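(* Let $q$ be a prime power and let $m$ and $d$ be odd integers with $1\le d\le m$. Let $Y$ be the set of quadratic forms $Q:\mathbb F_{q^m}\to\mathbb F_q$ (over $\mathbb F_q$) of the form \[ Q(x)=\sum_{i=(d-1)/2}^{(m-1)/2}\mathrm{Tr}_m(f_ix^{q^i+1}),\qquad f_i\in\mathbb F_{q^m}. \] Then $Y$ is additive (a subgroup of the additive group of quadratic forms) and is a $d$-code of size $q^{m(m-d+2)/2}$; moreover, this size is the largest possible size of a $d$-code in the set of quadratic forms on $\mathbb F_{q^m}$ (i.e. $Y$ is a maximal $d$-code).
   Context: $\mathrm{Tr}_m:\mathbb F_{q^m}\to\mathbb F_q$ is the relative trace $\mathrm{Tr}_m(y)=\sum_{i=1}^m y^{q^i}$. For a quadratic form $Q$ on an $\mathbb F_q$-vector space $V$, let $S_Q(x,y)=Q(x+y)-Q(x)-Q(y)$; the radical of $Q$ is $\{x\in V:S_Q(x,y)=0\ \forall y,\ Q(x)=0\}$ and the rank of $Q$ is the codimension of its radical. A set $Y$ of quadratic forms on $V$ is a $d$-code if $\operatorname{rank}(Q-Q')\ge d$ for all distinct $Q,Q'\in Y$. *)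

theory Defs
  imports Complex_Main "HOL-Library.Cardinality" "HOL-Algebra.Group" "HOL-Computational_Algebra.Computational_Algebra"
    "HOL-Number_Theory.Number_Theory"
begin

text \<open>
  The extension of finite fields is given by an embedding \<open>h\<close> of the base field \<open>'k\<close>
  into the extension field \<open>'v\<close>; injectivity is automatic.
\<close>

definition field_embedding :: "('k::field \<Rightarrow> 'v::field) \<Rightarrow> bool" where
  "field_embedding h \<longleftrightarrow>
     h 1 = 1 \<and> (\<forall>a b. h (a + b) = h a + h b) \<and> (\<forall>a b. h (a * b) = h a * h b)"

definition ext_scale :: "('k::field \<Rightarrow> 'v::field) \<Rightarrow> 'k \<Rightarrow> 'v \<Rightarrow> 'v" where
  "ext_scale h c x = h c * x"

text \<open>
  The power sum lies in the range of \<open>h\<close> (see \<open>embed_rel_trace\<close> below); \<open>inv_into UNIV h\<close> only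
  transports it back to the base field.
\<close>

definition rel_trace :: "('k::finite_field \<Rightarrow> 'v::finite_field) \<Rightarrow> nat \<Rightarrow> 'v \<Rightarrow> 'k" where
  "rel_trace h m y = inv_into UNIV h (\<Sum>i=1..m. y ^ (CARD('k) ^ i))"

text \<open>Below, \<open>s\<close> is the scalar multiplication of a vector space.\<close>

definition polar :: "('v::ab_group_add \<Rightarrow> 'k::field) \<Rightarrow> 'v \<Rightarrow> 'v \<Rightarrow> 'k" where
  "polar Q x y = Q (x + y) - Q x - Q y"

definition quadratic_form ::
    "('k::field \<Rightarrow> 'v::ab_group_add \<Rightarrow> 'v) \<Rightarrow> ('v \<Rightarrow> 'k) \<Rightarrow> bool" where
  "quadratic_form s Q \<longleftrightarrow>
     (\<forall>c x. Q (s c x) = c\<^sup>2 * Q x) \<and>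
     (\<forall>x. Vector_Spaces.linear s (*) (\<lambda>y. polar Q x y)) \<and>
     (\<forall>y. Vector_Spaces.linear s (*) (\<lambda>x. polar Q x y))"

definition qf_radical :: "('v::ab_group_add \<Rightarrow> 'k::field) \<Rightarrow> 'v set" where
  "qf_radical Q = {x. (\<forall>y. polar Q x y = 0) \<and> Q x = 0}"

text \<open>
  The codimension of the radical; meant for finite-dimensional spaces, where the truncated
  subtraction is exact.
\<close>

definition qf_rank ::
    "('k::field \<Rightarrow> 'v::ab_group_add \<Rightarrow> 'v) \<Rightarrow> ('v \<Rightarrow> 'k) \<Rightarrow> nat" where
  "qf_rank s Q = vector_space.dim s UNIV - vector_space.dim s (qf_radical Q)"

definition qf_group ::
    "('k::field \<Rightarrow> 'v::ab_group_add \<Rightarrow> 'v) \<Rightarrow> ('v \<Rightarrow> 'k) monoid" where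
  "qf_group s =
     \<lparr>carrier = {Q. quadratic_form s Q}, mult = (\<lambda>P Q x. P x + Q x), one = (\<lambda>x. 0)\<rparr>"

definition d_code ::
    "('k::field \<Rightarrow> 'v::ab_group_add \<Rightarrow> 'v) \<Rightarrow> nat \<Rightarrow> ('v \<Rightarrow> 'k) set \<Rightarrow> bool" where
  "d_code s d Y \<longleftrightarrow>
     (\<forall>Q\<in>Y. quadratic_form s Q) \<and>
     (\<forall>P\<in>Y. \<forall>Q\<in>Y. P \<noteq> Q \<longrightarrow> d \<le> qf_rank s (\<lambda>x. P x - Q x))"

definition trace_forms ::
    "('k::finite_field \<Rightarrow> 'v::finite_field) \<Rightarrow> nat \<Rightarrow> nat \<Rightarrow> ('v \<Rightarrow> 'k) set" where
  "trace_forms h m d =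
     {Q. \<exists>f :: nat \<Rightarrow> 'v. \<forall>x.
        Q x = (\<Sum>i = (d - 1) div 2..(m - 1) div 2. rel_trace h m (f i * x ^ (CARD('k) ^ i + 1)))}"

lemma field_embedding_zero:
  assumes "field_embedding h"
  shows "h 0 = 0"
  using assms unfolding field_embedding_def by (metis add_cancel_right_right)

lemma field_embedding_inj:
  assumes "field_embedding h"
  shows "inj h"
proof (rule injI)
  fix a b assume ab: "h a = h b"
  have "h (a - b) + h b = h a"
    using assms unfolding field_embedding_def by (metis diff_add_cancel)
  with ab have z: "h (a - b) = 0" by simp
  show "a = b"
  proof (rule ccontr)
    assume "a \<noteq> b"
    hence "h ((a - b) * inverse (a - b)) = 1"
      using assms unfolding field_embedding_def by simp
    moreover have "h ((a - b) * inverse (a - b)) = h (a - b) * h (inverse (a - b))"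
      using assms unfolding field_embedding_def by blast
    ultimately show False using z by simp
  qed
qed

lemma vector_space_ext_scale:
  assumes "field_embedding h"
  shows "vector_space (ext_scale h)"
  using assms unfolding field_embedding_def
  by unfold_locales (auto simp: ext_scale_def algebra_simps)

lemma range_field_embedding:
  fixes h :: "'k::finite_field \<Rightarrow> 'v::finite_field"
  assumes h: "field_embedding h"
  shows "range h = {y. y ^ CARD('k) = y}"
proof (rule card_seteq[symmetric, OF _ _ _, symmetric])
  show "finite {y::'v. y ^ CARD('k) = y}" by simp
  have pow: "h (x ^ n) = h x ^ n" for x n
    using h unfolding field_embedding_def by (induction n) auto
  show "range h \<subseteq> {y. y ^ CARD('k) = y}"
    by (auto simp: pow[symmetric] finite_field_power_card_eq_same)
  define p :: "'v poly" where "p = Polynomial.monom 1 CARD('k) - Polynomial.monom 1 1"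
  have q2: "CARD('k) > 1"
    using card_mono[of UNIV "{0::'k, 1}"] by simp
  have "Polynomial.coeff p CARD('k) = 1" using q2 by (simp add: p_def)
  hence p0: "p \<noteq> 0" by auto
  have "Polynomial.degree p \<le> CARD('k)"
    unfolding p_def using q2 by (intro degree_diff_le) (auto simp: degree_monom_eq)
  moreover have "{y. y ^ CARD('k) = y} = {y. poly p y = 0}"
    by (auto simp: p_def poly_monom)
  ultimately have "card {y::'v. y ^ CARD('k) = y} \<le> CARD('k)"
    using card_poly_roots_bound[OF p0] by simp
  also have "CARD('k) = card (range h)"
    using field_embedding_inj[OF h] by (simp add: card_image)
  finally show "card {y::'v. y ^ CARD('k) = y} \<le> card (range h)" .
qed

lemma embed_rel_trace:
  fixes h :: "'k::finite_field \<Rightarrow> 'v::finite_field"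
  assumes h: "field_embedding h" and q: "primepow CARD('k)" and m: "CARD('v) = CARD('k) ^ m"
    and "m > 0"
  shows "h (rel_trace h m y) = (\<Sum>i=1..m. y ^ (CARD('k) ^ i))"
proof -
  let ?q = "CARD('k)"
  obtain p k where p: "prime p" "k > 0" "?q = p ^ k" using q by (auto simp: primepow_def)
  have "CHAR('k) dvd p ^ k" using CHAR_dvd_CARD[where ?'a = 'k] p(3) by simp
  moreover have "prime CHAR('k)" by (simp add: prime_CHAR_semidom)
  ultimately have "CHAR('k) = p" using p by (metis prime_dvd_power primes_dvd_imp_eq)
  have "CHAR('v) dvd (p ^ k) ^ m" using CHAR_dvd_CARD[where ?'a = 'v] m p(3) by simp
  moreover have pv: "prime CHAR('v)" by (simp add: prime_CHAR_semidom)
  ultimately have "CHAR('v) = p" using p by (metis prime_dvd_power primes_dvd_imp_eq)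
  hence qv: "?q = CHAR('v) ^ k" using p by simp
  have "(\<Sum>i=1..m. y ^ (?q ^ i)) ^ ?q = (\<Sum>i=1..m. (y ^ (?q ^ i)) ^ ?q)"
    by (rule freshmans_dream_sum'[OF pv qv])
  also have "\<dots> = (\<Sum>i=1..m. y ^ (?q ^ Suc i))"
    by (simp add: power_mult[symmetric] mult.commute)
  also have "\<dots> = (\<Sum>i=2..Suc m. y ^ (?q ^ i))"
    by (rule sum.reindex_bij_witness[of _ "\<lambda>i. i - 1" Suc]) auto
  also have "\<dots> = (\<Sum>i=1..m. y ^ (?q ^ i))"
  proof -
    have e: "y ^ (?q ^ Suc m) = y ^ ?q"
      by (simp add: power_mult m[symmetric] finite_field_power_card_eq_same mult.commute[of ?q] del: power_Suc add: power_Suc2)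
    have "(\<Sum>i=2..Suc m. y ^ (?q ^ i)) = (\<Sum>i=2..m. y ^ (?q ^ i)) + y ^ (?q ^ Suc m)"
      using \<open>m > 0\<close> by simp
    also have "\<dots> = y ^ (?q ^ 1) + (\<Sum>i=2..m. y ^ (?q ^ i))" using e by simp
    also have "\<dots> = (\<Sum>i=1..m. y ^ (?q ^ i))"
      using \<open>m > 0\<close> by (subst (2) sum.atLeast_Suc_atMost) (auto simp: numeral_2_eq_2)
    finally show ?thesis .
  qed
  finally have "(\<Sum>i=1..m. y ^ (?q ^ i)) \<in> range h"
    using range_field_embedding[OF h] by auto
  thus ?thesis unfolding rel_trace_def by (rule f_inv_into_f)
qed

lemma comm_group_qf_group:
  assumes "vector_space s"
  shows "comm_group (qf_group s)"
proof -
  interpret V: vector_space s by fact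
  have lin: "Vector_Spaces.linear s (*) f \<longleftrightarrow>
      (\<forall>x y. f (x + y) = f x + f y) \<and> (\<forall>c x. f (s c x) = c * f x)" for f :: "'b \<Rightarrow> 'a"
  proof -
    interpret K: vector_space "(*) :: 'a \<Rightarrow> 'a \<Rightarrow> 'a"
      by unfold_locales (auto simp: algebra_simps)
    show ?thesis
      by (auto simp: Vector_Spaces.linear_def module_hom_def module_hom_axioms_def V.module_axioms
          K.module_axioms V.vector_space_axioms K.vector_space_axioms)
  qed
  have cl: "quadratic_form s (\<lambda>x. P x + Q x)" if "quadratic_form s P" "quadratic_form s Q" for P Q
  proof -
    have *: "polar (\<lambda>x. P x + Q x) x y = polar P x y + polar Q x y" for x y
      by (simp add: polar_def)
    from that show ?thesis
      unfolding quadratic_form_def lin * by (simp add: algebra_simps)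
  qed
  have mi: "quadratic_form s (\<lambda>x. - Q x)" if "quadratic_form s Q" for Q
  proof -
    have *: "polar (\<lambda>x. - Q x) x y = - polar Q x y" for x y
      by (simp add: polar_def)
    from that show ?thesis
      unfolding quadratic_form_def lin * by simp
  qed
  have ze: "quadratic_form s (\<lambda>x. 0)"
    unfolding quadratic_form_def lin by (simp add: polar_def)
  show ?thesis
  proof (rule comm_groupI)
    fix Q assume "Q \<in> carrier (qf_group s)"
    thus "\<exists>P\<in>carrier (qf_group s). P \<otimes>\<^bsub>qf_group s\<^esub> Q = \<one>\<^bsub>qf_group s\<^esub>"
      by (intro bexI[of _ "\<lambda>x. - Q x"]) (auto simp: qf_group_def mi)
  qed (auto simp: qf_group_def cl ze add_ac)
qed

end

theory Submission
  imports Defs "HOL-Library.Function_Algebras" "HOL-Library.Nonpos_Ints"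
begin

text \<open>
  Write \<open>cl Q\<close> for half the rank of a quadratic form, rounded up, and \<open>n\<close> for \<open>(m + 1) div 2\<close>.
  The argument is Delsarte's linear programming method with the test function
  \<open>F Q = gbin (q\<^sup>2) (n - cl Q) (n - t)\<close>, where \<open>d = 2 t + 1\<close>; it vanishes exactly on the forms of rank
  at least \<open>d\<close>. Removing one coordinate from a form either keeps \<open>cl\<close> or lowers it by one, and the
  fibre sums of additive characters over the extensions that keep it have a closed form.
  Restricting to the kernel of a functional that is isotropic for the dual symmetric bilinear form
  gives a recursion for the Fourier transform of \<open>F\<close>. It shows that the transform is nonnegative,
  that it vanishes where the dual form has large rank, and it evaluates the transform at \<open>0\<close>.
  Nonnegativity yields the upper bound on codes. The annihilator of the trace forms contains
  nonzero dual forms of large rank only, since their radicals are kernels of \<open>q\<close>-polynomials of small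
  degree; hence the sum of \<open>F\<close> over the trace forms is \<open>F 0\<close>, and all nonzero ones have rank at
  least \<open>d\<close>. This works uniformly in even and odd characteristic.
\<close>

text \<open>Ranks \<open>2 * i - 1\<close> and \<open>2 * i\<close> are merged because a form of
  either rank on a hyperplane has exactly \<open>q ^ (2 * i)\<close> extensions that keep
  \<open>cl\<close>, although the two counts arise differently (\<open>sum_stay\<close>). Hence the
  base \<open>q\<^sup>2\<close> of the Gaussian binomials, and hence odd \<open>d\<close>:
  \<open>cl Q > t\<close> says the same as rank at least \<open>2 * t + 1\<close>. The dual of the
  space of quadratic forms consists of symmetric bilinear forms on the dual space; in characteristic
  2 these are a different kind of object, so the transform is never read as a function on quadratic
  forms. The recursion requires an isotropic functional, which is guaranteed from dimension 3 on;
  this fixes its base case. With \<open>k = n - t\<close> the transform vanishes unless the dual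
  form has rank at most \<open>2 * k = m + 1 - 2 * t\<close>, whereas the
  \<open>q\<close>-polynomials of the annihilator leave rank at least
  \<open>m - (2 * t - 2)\<close>, one more. That margin of one makes the bound and the code
  meet.\<close>

lemma square_surj_char_2:
  fixes a :: "'a::finite_field"
  assumes "(2::'a) = 0"
  obtains c where "(c::'a)\<^sup>2 = a"
proof -
  have "inj (\<lambda>c::'a. c\<^sup>2)"
  proof (rule injI)
    fix x y :: 'a assume "x\<^sup>2 = y\<^sup>2"
    hence "(x - y)\<^sup>2 = 2 * (y\<^sup>2 - x * y)" by (simp add: power2_eq_square algebra_simps)
    thus "x = y" using assms by simp
  qed
  hence "surj (\<lambda>c::'a. c\<^sup>2)" by (simp add: finite_UNIV_inj_surj)
  thus thesis using that by (metis surjD)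
qed

text \<open>One nontrivial additive character \<open>\<psi>\<close> of the base field is a
  parameter. Characters of the other groups (vectors, functionals, quadratic forms) arise by
  composing it with additive maps into \<open>'k\<close>.\<close>

locale finite_space = vector_space scale
  for scale :: "'k::finite_field \<Rightarrow> 'v::{ab_group_add,finite} \<Rightarrow> 'v" (infixr "*s" 75) +
  fixes \<psi> :: "'k \<Rightarrow> complex"
  assumes psi_add: "\<psi> (x + y) = \<psi> x * \<psi> y"
    and norm_psi: "norm (\<psi> x) = 1"
    and psi_nontrivial: "\<exists>x. \<psi> x \<noteq> 1"
begin

sublocale finite_dimensional_vector_space scale "extend_basis {}"
  by unfold_locales (auto simp: independent_extend_basis independent_empty span_extend_basis)

declare dim_UNIV [simp del]

subsection \<open>Character sums\<close>

lemma psi_zero: "\<psi> 0 = 1"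
  using psi_add[of 0 0] norm_psi[of 0] by (metis add.right_neutral mult_cancel_right1 norm_zero zero_neq_one)

lemma psi_minus: "\<psi> (- x) = cnj (\<psi> x)"
proof -
  have "\<psi> (- x) * \<psi> x = 1" using psi_add[of "- x" x] psi_zero by simp
  moreover have "\<psi> x * cnj (\<psi> x) = 1" by (simp add: complex_norm_square[symmetric] norm_psi)
  ultimately show ?thesis by (metis mult.assoc mult.commute mult.right_neutral)
qed

lemma psi_nontrivial_multiple:
  assumes "c \<noteq> 0" shows "\<exists>a. \<psi> (a * c) \<noteq> 1"
proof -
  obtain x where "\<psi> x \<noteq> 1" using psi_nontrivial by blast
  hence "\<psi> ((x / c) * c) \<noteq> 1" using assms by simp
  thus ?thesis by blast
qed

text \<open>Translation by \<open>g\<close> permutes \<open>G\<close> and multiplies the sum by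
  \<open>\<psi> (\<theta> g)\<close>, which is not 1.\<close>

lemma char_sum_zero:
  fixes G :: "'a::ab_group_add set"
  assumes "finite G" and closed: "\<And>x y. x \<in> G \<Longrightarrow> y \<in> G \<Longrightarrow> x + y \<in> G"
    and hom: "\<And>x y. x \<in> G \<Longrightarrow> y \<in> G \<Longrightarrow> \<theta> (x + y) = \<theta> x + \<theta> y"
    and g: "g \<in> G" "\<psi> (\<theta> g) \<noteq> 1"
  shows "(\<Sum>x\<in>G. \<psi> (\<theta> x)) = 0"
proof -
  have "(+) g ` G = G"
    using assms by (intro endo_inj_surj) (auto simp: inj_on_def)
  hence bij: "bij_betw ((+) g) G G" by (simp add: bij_betw_def inj_on_def)
  have "(\<Sum>x\<in>G. \<psi> (\<theta> x)) = (\<Sum>x\<in>G. \<psi> (\<theta> (g + x)))"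
    by (rule sum.reindex_bij_betw[OF bij, symmetric])
  also have "\<dots> = (\<Sum>x\<in>G. \<psi> (\<theta> g) * \<psi> (\<theta> x))"
    by (rule sum.cong) (simp_all add: hom g psi_add)
  also have "\<dots> = \<psi> (\<theta> g) * (\<Sum>x\<in>G. \<psi> (\<theta> x))" by (simp add: sum_distrib_left)
  finally show ?thesis using g by simp
qed

subsection \<open>Linear functionals and hyperplanes\<close>

text \<open>Functionals on a subspace are total functions pinned to 0 outside it, so that each is
  represented once and the set can be counted. \<open>quad\<close> follows the same
  convention.\<close>

definition lf :: "'v set \<Rightarrow> ('v \<Rightarrow> 'k) set" where
  "lf V = {l. (\<forall>x. x \<notin> V \<longrightarrow> l x = 0) \<and> (\<forall>x\<in>V. \<forall>y\<in>V. l (x + y) = l x + l y) \<and>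
     (\<forall>c. \<forall>x\<in>V. l (c *s x) = c * l x)}"

definition ann :: "'v set \<Rightarrow> 'v set \<Rightarrow> ('v \<Rightarrow> 'k) set" where
  "ann V R = {l \<in> lf V. \<forall>x\<in>R. l x = 0}"

text \<open>\<open>V'\<close> is a hyperplane of \<open>V\<close> and \<open>e\<close> spans a
  complement; every recursion below moves along such a splitting.\<close>

definition dsum :: "'v set \<Rightarrow> 'v \<Rightarrow> 'v set \<Rightarrow> bool" where
  "dsum V' e V \<longleftrightarrow> subspace V' \<and> e \<notin> V' \<and> V = {x + c *s e | x c. x \<in> V'}"

definition coord :: "'v set \<Rightarrow> 'v \<Rightarrow> 'v \<Rightarrow> 'k" where
  "coord V' e v = (THE c. v - c *s e \<in> V')"

lemma separation:
  assumes "subspace R" "v \<notin> R"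
  obtains l where "\<And>x y. l (x + y) = l x + l y" "\<And>c x. l (c *s x) = c * l x"
    "\<And>x. x \<in> R \<Longrightarrow> l x = 0" "l v = 1"
proof -
  obtain B where B: "B \<subseteq> R" "independent B" "R \<subseteq> span B" "card B = dim R"
    by (rule basis_exists)
  have sp: "span B = R" using span_minimal[of B R] B assms by blast
  have ind: "independent (insert v B)" using B assms sp by (intro independent_insertI) auto
  define E where "E = extend_basis (insert v B)"
  have E: "independent E" "span E = UNIV" "insert v B \<subseteq> E"
    using ind extend_basis_superset[OF ind]
    by (simp_all add: E_def independent_extend_basis span_extend_basis)
  show thesis
  proof (rule that[of "\<lambda>x. representation E x v"])
    show "representation E (x + y) v = representation E x v + representation E y v" for x y
      using E by (simp add: representation_add)
    show "representation E (c *s x) v = c * representation E x v" for c x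
      using E by (simp add: representation_scale)
    show "representation E v v = 1" using E by (simp add: representation_basis)
    fix x assume "x \<in> R"
    hence "x \<in> span B" using sp by simp
    hence "representation E x = representation B x"
      using E by (intro representation_extend) auto
    moreover have "representation B x v = 0"
      using representation_ne_zero[of B x v] B assms by auto
    ultimately show "representation E x v = 0" by simp
  qed
qed

lemma lf_separation:
  assumes "subspace R" "subspace V" "v \<in> V" "v \<notin> R"
  obtains l where "l \<in> ann V R" "l v = 1"
proof -
  obtain l where l: "\<And>x y. l (x + y) = l x + l y" "\<And>c x. l (c *s x) = c * l x"
    "\<And>x. x \<in> R \<Longrightarrow> l x = 0" "l v = 1"
    using separation[OF assms(1,4)] by blast
  show thesis
    by (rule that[of "\<lambda>x. if x \<in> V then l x else 0"])
      (use assms l in \<open>auto simp: ann_def lf_def subspace_add subspace_scale\<close>)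
qed

lemma lf_simps:
  assumes "l \<in> lf V"
  shows "x \<in> V \<Longrightarrow> y \<in> V \<Longrightarrow> l (x + y) = l x + l y"
    and "x \<in> V \<Longrightarrow> l (c *s x) = c * l x" and "x \<notin> V \<Longrightarrow> l x = 0"
  using assms by (auto simp: lf_def)

lemma lf_zero: "subspace V \<Longrightarrow> l \<in> lf V \<Longrightarrow> l 0 = 0"
  using lf_simps(2)[of l V 0 0] by (simp add: subspace_0)

lemma lf_minus: "subspace V \<Longrightarrow> l \<in> lf V \<Longrightarrow> x \<in> V \<Longrightarrow> y \<in> V \<Longrightarrow> l (x - y) = l x - l y"
  using lf_simps(1)[of l V "x - y" y] by (simp add: subspace_diff)

lemma lf_sum:
  assumes V: "subspace V" and "l \<in> lf V" "\<And>i. i \<in> I \<Longrightarrow> f i \<in> V"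
  shows "l (sum f I) = (\<Sum>i\<in>I. l (f i))"
proof (cases "finite I")
  case True
  thus ?thesis using assms(3)
  proof (induction I rule: finite_induct)
    case (insert i I)
    thus ?case using lf_simps(1)[OF assms(2), of "f i" "sum f I"] V
      by (simp add: subspace_sum)
  qed (simp add: lf_zero[OF V assms(2)])
qed (simp add: lf_zero[OF V assms(2)])

lemma ann_zero: "subspace V \<Longrightarrow> ann V {0} = lf V"
  by (auto simp: ann_def lf_zero)

lemma zero_ann: "(\<lambda>x. 0) \<in> ann V R" "0 \<in> ann V R"
  by (auto simp: ann_def lf_def)

lemma ann_add: "f \<in> ann V R \<Longrightarrow> g \<in> ann V R \<Longrightarrow> f + g \<in> ann V R"
  by (auto simp: ann_def lf_def algebra_simps)

lemma ann_scale: "f \<in> ann V R \<Longrightarrow> (\<lambda>x. c * f x) \<in> ann V R"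
  by (auto simp: ann_def lf_def algebra_simps)

lemma lf_add: "f \<in> lf V \<Longrightarrow> g \<in> lf V \<Longrightarrow> (\<lambda>x. f x + g x) \<in> lf V"
  by (auto simp: lf_def algebra_simps)

lemma lf_scale: "f \<in> lf V \<Longrightarrow> (\<lambda>x. c * f x) \<in> lf V"
  by (auto simp: lf_def algebra_simps)

lemma lf_diff: "f \<in> lf V \<Longrightarrow> g \<in> lf V \<Longrightarrow> (\<lambda>x. f x - g x) \<in> lf V"
  by (auto simp: lf_def algebra_simps)

lemma sum_psi_ann:
  assumes "subspace V" "subspace R" "v \<in> V"
  shows "(\<Sum>l\<in>ann V R. \<psi> (l v)) = (if v \<in> R then of_nat (card (ann V R)) else 0)"
proof (cases "v \<in> R")
  case True
  thus ?thesis by (simp add: ann_def psi_zero)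
next
  case False
  obtain l where l: "l \<in> ann V R" "l v = 1" using lf_separation[OF assms(2,1,3) False] by blast
  obtain a where a: "\<psi> (a * 1) \<noteq> 1" using psi_nontrivial_multiple[of 1] by auto
  have "(\<Sum>l\<in>ann V R. \<psi> (l v)) = 0"
    by (rule char_sum_zero[where g = "\<lambda>x. a * l x"]) (use l a ann_add ann_scale in auto)
  thus ?thesis using False by simp
qed

lemma sum_psi_lf_values:
  assumes "subspace V" "l \<in> lf V"
  shows "(\<Sum>v\<in>V. \<psi> (l v)) = (if l = (\<lambda>x. 0) then of_nat (card V) else 0)"
proof (cases "l = (\<lambda>x. 0)")
  case True
  thus ?thesis by (simp add: psi_zero)
next
  case False
  then obtain v where "l v \<noteq> 0" by auto
  hence v: "v \<in> V" using assms by (auto simp: lf_def)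
  obtain a where a: "\<psi> (a * l v) \<noteq> 1" using psi_nontrivial_multiple[of "l v"] \<open>l v \<noteq> 0\<close> by auto
  have "(\<Sum>v\<in>V. \<psi> (l v)) = 0"
    by (rule char_sum_zero[where g = "a *s v"])
      (use v a assms in \<open>auto simp: lf_simps subspace_add subspace_scale\<close>)
  thus ?thesis using False by simp
qed

text \<open>Summing \<open>\<psi> (l v)\<close> over \<open>ann V R\<close> and \<open>V\<close> in
  both orders gives the count without dual bases.\<close>

lemma card_ann:
  assumes V: "subspace V" and R: "subspace R" and RV: "R \<subseteq> V"
  shows "card (ann V R) * card R = card V"
proof -
  have "(\<Sum>l\<in>ann V R. \<Sum>v\<in>V. \<psi> (l v)) = (\<Sum>l\<in>ann V R. if l = (\<lambda>x. 0) then of_nat (card V) else 0)"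
    by (rule sum.cong) (auto simp: ann_def sum_psi_lf_values[OF V])
  hence 1: "(\<Sum>l\<in>ann V R. \<Sum>v\<in>V. \<psi> (l v)) = of_nat (card V)"
    using zero_ann(1)[of V R] by simp
  have "(\<Sum>v\<in>V. \<Sum>l\<in>ann V R. \<psi> (l v)) = (\<Sum>v\<in>V. if v \<in> R then of_nat (card (ann V R)) else 0)"
    by (rule sum.cong) (auto simp: sum_psi_ann[OF V R])
  also have "\<dots> = of_nat (card (ann V R) * card R)"
    using RV by (simp add: sum.If_cases Int_absorb1)
  finally have "of_nat (card (ann V R) * card R) = (of_nat (card V) :: complex)"
    using 1 by (subst (asm) sum.swap) simp
  thus ?thesis by (simp only: of_nat_eq_iff)
qed

lemma card_lf: "subspace V \<Longrightarrow> card (lf V) = card V"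
  using card_ann[of V "{0}"] by (simp add: ann_zero subspace_0)

lemma
  assumes "dsum V' e V"
  shows dsum_subspace': "subspace V'" and dsum_subspace: "subspace V"
    and dsum_subset: "V' \<subseteq> V" and dsum_vector: "e \<in> V" and dsum_notin: "e \<notin> V'"
    and dsum_add: "x \<in> V' \<Longrightarrow> x + c *s e \<in> V"
    and dsum_unique: "x \<in> V' \<Longrightarrow> y \<in> V' \<Longrightarrow> x + c *s e = y + d *s e \<Longrightarrow> x = y \<and> c = d"
    and dsum_dim: "dim V = Suc (dim V')"
proof -
  have V': "subspace V'" "e \<notin> V'" and V: "V = {x + c *s e | x c. x \<in> V'}"
    using assms by (auto simp: dsum_def)
  have sp: "V = span (insert e V')"
    using V' unfolding V span_insert
    by (auto simp: span_eq_iff[THEN iffD2]) (metis add_diff_cancel, metis diff_add_cancel)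
  show "subspace V'" "e \<notin> V'" "subspace V" "V' \<subseteq> V" "e \<in> V"
    using V' by (auto simp: sp span_base)
  show "x \<in> V' \<Longrightarrow> x + c *s e \<in> V" using V by auto
  show "dim V = Suc (dim V')" using V' by (simp add: sp dim_insert span_eq_iff[THEN iffD2])
  assume x: "x \<in> V'" "y \<in> V'" and eq: "x + c *s e = y + d *s e"
  have "(c - d) *s e = y - x" using eq by (simp add: scale_left_diff_distrib algebra_simps)
  hence "(c - d) *s e \<in> V'" using x V' by (simp add: subspace_diff)
  hence "inverse (c - d) *s (c - d) *s e \<in> V'" using V' subspace_scale by blast
  hence "c - d \<noteq> 0 \<Longrightarrow> e \<in> V'" by (simp del: scale_cancel_left)
  hence "c = d" using V' by auto
  thus "x = y \<and> c = d" using eq by simp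
qed

lemma dsum_cases:
  assumes "dsum V' e V" "v \<in> V"
  obtains x c where "x \<in> V'" "v = x + c *s e"
  using assms by (auto simp: dsum_def)

lemma coord_eq:
  assumes "dsum V' e V" "x \<in> V'"
  shows "coord V' e (x + c *s e) = c"
  unfolding coord_def
proof (rule the_equality)
  show "x + c *s e - c *s e \<in> V'" using assms by simp
  fix d assume "x + c *s e - d *s e \<in> V'"
  from dsum_unique[OF assms(1) this assms(2), of d c] show "d = c" by simp
qed

lemma dsum_sum:
  assumes "dsum V' e V"
  shows "(\<Sum>v\<in>V. g v) = (\<Sum>x\<in>V'. \<Sum>c\<in>UNIV. g (x + c *s e))"
proof -
  have "bij_betw (\<lambda>(x, c). x + c *s e) (V' \<times> UNIV) V"
    using assms dsum_unique[OF assms]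
    by (auto simp: bij_betw_def inj_on_def dsum_def image_iff)
  from sum.reindex_bij_betw[OF this, of g, symmetric]
  show ?thesis by (simp add: sum.cartesian_product case_prod_unfold)
qed

lemma dsum_card: "dsum V' e V \<Longrightarrow> card V = CARD('k) * card V'"
  using dsum_sum[of V' e V "\<lambda>_. 1::nat"] by simp

lemma dsum_kernel:
  assumes "subspace V" "\<phi> \<in> lf V" "e \<in> V" "\<phi> e = 1"
  shows "dsum {x \<in> V. \<phi> x = 0} e V"
  unfolding dsum_def
proof (intro conjI Set.set_eqI iffI)
  show "subspace {x \<in> V. \<phi> x = 0}"
    using assms by (auto simp: subspace_def lf_simps lf_zero)
  show "e \<notin> {x \<in> V. \<phi> x = 0}" using assms by simp
  fix v assume v: "v \<in> V"
  have "v - \<phi> v *s e \<in> V" "\<phi> (v - \<phi> v *s e) = 0"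
    using v assms by (auto simp: subspace_diff subspace_scale lf_minus lf_simps)
  thus "v \<in> {x + c *s e |x c. x \<in> {x \<in> V. \<phi> x = 0}}"
    by (intro CollectI exI[of _ "v - \<phi> v *s e"] exI[of _ "\<phi> v"]) auto
next
  fix v assume "v \<in> {x + c *s e |x c. x \<in> {x \<in> V. \<phi> x = 0}}"
  thus "v \<in> V" using assms by (auto simp: subspace_add subspace_scale)
qed

lemma dsum_exists:
  assumes "subspace V" "v \<in> V" "v \<noteq> 0"
  obtains V' where "dsum V' v V"
proof -
  obtain l where "l \<in> ann V {0}" "l v = 1"
    using lf_separation[of "{0}" V v] assms by (auto simp: subspace_0)
  thus thesis using dsum_kernel[of V l v] assms that by (auto simp: ann_def)
qed

lemma subspace_dsum_induct [consumes 1, case_names zero dsum]: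
  assumes "subspace V" and "P {0}" and "\<And>V' e V. dsum V' e V \<Longrightarrow> P V' \<Longrightarrow> P V"
  shows "P V"
  using assms(1)
proof (induction "dim V" arbitrary: V rule: less_induct)
  case less
  show ?case
  proof (cases "V = {0}")
    case True
    thus ?thesis using assms by simp
  next
    case False
    then obtain v where "v \<in> V" "v \<noteq> 0" using subspace_0[OF less.prems] by auto
    then obtain V' where "dsum V' v V" using dsum_exists less.prems by blast
    thus ?thesis using less.hyps[of V'] assms(3)[of V' v V] dsum_dim dsum_subspace' by simp
  qed
qed

lemma card_subspace: "subspace V \<Longrightarrow> card V = CARD('k) ^ dim V"
proof (induction V rule: subspace_dsum_induct)
  case zero
  have "dim {0} = 0" by simp
  then show ?case by simp
next
  case (dsum V' e V)
  thus ?case by (simp add: dsum_card dsum_dim)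
qed

lemma q_gt_1: "CARD('k) > 1"
  using card_mono[of UNIV "{0::'k, 1}"] by simp

lemma card_ann_dim:
  assumes "subspace V" "subspace R" "R \<subseteq> V"
  shows "card (ann V R) = CARD('k) ^ (dim V - dim R)"
proof -
  have "dim R \<le> dim V" using assms by (intro dim_subset)
  hence "CARD('k) ^ dim V = CARD('k) ^ (dim V - dim R) * CARD('k) ^ dim R"
    by (simp add: power_add[symmetric])
  thus ?thesis using card_ann[OF assms] assms q_gt_1 by (simp add: card_subspace)
qed

text \<open>The condition is on the fibres of \<open>f\<close> and not on its linearity, because
  \<open>sum_stay\<close> applies this to a map with a quadratic component.\<close>

lemma sum_fibres:
  fixes g :: "'b \<Rightarrow> complex"
  assumes V: "subspace V" and R: "subspace R" "R \<subseteq> V"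
    and f: "\<And>x y. x \<in> V \<Longrightarrow> y \<in> V \<Longrightarrow> f x = f y \<longleftrightarrow> x - y \<in> R"
  shows "(\<Sum>x\<in>V. g (f x)) = of_nat (card R) * (\<Sum>y\<in>f ` V. g y)"
proof -
  have fib: "card {x \<in> V. f x = y} = card R" if y: "y \<in> f ` V" for y
  proof -
    obtain w where w: "w \<in> V" "y = f w" using y by auto
    have "{x \<in> V. f x = y} = (+) w ` R"
    proof (intro Set.set_eqI iffI)
      fix x assume "x \<in> {x \<in> V. f x = y}"
      thus "x \<in> (+) w ` R" using w f by (intro image_eqI[of _ _ "x - w"]) auto
    next
      fix x assume "x \<in> (+) w ` R"
      then obtain r where r: "r \<in> R" "x = w + r" by auto
      hence "x \<in> V" using w R V by (auto intro: subspace_add)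
      thus "x \<in> {x \<in> V. f x = y}" using f[of x w] w r by simp
    qed
    thus ?thesis by (simp add: card_image)
  qed
  have "(\<Sum>x\<in>V. g (f x)) = (\<Sum>y\<in>f ` V. \<Sum>x\<in>{x \<in> V. f x = y}. g (f x))"
    by (rule sum.image_gen) simp
  also have "\<dots> = (\<Sum>y\<in>f ` V. of_nat (card R) * g y)"
    by (rule sum.cong) (simp_all add: fib)
  finally show ?thesis by (simp add: sum_distrib_left)
qed

lemma card_fibres:
  assumes "subspace V" "subspace R" "R \<subseteq> V"
    "\<And>x y. x \<in> V \<Longrightarrow> y \<in> V \<Longrightarrow> f x = f y \<longleftrightarrow> x - y \<in> R"
  shows "card V = card R * card (f ` V)"
  using sum_fibres[OF assms, of "\<lambda>_. 1"] by (simp flip: of_nat_mult)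


subsection \<open>Bilinear forms\<close>

definition bilin :: "'v set \<Rightarrow> ('v \<Rightarrow> 'v \<Rightarrow> 'k) \<Rightarrow> bool" where
  "bilin V B \<longleftrightarrow>
     (\<forall>x\<in>V. \<forall>y\<in>V. \<forall>z\<in>V. B (x + y) z = B x z + B y z \<and> B x (y + z) = B x y + B x z) \<and>
     (\<forall>c. \<forall>x\<in>V. \<forall>y\<in>V. B (c *s x) y = c * B x y \<and> B x (c *s y) = c * B x y)"

text \<open>Common weakening of symmetric and alternating, the two cases in which
  \<open>ann_brad_represented\<close> is applied.\<close>

definition refl_form :: "'v set \<Rightarrow> ('v \<Rightarrow> 'v \<Rightarrow> 'k) \<Rightarrow> bool" where
  "refl_form V B \<longleftrightarrow> (\<forall>x\<in>V. \<forall>y\<in>V. B x y = 0 \<longrightarrow> B y x = 0)"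

definition brad :: "'v set \<Rightarrow> ('v \<Rightarrow> 'v \<Rightarrow> 'k) \<Rightarrow> 'v set" where
  "brad V B = {x \<in> V. \<forall>y\<in>V. B x y = 0}"

lemma bilinD:
  assumes "bilin V B" "x \<in> V" "y \<in> V"
  shows "z \<in> V \<Longrightarrow> B (x + y) z = B x z + B y z" "z \<in> V \<Longrightarrow> B z (x + y) = B z x + B z y"
    "B (c *s x) y = c * B x y" "B x (c *s y) = c * B x y"
  using assms by (auto simp: bilin_def)

lemma bilin_diff:
  assumes "bilin V B" "subspace V" "x \<in> V" "y \<in> V" "z \<in> V"
  shows "B (x - y) z = B x z - B y z"
  using bilinD(1)[OF assms(1), of "x - y" y z] assms by (simp add: subspace_diff)

lemma bilin_zero:
  assumes "bilin V B" "subspace V" "x \<in> V"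
  shows "B 0 x = 0" "B x 0 = 0"
  using bilinD(3)[OF assms(1), of 0 x 0] bilinD(4)[OF assms(1), of x 0 0] assms by (simp_all add: subspace_0)

lemma bilin_mono: "bilin V B \<Longrightarrow> V' \<subseteq> V \<Longrightarrow> bilin V' B"
  unfolding bilin_def by blast

lemma subspace_brad:
  assumes "bilin V B" "subspace V"
  shows "subspace (brad V B)"
  using assms bilin_zero[OF assms] by (auto simp: subspace_def brad_def bilinD)

lemma brad_subset: "brad V B \<subseteq> V"
  by (auto simp: brad_def)

lemma bilin_lf:
  assumes "bilin V B" "subspace V" "w \<in> V"
  shows "(\<lambda>y. if y \<in> V then B w y else 0) \<in> lf V"
  using assms by (auto simp: lf_def subspace_add subspace_scale bilinD)

lemma bilin_fibre:
  assumes "bilin V B" "subspace V" "x \<in> V" "y \<in> V"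
  shows "(\<lambda>z. if z \<in> V then B x z else 0) = (\<lambda>z. if z \<in> V then B y z else 0) \<longleftrightarrow> x - y \<in> brad V B"
  using assms bilin_diff[OF assms] by (auto simp: fun_eq_iff brad_def subspace_diff)

text \<open>The map sending \<open>w\<close> to \<open>B w\<close> has fibres the cosets of the
  radical, and reflexivity puts its image into \<open>ann V (brad V B)\<close>. By
  \<open>card_ann\<close> both sets have the same size, so they agree.\<close>

lemma ann_brad_represented:
  assumes B: "bilin V B" and V: "subspace V" and r: "refl_form V B" and l: "l \<in> ann V (brad V B)"
  obtains w where "w \<in> V" "\<And>y. y \<in> V \<Longrightarrow> l y = B w y"
proof -
  define f where "f w = (\<lambda>y. if y \<in> V then B w y else 0)" for w
  have R: "subspace (brad V B)" "brad V B \<subseteq> V" using subspace_brad[OF B V] brad_subset by auto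
  have "card V = card (brad V B) * card (f ` V)"
    using card_fibres[OF V R, of f] bilin_fibre[OF B V] by (simp add: f_def)
  moreover have "card (ann V (brad V B)) * card (brad V B) = card V"
    using card_ann[OF V R] .
  moreover have "card (brad V B) > 0" using R by (auto simp: card_gt_0_iff subspace_def)
  ultimately have "card (f ` V) = card (ann V (brad V B))"
    by (metis mult.commute nat_mult_eq_cancel1)
  moreover have "f ` V \<subseteq> ann V (brad V B)"
    using r bilin_lf[OF B V] by (auto simp: f_def ann_def brad_def refl_form_def)
  ultimately have "f ` V = ann V (brad V B)" by (intro card_subset_eq) auto
  then obtain w where "w \<in> V" "l = f w" using l by auto
  thus thesis using that by (auto simp: f_def)
qed

text \<open>Adding \<open>e\<close> to a hyperplane with radical \<open>R\<close> changes the rank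
  by 2 or 0: either \<open>e\<close> pairs nontrivially with \<open>R\<close>, which then loses one
  dimension, or \<open>e\<close> can be corrected by a vector of the hyperplane so that it joins the
  radical.\<close>

lemma even_alternating_rank:
  assumes "subspace V" "bilin V B" "\<And>x. x \<in> V \<Longrightarrow> B x x = 0"
  shows "even (dim V - dim (brad V B))"
  using assms
proof (induction V rule: subspace_dsum_induct)
  case zero
  thus ?case by simp
next
  case (dsum V' e V)
  note V' = dsum_subspace'[OF dsum(1)] and V = dsum_subspace[OF dsum(1)]
    and sub = dsum_subset[OF dsum(1)] and eV = dsum_vector[OF dsum(1)]
  note B = dsum.prems(1) and alt = dsum.prems(2)
  have B': "bilin V' B" using bilin_mono[OF B sub] .
  have skew: "B x y = - B y x" if "x \<in> V" "y \<in> V" for x y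
  proof -
    have "B (x + y) (x + y) = B x x + B x y + (B y x + B y y)"
      using that V by (simp add: bilinD[OF B] subspace_add)
    moreover have "B (x + y) (x + y) = 0" using alt that V by (simp add: subspace_add)
    ultimately have "B x y + B y x = 0" using alt that by simp
    thus ?thesis by (simp add: eq_neg_iff_add_eq_0)
  qed
  have rf: "refl_form V' B" using skew sub unfolding refl_form_def by (metis minus_zero subsetD)
  define R where "R = brad V' B"
  have R: "subspace R" "R \<subseteq> V'" using subspace_brad[OF B' V'] brad_subset by (auto simp: R_def)
  have IH: "even (dim V' - dim R)" using dsum.IH B' alt sub by (auto simp: R_def)
  have dR: "dim R \<le> dim V'" using R by (intro dim_subset)
  show ?case
  proof (cases "\<exists>y\<in>R. B e y \<noteq> 0")
    case True
    then obtain y0 where y0: "y0 \<in> R" "B e y0 \<noteq> 0" by blast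
    define y1 where "y1 = inverse (B e y0) *s y0"
    have y1: "y1 \<in> R" "B e y1 = 1"
      using y0 R sub eV by (auto simp: y1_def subspace_scale bilinD[OF B])
    have RV: "x \<in> V" if "x \<in> R" for x using that R sub by auto
    have "(\<lambda>y. if y \<in> R then B e y else 0) \<in> lf R"
      using eV R by (auto simp: lf_def RV bilinD[OF B] subspace_add subspace_scale)
    from dsum_kernel[OF R(1) this y1(1)] y1
    have d: "dim R = Suc (dim {x \<in> R. B e x = 0})"
      by (auto dest!: dsum_dim simp: conj_commute cong: conj_cong)
    have "brad V B = {x \<in> R. B e x = 0}"
    proof (intro Set.set_eqI iffI)
      fix v assume v: "v \<in> brad V B"
      then obtain x c where xc: "x \<in> V'" "v = x + c *s e"
        using dsum_cases[OF dsum(1)] brad_subset by blast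
      have "B v y = B x y + c * B e y" if "y \<in> V" for y
        using xc sub eV V that by (auto simp: bilinD[OF B] subspace_scale)
      \<comment> \<open>\<open>y1\<close> is orthogonal to \<open>V'\<close> and pairs to 1 with
        \<open>e\<close>, so pairing with it reads off the \<open>e\<close>-coefficient of
        \<open>v\<close>.\<close>
      moreover have "B x y1 = 0"
        using y1 xc rf by (auto simp: R_def brad_def refl_form_def)
      moreover have "B v y1 = 0" using v RV[OF y1(1)] by (simp add: brad_def)
      ultimately have c: "c = 0" using RV[OF y1(1)] y1(2) by simp
      hence "v \<in> R" "B v e = 0" using v xc sub eV by (auto simp: R_def brad_def)
      thus "v \<in> {x \<in> R. B e x = 0}" using skew[of e v] eV R sub by auto
    next
      fix v assume v: "v \<in> {x \<in> R. B e x = 0}"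
      hence vV: "v \<in> V" using R sub by auto
      have "B v y = 0" if yV: "y \<in> V" for y
      proof -
        obtain x c where xc: "x \<in> V'" "y = x + c *s e" using dsum_cases[OF dsum(1) yV] .
        have "B v y = B v x + c * B v e"
          using vV xc sub V eV by (auto simp: bilinD[OF B] subspace_scale)
        thus ?thesis using v xc skew[of v e] vV eV by (auto simp: R_def brad_def)
      qed
      thus "v \<in> brad V B" using vV by (simp add: brad_def)
    qed
    thus ?thesis using d IH dR dsum_dim[OF dsum(1)] by simp
  next
    case False
    have "(\<lambda>y. if y \<in> V' then B e y else 0) \<in> ann V' R"
      using False R V' eV sub
      by (auto simp: ann_def lf_def subset_iff bilinD[OF B] subspace_add subspace_scale)
    from ann_brad_represented[OF B' V' rf this[unfolded R_def]]
    obtain w where w: "w \<in> V'" "\<And>y. y \<in> V' \<Longrightarrow> B e y = B w y" by (metis (mono_tags, lifting))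
    \<comment> \<open>\<open>e'\<close> is orthogonal to \<open>V'\<close> by the choice of
      \<open>w\<close>, and to itself because \<open>B\<close> is alternating, hence to all of
      \<open>V\<close>.\<close>
    define e' where "e' = e - w"
    have e': "e' \<in> V" "e' \<notin> V'"
      using w sub eV V V' dsum_notin[OF dsum(1)] subspace_add[OF V', of e' w]
      by (auto simp: e'_def subspace_diff)
    have e'0: "B e' y = 0" if "y \<in> V'" for y
      using w eV sub that V bilin_diff[OF B V, of e w y] by (auto simp: e'_def)
    have e'r: "e' \<in> brad V B"
    proof -
      have "B e' y = 0" if yV: "y \<in> V" for y
      proof -
        obtain x c where xc: "x \<in> V'" "y = x + c *s e" using dsum_cases[OF dsum(1) yV] .
        have xV: "x \<in> V" "w \<in> V" "e' + w = e" using xc w sub by (auto simp: e'_def)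
        have "B e' y = B e' x + c * B e' e"
          using xV(1) V eV e'(1) by (simp add: xc bilinD[OF B] subspace_scale)
        also have "B e' e = B e' e' + B e' w"
          using bilinD(2)[OF B e'(1) xV(2) e'(1)] xV(3) by simp
        finally have "B e' y = B e' x + c * (B e' e' + B e' w)" .
        thus ?thesis using xc e'0 w alt e' by simp
      qed
      thus ?thesis using e' by (simp add: brad_def)
    qed
    have "brad V B = {x + c *s e' | x c. x \<in> R}"
    proof (intro Set.set_eqI iffI)
      fix v assume v: "v \<in> brad V B"
      then obtain x c where xc: "x \<in> V'" "v = x + c *s e"
        using dsum_cases[OF dsum(1)] brad_subset by blast
      have eq: "v = (x + c *s w) + c *s e'" by (simp add: xc e'_def scale_right_diff_distrib)
      have "B (x + c *s w) y = 0" if y: "y \<in> V'" for y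
      proof -
        have "x + c *s w \<in> V" "c *s e' \<in> V" using xc w sub V e' by (auto intro: subspace_add subspace_scale)
        hence "B v y = B (x + c *s w) y + c * B e' y"
          using y sub e' unfolding eq by (auto simp: bilinD[OF B])
        thus ?thesis using e'0 v y sub by (auto simp: brad_def)
      qed
      hence "x + c *s w \<in> R" using xc w V' by (auto simp: R_def brad_def subspace_add subspace_scale)
      thus "v \<in> {x + c *s e' | x c. x \<in> R}" using eq by blast
    next
      fix v assume "v \<in> {x + c *s e' | x c. x \<in> R}"
      then obtain x c where xc: "x \<in> R" "v = x + c *s e'" by blast
      have "x \<in> brad V B"
      proof -
        have xV: "x \<in> V'" "x \<in> V" using xc R sub by auto
        have "B x y = 0" if yV: "y \<in> V" for y
        proof -
          obtain z d where zd: "z \<in> V'" "y = z + d *s e" using dsum_cases[OF dsum(1) yV] .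
          have "B x y = B x z + d * B x e" using xV zd sub V eV by (auto simp: bilinD[OF B] subspace_scale)
          also have "\<dots> = 0" using xc False zd skew[of x e] xV eV by (auto simp: R_def brad_def)
          finally show ?thesis .
        qed
        thus ?thesis using xV by (simp add: brad_def)
      qed
      thus "v \<in> brad V B" using e'r subspace_brad[OF B V] xc by (simp add: subspace_add subspace_scale)
    qed
    hence "dsum R e' (brad V B)" using R e' by (auto simp: dsum_def)
    thus ?thesis using IH dsum_dim[OF dsum(1)] dsum_dim[of R e'] by simp
  qed
qed

subsection \<open>Rank of quadratic forms\<close>

definition qf :: "'v set \<Rightarrow> ('v \<Rightarrow> 'k) \<Rightarrow> bool" where
  "qf V Q \<longleftrightarrow> (\<forall>c. \<forall>x\<in>V. Q (c *s x) = c\<^sup>2 * Q x) \<and> bilin V (polar Q)"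

definition quad :: "'v set \<Rightarrow> ('v \<Rightarrow> 'k) set" where
  "quad V = {Q. qf V Q \<and> (\<forall>x. x \<notin> V \<longrightarrow> Q x = 0)}"

definition rad :: "'v set \<Rightarrow> ('v \<Rightarrow> 'k) \<Rightarrow> 'v set" where
  "rad V Q = {x \<in> brad V (polar Q). Q x = 0}"

definition rk :: "'v set \<Rightarrow> ('v \<Rightarrow> 'k) \<Rightarrow> nat" where
  "rk V Q = dim V - dim (rad V Q)"

definition cl :: "'v set \<Rightarrow> ('v \<Rightarrow> 'k) \<Rightarrow> nat" where
  "cl V Q = (rk V Q + 1) div 2"

lemma polar_commute: "polar Q x y = polar Q y x"
  by (simp add: polar_def add.commute)

lemma polar_sum: "Q (x + y) = Q x + Q y + polar Q x y"
  by (simp add: polar_def)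

lemma refl_polar: "refl_form V (polar Q)"
  by (simp add: refl_form_def polar_commute)

lemma qf_bilin: "qf V Q \<Longrightarrow> bilin V (polar Q)"
  by (simp add: qf_def)

lemma qf_scale: "qf V Q \<Longrightarrow> x \<in> V \<Longrightarrow> Q (c *s x) = c\<^sup>2 * Q x"
  by (simp add: qf_def)

lemma qf_mono: "qf V Q \<Longrightarrow> V' \<subseteq> V \<Longrightarrow> qf V' Q"
  by (auto simp: qf_def intro: bilin_mono)

lemma qf_zero: "qf V Q \<Longrightarrow> subspace V \<Longrightarrow> Q 0 = 0"
  using qf_scale[of V Q 0 0] by (simp add: subspace_0)

lemma qf_polar_self:
  assumes "qf V Q" "x \<in> V"
  shows "polar Q x x = 2 * Q x"
proof -
  have "Q (x + x) = 4 * Q x"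
    using qf_scale[OF assms, of 2] by (metis one_add_one scale_left_distrib scale_one power2_eq_square
        mult_2 numeral_Bit0 mult_numeral_1 semiring_norm(3))
  thus ?thesis by (simp add: polar_def)
qed

lemma qf_diff:
  assumes "qf V Q" "subspace V" "x \<in> V" "y \<in> V"
  shows "Q (x - y) = Q x + Q y - polar Q x y"
proof -
  have "Q x = Q ((x - y) + y)" by simp
  also have "\<dots> = Q (x - y) + Q y + polar Q (x - y) y" by (rule polar_sum)
  also have "polar Q (x - y) y = polar Q x y - 2 * Q y"
    using assms by (simp add: bilin_diff[OF qf_bilin] qf_polar_self)
  finally show ?thesis by simp
qed

lemma subspace_rad:
  assumes "qf V Q" "subspace V"
  shows "subspace (rad V Q)"
  unfolding subspace_def
proof (intro conjI ballI allI)
  note S = subspace_brad[OF qf_bilin[OF assms(1)] assms(2)]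
  show "0 \<in> rad V Q" using S assms by (simp add: rad_def subspace_0 qf_zero)
  show "x + y \<in> rad V Q" if "x \<in> rad V Q" "y \<in> rad V Q" for x y
    using that subspace_add[OF S, of x y] polar_sum[of Q x y] by (auto simp: rad_def) (auto simp: brad_def)
  show "c *s x \<in> rad V Q" if "x \<in> rad V Q" for c x
    using that subspace_scale[OF S, of x c] qf_scale[OF assms(1), of x c] brad_subset by (auto simp: rad_def)
qed

lemma rad_subset: "rad V Q \<subseteq> V"
  by (auto simp: rad_def brad_def)

lemma dim_rad_le: "dim (rad V Q) \<le> dim V"
  by (intro dim_subset rad_subset)

text \<open>A vector \<open>x0\<close> of the polar radical with \<open>Q x0\<close> nonzero forces
  characteristic 2. There \<open>Q\<close> is additive on that radical and every scalar is a square,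
  so \<open>rad V Q\<close> has codimension 1 in it; the polar form is alternating, hence of even
  rank, and the rank of \<open>Q\<close> would be odd.\<close>

lemma even_rank_rad:
  assumes Q: "qf V Q" and V: "subspace V" and even: "even (rk V Q)"
  shows "brad V (polar Q) = rad V Q"
proof (rule ccontr)
  define R where "R = brad V (polar Q)"
  note R = subspace_brad[OF qf_bilin[OF Q] V, folded R_def]
  assume "brad V (polar Q) \<noteq> rad V Q"
  then obtain x0 where x0: "x0 \<in> R" "Q x0 \<noteq> 0" by (auto simp: rad_def R_def)
  have "2 * Q x0 = 0" using qf_polar_self[OF Q, of x0] x0 by (auto simp: R_def brad_def)
  hence two: "(2::'k) = 0" using x0 by simp
  have "dsum (rad V Q) x0 R"
    unfolding dsum_def
  proof (intro conjI Set.set_eqI iffI)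
    show "subspace (rad V Q)" by (rule subspace_rad[OF Q V])
    show "x0 \<notin> rad V Q" using x0 by (simp add: rad_def)
    fix v assume v: "v \<in> R"
    \<comment> \<open>With this \<open>c\<close> the value at \<open>v - c *s x0\<close> becomes
      \<open>Q v + Q v\<close>, which vanishes in characteristic 2.\<close>
    obtain c where c: "c\<^sup>2 = Q v / Q x0" using square_surj_char_2[OF two] by blast
    have *: "v - c *s x0 \<in> R" using v x0 R by (simp add: subspace_diff subspace_scale)
    have vV: "v \<in> V" "x0 \<in> V" using v x0 by (auto simp: R_def brad_def)
    have "polar Q v (c *s x0) = 0" using v vV V by (auto simp: R_def brad_def subspace_scale)
    moreover have "Q v + Q v = 2 * Q v" by simp
    ultimately have "Q (v - c *s x0) = 0"
      using qf_diff[OF Q V, of v "c *s x0"] qf_scale[OF Q vV(2), of c] vV c x0 V two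
      by (simp add: subspace_scale)
    hence "v - c *s x0 \<in> rad V Q" using * by (simp add: rad_def R_def)
    thus "v \<in> {x + c *s x0 |x c. x \<in> rad V Q}"
      by (intro CollectI exI[of _ "v - c *s x0"] exI[of _ c]) auto
  next
    fix v assume "v \<in> {x + c *s x0 |x c. x \<in> rad V Q}"
    thus "v \<in> R" using x0 R by (auto simp: rad_def R_def subspace_add subspace_scale)
  qed
  hence d: "dim R = Suc (dim (rad V Q))" by (rule dsum_dim)
  have "even (dim V - dim R)"
    unfolding R_def using qf_polar_self[OF Q] two by (intro even_alternating_rank V qf_bilin Q) auto
  moreover have "dim R \<le> dim V" unfolding R_def by (intro dim_subset brad_subset)
  ultimately show False using even d by (auto simp: rk_def)
qed

text \<open>Criterion for \<open>cl\<close> to survive the addition of a vector \<open>e\<close>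
  with polar values \<open>l\<close> and \<open>Q e = a\<close>. For even rank the rank itself must
  not grow, which means that some \<open>e - w\<close> enters the radical; for odd rank a growth by
  one is harmless, and only the growth by two must be excluded.\<close>

definition stay :: "'v set \<Rightarrow> ('v \<Rightarrow> 'k) \<Rightarrow> ('v \<Rightarrow> 'k) \<Rightarrow> 'k \<Rightarrow> bool" where
  "stay V Q l a \<longleftrightarrow>
     (if even (rk V Q) then \<exists>w\<in>V. (\<forall>y\<in>V. l y = polar Q w y) \<and> a = Q w else \<forall>y\<in>rad V Q. l y = 0)"

lemma qf_value:
  assumes Q: "qf V Q" and D: "dsum V' e V" and x: "x \<in> V'"
  shows "Q (x + c *s e) = Q x + c * polar Q x e + c\<^sup>2 * Q e"
  using x dsum_subset[OF D] dsum_vector[OF D] dsum_subspace[OF D]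
  by (simp add: polar_sum[of Q x] qf_scale[OF Q] bilinD[OF qf_bilin[OF Q]] subset_iff)

lemma qf_polar_value:
  assumes Q: "qf V Q" and D: "dsum V' e V" and x: "x \<in> V'" and y: "y \<in> V"
  shows "polar Q (x + c *s e) y = polar Q x y + c * polar Q e y"
  using x y dsum_subset[OF D] dsum_vector[OF D] dsum_subspace[OF D]
  by (simp add: bilinD[OF qf_bilin[OF Q]] subset_iff subspace_scale)

lemma brad_dsum:
  assumes Q: "qf V Q" and D: "dsum V' e V" and x: "x \<in> V"
  shows "x \<in> brad V (polar Q) \<longleftrightarrow> polar Q x e = 0 \<and> (\<forall>y\<in>V'. polar Q x y = 0)"
proof
  assume "x \<in> brad V (polar Q)"
  thus "polar Q x e = 0 \<and> (\<forall>y\<in>V'. polar Q x y = 0)"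
    using dsum_subset[OF D] dsum_vector[OF D] by (auto simp: brad_def)
next
  assume *: "polar Q x e = 0 \<and> (\<forall>y\<in>V'. polar Q x y = 0)"
  have "polar Q x v = 0" if v: "v \<in> V" for v
  proof -
    obtain y c where "y \<in> V'" "v = y + c *s e" using dsum_cases[OF D v] .
    thus ?thesis using qf_polar_value[OF Q D, of y x c] x * by (simp add: polar_commute)
  qed
  thus "x \<in> brad V (polar Q)" using x by (simp add: brad_def)
qed

text \<open>The new radical is the part of the old one orthogonal to \<open>e\<close>: it loses one
  dimension while the space gains one.\<close>

lemma rk_hyperbolic:
  assumes Q: "qf V Q" and D: "dsum V' e V" and y0: "y0 \<in> rad V' Q" "polar Q e y0 \<noteq> 0"
  shows "rk V Q = rk V' Q + 2"
proof -
  note V' = dsum_subspace'[OF D] and V = dsum_subspace[OF D]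
    and sub = dsum_subset[OF D] and eV = dsum_vector[OF D]
  note Q' = qf_mono[OF Q sub]
  define R where "R = rad V' Q"
  note R = subspace_rad[OF Q' V', folded R_def] rad_subset[of V' Q, folded R_def]
  define y1 where "y1 = inverse (polar Q e y0) *s y0"
  have y1: "y1 \<in> R" "polar Q e y1 = 1"
    using y0 R sub eV by (auto simp: y1_def subspace_scale bilinD[OF qf_bilin[OF Q]] R_def[symmetric])
  have RV: "x \<in> V" if "x \<in> R" for x using that R sub by auto
  have "(\<lambda>y. if y \<in> R then polar Q e y else 0) \<in> lf R"
    using eV R by (auto simp: lf_def RV bilinD[OF qf_bilin[OF Q]] subspace_add subspace_scale)
  from dsum_kernel[OF R(1) this y1(1)] y1
  have d: "dim R = Suc (dim {x \<in> R. polar Q e x = 0})"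
    by (auto dest!: dsum_dim simp: conj_commute cong: conj_cong)
  have "rad V Q = {x \<in> R. polar Q e x = 0}"
  proof (intro Set.set_eqI iffI)
    fix v assume v: "v \<in> rad V Q"
    hence vV: "v \<in> V" using rad_subset by auto
    then obtain x c where xc: "x \<in> V'" "v = x + c *s e"
      using dsum_cases[OF D] by blast
    have "polar Q x y1 = 0"
      using y1 xc by (auto simp: R_def rad_def brad_def polar_commute[of Q x])
    hence c: "c = 0" using v y1 R sub qf_polar_value[OF Q D xc(1), of y1 c] xc
      by (auto simp: rad_def brad_def)
    thus "v \<in> {x \<in> R. polar Q e x = 0}"
      using v xc sub eV by (auto simp: R_def brad_def rad_def polar_commute[of Q e])
  next
    fix v assume v: "v \<in> {x \<in> R. polar Q e x = 0}"
    hence vV: "v \<in> V" using R sub by auto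
    show "v \<in> rad V Q"
      using v vV brad_dsum[OF Q D vV] by (auto simp: rad_def R_def brad_def polar_commute[of Q e])
  qed
  moreover have "dim R \<le> dim V'" unfolding R_def by (rule dim_rad_le)
  ultimately show ?thesis using d dsum_dim[OF D] by (simp add: rk_def R_def)
qed

text \<open>Replacing \<open>e\<close> by \<open>e' = e - w\<close> makes the sum of
  \<open>V'\<close> and the new line orthogonal, and \<open>Q e' = Q e - Q w\<close> decides whether
  \<open>e'\<close> joins the radical. Evenness makes \<open>R\<close> the full polar radical, so
  orthogonality to \<open>V'\<close> alone puts a vector of \<open>V'\<close> into
  \<open>R\<close>.\<close>

lemma rk_even_extension:
  assumes Q: "qf V Q" and D: "dsum V' e V" and even: "even (rk V' Q)"
    and w: "w \<in> V'" "\<And>y. y \<in> V' \<Longrightarrow> polar Q e y = polar Q w y"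
  shows "rk V Q = (if Q e = Q w then rk V' Q else rk V' Q + 1)"
proof -
  note V' = dsum_subspace'[OF D] and V = dsum_subspace[OF D]
    and sub = dsum_subset[OF D] and eV = dsum_vector[OF D]
  note Q' = qf_mono[OF Q sub]
  define R where "R = rad V' Q"
  have R: "subspace R" "R \<subseteq> V'" "R = brad V' (polar Q)"
    using subspace_rad[OF Q' V'] rad_subset[of V' Q] even_rank_rad[OF Q' V' even] by (auto simp: R_def)
  define e' where "e' = e - w"
  have wV: "w \<in> V" using w sub by auto
  have e': "e' \<in> V" "e' \<notin> V'" "e' + w = e"
    using w eV wV V V' dsum_notin[OF D] subspace_add[OF V', of e' w]
    by (auto simp: e'_def subspace_diff)
  have e'0: "polar Q e' y = 0" if "y \<in> V'" for y
    using w eV sub that V bilin_diff[OF qf_bilin[OF Q] V, of e w y] by (auto simp: e'_def)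
  have Qe': "Q e' = Q e - Q w"
    using polar_sum[of Q e' w] e'0[OF w(1)] e' by simp
  have D': "dsum V' e' V"
    unfolding dsum_def
  proof (intro conjI V' e' Set.set_eqI iffI)
    fix v assume "v \<in> V"
    then obtain x c where "x \<in> V'" "v = x + c *s e" using dsum_cases[OF D] by blast
    moreover from this have "v = (x + c *s w) + c *s e'" by (simp add: e'_def scale_right_diff_distrib)
    ultimately show "v \<in> {x + c *s e' |x c. x \<in> V'}"
      using V' w by (auto intro!: exI[of _ "x + c *s w"] exI[of _ c] subspace_add subspace_scale)
  next
    fix v assume "v \<in> {x + c *s e' |x c. x \<in> V'}"
    thus "v \<in> V" using sub V e' by (auto simp: subspace_add subspace_scale)
  qed
  have RV: "R \<subseteq> rad V Q"
  proof
    fix x assume x: "x \<in> R"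
    hence "x \<in> V" "x \<in> V'" using R sub by auto
    thus "x \<in> rad V Q"
      using x brad_dsum[OF Q D', of x] e'0[of x] by (auto simp: R_def rad_def brad_def polar_commute[of Q e'])
  qed
  have xR: "x \<in> R" if x: "x \<in> V'" "x + c *s e' \<in> rad V Q" for x c
  proof -
    have "polar Q x y = 0" if "y \<in> V'" for y
      using qf_polar_value[OF Q D' x(1), of y c] e'0[OF that] that sub x by (auto simp: rad_def brad_def)
    thus ?thesis using x R by (auto simp: brad_def)
  qed
  show ?thesis
  proof (cases "Q e = Q w")
    case True
    have "polar Q e' e' = 0" using qf_polar_self[OF Q e'(1)] Qe' True by simp
    hence e'r: "e' \<in> rad V Q" using brad_dsum[OF Q D' e'(1)] e'0 Qe' True by (auto simp: rad_def)
    have "dsum R e' (rad V Q)"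
      unfolding dsum_def
    proof (intro conjI Set.set_eqI iffI)
      show "subspace R" by fact
      show "e' \<notin> R" using e' R by auto
      fix v assume v: "v \<in> rad V Q"
      then obtain x c where "x \<in> V'" "v = x + c *s e'" using dsum_cases[OF D'] rad_subset by blast
      thus "v \<in> {x + c *s e' |x c. x \<in> R}" using xR v by blast
    next
      fix v assume "v \<in> {x + c *s e' |x c. x \<in> R}"
      thus "v \<in> rad V Q" using RV e'r subspace_rad[OF Q V] by (auto simp: subspace_add subspace_scale)
    qed
    thus ?thesis using dsum_dim[OF D] dsum_dim[of R e'] True by (simp add: rk_def R_def)
  next
    case False
    have "rad V Q = R"
    proof (rule subset_antisym[OF subsetI RV])
      fix v assume v: "v \<in> rad V Q"
      then obtain x c where xc: "x \<in> V'" "v = x + c *s e'" using dsum_cases[OF D'] rad_subset by blast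
      have xr: "x \<in> R" using xR[OF xc(1)] v xc by simp
      have "Q v = Q x + c * polar Q x e' + c\<^sup>2 * Q e'"
        unfolding xc(2) by (rule qf_value[OF Q D' xc(1)])
      moreover have "Q v = 0" "Q x = 0" using v xr by (auto simp: R_def rad_def)
      ultimately have "c = 0" using e'0[OF xc(1)] Qe' False by (simp add: polar_commute[of Q x])
      thus "v \<in> R" using xr xc by simp
    qed
    moreover have "dim R \<le> dim V'" unfolding R_def by (rule dim_rad_le)
    ultimately show ?thesis using dsum_dim[OF D] False by (simp add: rk_def R_def)
  qed
qed

text \<open>The old radical survives and grows by at most one dimension, since any two radical
  vectors have a nontrivial combination inside \<open>V'\<close>. For odd rank both outcomes have
  the same \<open>cl\<close>.\<close>

lemma rk_orthogonal_extension:
  assumes Q: "qf V Q" and D: "dsum V' e V" and orth: "\<And>y. y \<in> rad V' Q \<Longrightarrow> polar Q e y = 0"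
  shows "rk V Q = rk V' Q \<or> rk V Q = rk V' Q + 1"
proof -
  note V' = dsum_subspace'[OF D] and V = dsum_subspace[OF D]
    and sub = dsum_subset[OF D] and eV = dsum_vector[OF D]
  note Q' = qf_mono[OF Q sub]
  define R where "R = rad V' Q"
  note R = subspace_rad[OF Q' V', folded R_def] rad_subset[of V' Q, folded R_def]
  have RV: "R \<subseteq> rad V Q"
  proof
    fix x assume x: "x \<in> R"
    hence "x \<in> V" "x \<in> V'" using R sub by auto
    thus "x \<in> rad V Q"
      using x brad_dsum[OF Q D, of x] orth[of x] by (auto simp: R_def rad_def brad_def polar_commute[of Q e])
  qed
  have "dim (rad V Q) \<le> dim R + 1"
  proof (cases "rad V Q \<subseteq> V'")
    case True
    hence "rad V Q \<subseteq> R" using sub by (auto simp: rad_def R_def brad_def)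
    hence "rad V Q = R" using RV by auto
    thus ?thesis by simp
  next
    case False
    then obtain v where v: "v \<in> rad V Q" "v \<notin> V'" by auto
    then obtain x c where xc: "x \<in> V'" "v = x + c *s e" using dsum_cases[OF D] rad_subset by blast
    have c: "c \<noteq> 0" using v xc by auto
    have "rad V Q \<subseteq> span (insert v R)"
    proof
      fix u assume u: "u \<in> rad V Q"
      then obtain y d where yd: "y \<in> V'" "u = y + d *s e" using dsum_cases[OF D] rad_subset by blast
      have eq: "u - (d / c) *s v = y - (d / c) *s x" using c by (simp add: xc yd scale_right_distrib)
      have "u - (d / c) *s v \<in> V'"
        unfolding eq using V' yd(1) xc(1) by (intro subspace_diff subspace_scale)
      moreover have "u - (d / c) *s v \<in> rad V Q"
        using u v subspace_rad[OF Q V] by (simp add: subspace_diff subspace_scale)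
      ultimately have "u - (d / c) *s v \<in> R" using sub by (auto simp: rad_def R_def brad_def)
      thus "u \<in> span (insert v R)" unfolding span_insert by (auto intro: span_base)
    qed
    hence "dim (rad V Q) \<le> dim (insert v R)" by (metis dim_mono)
    also have "\<dots> \<le> dim R + 1" by (simp add: dim_insert)
    finally show ?thesis .
  qed
  moreover have "dim R \<le> dim (rad V Q)" using RV by (intro dim_subset)
  moreover have "dim R \<le> dim V'" unfolding R_def by (rule dim_rad_le)
  ultimately show ?thesis using dsum_dim[OF D] unfolding rk_def R_def by linarith
qed

text \<open>The rank grows by 0, 1 or 2; pairing each odd rank with the even rank above it leaves
  only two outcomes.\<close>

lemma cl_dsum:
  assumes Q: "qf V Q" and D: "dsum V' e V"
  shows "cl V Q = (if stay V' Q (polar Q e) (Q e) then cl V' Q else Suc (cl V' Q))"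
proof -
  note V' = dsum_subspace'[OF D] and sub = dsum_subset[OF D] and eV = dsum_vector[OF D]
  note Q' = qf_mono[OF Q sub]
  show ?thesis
  proof (cases "\<forall>y\<in>rad V' Q. polar Q e y = 0")
    case False
    then obtain y0 where y0: "y0 \<in> rad V' Q" "polar Q e y0 \<noteq> 0" by blast
    have "\<not> (\<forall>y\<in>V'. polar Q e y = polar Q w y)" if "w \<in> V'" for w
    proof
      assume "\<forall>y\<in>V'. polar Q e y = polar Q w y"
      hence "polar Q w y0 \<noteq> 0" using y0 rad_subset[of V' Q] by auto
      thus False using y0 that by (auto simp: rad_def brad_def polar_commute[of Q w])
    qed
    hence "\<not> stay V' Q (polar Q e) (Q e)" using False by (auto simp: stay_def)
    thus ?thesis using rk_hyperbolic[OF Q D y0] by (simp add: cl_def)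
  next
    case True
    show ?thesis
    proof (cases "even (rk V' Q)")
      case False
      hence "stay V' Q (polar Q e) (Q e)" using True by (simp add: stay_def)
      thus ?thesis using rk_orthogonal_extension[OF Q D] True False by (auto simp: cl_def elim!: oddE)
    next
      case even: True
      have "(\<lambda>y. if y \<in> V' then polar Q e y else 0) \<in> ann V' (brad V' (polar Q))"
        using True V' eV sub rad_subset[of V' Q]
        by (auto simp: even_rank_rad[OF Q' V' even] ann_def lf_def subset_iff bilinD[OF qf_bilin[OF Q]]
            subspace_add subspace_scale)
      from ann_brad_represented[OF qf_bilin[OF Q'] V' refl_polar this]
      obtain w where w: "w \<in> V'" "\<And>y. y \<in> V' \<Longrightarrow> polar Q e y = polar Q w y"
        by (metis (mono_tags, lifting))
      \<comment> \<open>The representing vector is not unique. A second one \<open>u\<close> with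
        \<open>Q e = Q u\<close> fixes the rank of the extension, and this rank forces
        \<open>Q e = Q w\<close>.\<close>
      have "stay V' Q (polar Q e) (Q e) \<longleftrightarrow> Q e = Q w"
      proof
        assume "stay V' Q (polar Q e) (Q e)"
        then obtain u where u: "u \<in> V'" "\<And>y. y \<in> V' \<Longrightarrow> polar Q e y = polar Q u y" "Q e = Q u"
          using even by (auto simp: stay_def)
        have "rk V Q = rk V' Q" using rk_even_extension[OF Q D even u(1,2)] u(3) by simp
        thus "Q e = Q w" using rk_even_extension[OF Q D even w] by (auto split: if_splits)
      next
        assume "Q e = Q w"
        thus "stay V' Q (polar Q e) (Q e)" using w even by (auto simp: stay_def)
      qed
      thus ?thesis using rk_even_extension[OF Q D even w] even by (auto simp: cl_def elim!: evenE)
    qed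
  qed
qed

end

subsection \<open>Gaussian binomial coefficients\<close>

text \<open>The Gaussian binomial coefficient with base \<open>b\<close>, given by a Pascal rule to
  avoid quotients. Where \<open>n - k\<close> is truncated, the factor \<open>gbin b n k\<close> is
  0.\<close>

fun gbin :: "real \<Rightarrow> nat \<Rightarrow> nat \<Rightarrow> real" where
  "gbin b n 0 = 1"
| "gbin b 0 (Suc k) = 0"
| "gbin b (Suc n) (Suc k) = gbin b n (Suc k) + b ^ (n - k) * gbin b n k"

lemma gbin_eq_0: "n < k \<Longrightarrow> gbin b n k = 0"
proof (induction n arbitrary: k)
  case 0
  thus ?case by (cases k) auto
next
  case (Suc n)
  thus ?case by (cases k) auto
qed

lemma gbin_nonneg: "b \<ge> 0 \<Longrightarrow> gbin b n k \<ge> 0"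
  by (induction b n k rule: gbin.induct) auto

lemma gbin_pos: "b > 0 \<Longrightarrow> k \<le> n \<Longrightarrow> gbin b n k > 0"
proof (induction n arbitrary: k)
  case (Suc n)
  thus ?case using gbin_nonneg[of b n k] by (cases k) (auto simp: add_nonneg_pos gbin_nonneg)
qed auto

text \<open>The mirror Pascal rule; comparison with the defining one yields
  \<open>gbin_ratio\<close>.\<close>

lemma gbin_Suc_Suc': "gbin b (Suc n) (Suc k) = b ^ Suc k * gbin b n (Suc k) + gbin b n k"
proof (induction n arbitrary: k)
  case 0
  thus ?case by (cases k) auto
next
  case (Suc n)
  show ?case
  proof (cases k)
    case 0
    have "gbin b (Suc (Suc n)) (Suc 0) = b * gbin b n (Suc 0) + 1 + b ^ Suc n"
      using Suc[of 0] by simp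
    also have "\<dots> = b * (gbin b n (Suc 0) + b ^ n) + 1" by (simp add: algebra_simps)
    finally show ?thesis using 0 by simp
  next
    case (Suc j)
    show ?thesis
    proof (cases "k \<le> n")
      case True
      have "gbin b (Suc (Suc n)) (Suc k) = gbin b (Suc n) (Suc k) + b ^ (Suc n - k) * gbin b (Suc n) k"
        by simp
      also have "\<dots> = (b ^ Suc k * gbin b n (Suc k) + gbin b n k) + b ^ (Suc n - k) * (b ^ k * gbin b n k + gbin b n j)"
        using Suc.IH[of k] Suc.IH[of j] Suc by (simp del: gbin.simps)
      also have "\<dots> = b ^ Suc k * (gbin b n (Suc k) + b ^ (n - k) * gbin b n k) + (gbin b n k + b ^ (n - j) * gbin b n j)"
        using True Suc by (simp add: algebra_simps power_add[symmetric] Suc_diff_le del: power_Suc) 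
      finally show ?thesis using Suc by simp
    next
      case False
      thus ?thesis using Suc by (cases "k = Suc n") (auto simp: gbin_eq_0)
    qed
  qed
qed

lemma gbin_ratio:
  assumes "k \<le> n"
  shows "(b ^ Suc k - 1) * gbin b n (Suc k) = (b ^ (n - k) - 1) * gbin b n k"
  using gbin_Suc_Suc'[of b n k] by (simp add: algebra_simps)

lemma gbin_absorb:
  assumes "k \<le> Suc n"
  shows "(b ^ Suc n - 1) * gbin b n k = (b ^ (Suc n - k) - 1) * gbin b (Suc n) k"
proof (cases k)
  case (Suc j)
  hence j: "j \<le> n" using assms by simp
  have e: "b ^ Suc n = b ^ (n - j) * b ^ Suc j" using j by (simp add: power_add[symmetric] del: power_Suc)
  have "(b ^ Suc n - 1) * gbin b n k = (b ^ (n - j) - 1) * gbin b n (Suc j) + b ^ (n - j) * ((b ^ Suc j - 1) * gbin b n (Suc j))"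
    unfolding e Suc by (simp add: algebra_simps del: power_Suc)
  also have "(b ^ Suc j - 1) * gbin b n (Suc j) = (b ^ (n - j) - 1) * gbin b n j"
    by (rule gbin_ratio[OF j])
  finally show ?thesis using Suc by (simp add: algebra_simps)
qed simp

text \<open>For \<open>b = q\<^sup>2\<close> and a space of dimension \<open>2 * n\<close>, a form
  with \<open>cl\<close> equal to \<open>i\<close> on a hyperplane has \<open>b ^ n\<close>
  extensions, of which \<open>b ^ i\<close> keep \<open>cl\<close>. The left side is their total
  weight; the identity says that the weight is reproduced up to a constant factor.\<close>

lemma gbin_stay_same:
  assumes "i \<le> n"
  shows "b ^ n * gbin b (n - Suc i) k + (gbin b (n - i) k - gbin b (n - Suc i) k) * b ^ i
    = b ^ (n - k) * gbin b (n - i) k"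
proof (cases "n = i")
  case True
  thus ?thesis by (cases k) auto
next
  case False
  define x where "x = n - Suc i"
  have x: "n - i = Suc x" "n - Suc i = x" "n = i + Suc x" using assms False by (auto simp: x_def)
  show ?thesis
  proof (cases "k \<le> Suc x")
    case True
    have "b ^ n * gbin b x k + (gbin b (Suc x) k - gbin b x k) * b ^ i
      = b ^ i * ((b ^ Suc x - 1) * gbin b x k) + b ^ i * gbin b (Suc x) k"
      unfolding x(3) by (simp add: power_add algebra_simps del: gbin.simps)
    also have "(b ^ Suc x - 1) * gbin b x k = (b ^ (Suc x - k) - 1) * gbin b (Suc x) k"
      by (rule gbin_absorb[OF True])
    also have "b ^ i * ((b ^ (Suc x - k) - 1) * gbin b (Suc x) k) + b ^ i * gbin b (Suc x) k
      = b ^ i * b ^ (Suc x - k) * gbin b (Suc x) k" by (simp add: algebra_simps del: gbin.simps)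
    also have "b ^ i * b ^ (Suc x - k) = b ^ (n - k)"
      using True x by (simp add: power_add[symmetric])
    finally show ?thesis unfolding x(1,2) .
  next
    case False
    thus ?thesis unfolding x(1,2) by (simp add: gbin_eq_0 del: gbin.simps)
  qed
qed

text \<open>The defining Pascal rule in the form in which the surplus of the extensions that keep
  \<open>cl\<close> becomes a weight with lower index \<open>j\<close>.\<close>

lemma gbin_stay_drop:
  assumes "i < n"
  shows "(gbin b (n - i) (Suc j) - gbin b (n - Suc i) (Suc j)) * b ^ i = b ^ (n - Suc j) * gbin b (n - Suc i) j"
proof -
  define x where "x = n - Suc i"
  have x: "n - i = Suc x" "n - Suc i = x" "n = i + Suc x" using assms by (auto simp: x_def)
  show ?thesis
    unfolding x(1,2) using x(3) by (cases "j \<le> x") (auto simp: gbin_eq_0 power_add[symmetric] algebra_simps)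
qed

context finite_space
begin

subsection \<open>Extending quadratic forms from a hyperplane\<close>

text \<open>Inverse of restriction: a form on \<open>V\<close> amounts to its restriction to
  \<open>V'\<close>, its polar values \<open>l\<close> against \<open>e\<close> and its value
  \<open>a\<close> at \<open>e\<close>, all three being free (\<open>sum_quad\<close>).\<close>

definition glue :: "'v set \<Rightarrow> 'v \<Rightarrow> 'v set \<Rightarrow> ('v \<Rightarrow> 'k) \<Rightarrow> ('v \<Rightarrow> 'k) \<Rightarrow> 'k \<Rightarrow> 'v \<Rightarrow> 'k" where
  "glue V' e V Q l a v =
     (if v \<in> V then Q (v - coord V' e v *s e) + coord V' e v * l (v - coord V' e v *s e) + (coord V' e v)\<^sup>2 * a
      else 0)"

lemma glue_value:
  assumes "dsum V' e V" "x \<in> V'"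
  shows "glue V' e V Q l a (x + c *s e) = Q x + c * l x + c\<^sup>2 * a"
  using assms by (simp add: glue_def dsum_add coord_eq)

lemma glue_value':
  assumes D: "dsum V' e V" and Q: "Q \<in> quad V'" and l: "l \<in> lf V'"
  shows "x \<in> V' \<Longrightarrow> glue V' e V Q l a x = Q x" and "glue V' e V Q l a e = a"
  using glue_value[OF D, of x Q l a 0] glue_value[OF D, of 0 Q l a 1] dsum_subspace'[OF D] Q l
    qf_zero[of V' Q] lf_zero[of V' l]
  by (auto simp: quad_def subspace_0)

lemma glue_polar:
  assumes D: "dsum V' e V" and l: "l \<in> lf V'" and x: "x \<in> V'" and y: "y \<in> V'"
  shows "polar (glue V' e V Q l a) (x + c *s e) (y + d *s e) = polar Q x y + c * l y + d * l x + 2 * c * d * a"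
proof -
  have "(x + c *s e) + (y + d *s e) = (x + y) + (c + d) *s e"
    by (simp add: scale_left_distrib algebra_simps)
  moreover have "x + y \<in> V'" using x y dsum_subspace'[OF D] by (simp add: subspace_add)
  ultimately have "glue V' e V Q l a ((x + c *s e) + (y + d *s e)) = Q (x + y) + (c + d) * (l x + l y) + (c + d)\<^sup>2 * a"
    by (simp only: glue_value[OF D] lf_simps(1)[OF l x y])
  thus ?thesis
    by (simp add: polar_def glue_value[OF D] x y algebra_simps power2_eq_square)
qed

lemma glue_quad:
  assumes D: "dsum V' e V" and Q: "Q \<in> quad V'" and l: "l \<in> lf V'"
  shows "glue V' e V Q l a \<in> quad V"
proof -
  let ?G = "glue V' e V Q l a"
  note V' = dsum_subspace'[OF D] and V = dsum_subspace[OF D]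
  have qQ: "qf V' Q" using Q by (simp add: quad_def)
  note B = bilinD[OF qf_bilin[OF qQ]]
  have sc: "c *s (x + d *s e) = c *s x + (c * d) *s e" for c d x by (simp add: scale_right_distrib)
  have ad: "(x + c *s e) + (y + d *s e) = (x + y) + (c + d) *s e" for x y c d
    by (simp add: scale_left_distrib algebra_simps)
  have add: "polar ?G (u + v) w = polar ?G u w + polar ?G v w" if mem: "u \<in> V" "v \<in> V" "w \<in> V" for u v w
  proof -
    obtain x c where u: "x \<in> V'" "u = x + c *s e" using dsum_cases[OF D mem(1)] .
    obtain y d where v: "y \<in> V'" "v = y + d *s e" using dsum_cases[OF D mem(2)] .
    obtain z f where w: "z \<in> V'" "w = z + f *s e" using dsum_cases[OF D mem(3)] .
    show ?thesis
      unfolding u(2) v(2) w(2) ad using u(1) v(1) w(1) V'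
      by (simp add: glue_polar[OF D l] subspace_add B lf_simps[OF l]) (simp add: algebra_simps)
  qed
  have scale: "polar ?G (r *s u) w = r * polar ?G u w" if mem: "u \<in> V" "w \<in> V" for r u w
  proof -
    obtain x c where u: "x \<in> V'" "u = x + c *s e" using dsum_cases[OF D mem(1)] .
    obtain z f where w: "z \<in> V'" "w = z + f *s e" using dsum_cases[OF D mem(2)] .
    show ?thesis
      unfolding u(2) w(2) sc using u(1) w(1) V'
      by (simp add: glue_polar[OF D l] subspace_scale B lf_simps[OF l]) (simp add: algebra_simps)
  qed
  have "bilin V (polar ?G)"
    using add scale by (simp add: bilin_def polar_commute[of ?G _ "_ + _"] polar_commute[of ?G _ "_ *s _"])
      (simp add: polar_commute)
  moreover have "?G (r *s u) = r\<^sup>2 * ?G u" if mem: "u \<in> V" for r u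
  proof -
    obtain x c where u: "x \<in> V'" "u = x + c *s e" using dsum_cases[OF D mem] .
    show ?thesis
      using u V' by (simp add: sc glue_value[OF D] subspace_scale qf_scale[OF qQ] lf_simps[OF l]
          algebra_simps power2_eq_square)
  qed
  ultimately show ?thesis by (simp add: quad_def qf_def glue_def)
qed

lemma quad_restrict:
  assumes "Q \<in> quad V" "subspace V'" "V' \<subseteq> V"
  shows "(\<lambda>x. if x \<in> V' then Q x else 0) \<in> quad V'"
proof -
  have q: "qf V' Q" using assms qf_mono by (auto simp: quad_def)
  have "polar (\<lambda>x. if x \<in> V' then Q x else 0) x y = polar Q x y" if "x \<in> V'" "y \<in> V'" for x y
    using that assms by (simp add: polar_def subspace_add)
  thus ?thesis using q assms
    by (auto simp: quad_def qf_def bilin_def subspace_add subspace_scale)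
qed

lemma quad_eq_glue:
  assumes D: "dsum V' e V" and Q: "Q \<in> quad V"
  shows "glue V' e V (\<lambda>x. if x \<in> V' then Q x else 0) (\<lambda>y. if y \<in> V' then polar Q e y else 0) (Q e) = Q"
proof
  fix v
  show "glue V' e V (\<lambda>x. if x \<in> V' then Q x else 0) (\<lambda>y. if y \<in> V' then polar Q e y else 0) (Q e) v = Q v"
  proof (cases "v \<in> V")
    case True
    then obtain x c where "x \<in> V'" "v = x + c *s e" using dsum_cases[OF D] by blast
    thus ?thesis using glue_value[OF D] qf_value[OF _ D, of Q x c] Q
      by (simp add: quad_def polar_commute[of Q x])
  next
    case False
    thus ?thesis using Q by (simp add: glue_def quad_def)
  qed
qed

lemma sum_quad:
  assumes D: "dsum V' e V"
  shows "(\<Sum>Q\<in>quad V. F Q) = (\<Sum>Q\<in>quad V'. \<Sum>(l, a)\<in>lf V' \<times> UNIV. F (glue V' e V Q l a))"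
proof -
  note V' = dsum_subspace'[OF D] and sub = dsum_subset[OF D] and eV = dsum_vector[OF D]
  define r where "r Q = (\<lambda>x. if x \<in> V' then Q x else (0::'k))" for Q
  have "(\<Sum>(Q, l, a)\<in>quad V' \<times> (lf V' \<times> UNIV). F (glue V' e V Q l a)) = (\<Sum>Q\<in>quad V. F Q)"
  proof (rule sum.reindex_bij_witness[of _ "\<lambda>Q. (r Q, r (polar Q e), Q e)" "\<lambda>(Q, l, a). glue V' e V Q l a"])
    fix Q assume Q: "Q \<in> quad V"
    show "(case (r Q, r (polar Q e), Q e) of (Q, l, a) \<Rightarrow> glue V' e V Q l a) = Q"
      using quad_eq_glue[OF D Q] by (simp add: r_def)
    have "r (polar Q e) \<in> lf V'"
      using Q eV sub V' by (auto simp: r_def lf_def quad_def subset_iff bilinD[OF qf_bilin] subspace_add subspace_scale)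
    thus "(r Q, r (polar Q e), Q e) \<in> quad V' \<times> lf V' \<times> UNIV"
      using quad_restrict[OF Q V' sub] by (simp add: r_def)
  next
    fix p assume p: "p \<in> quad V' \<times> lf V' \<times> (UNIV :: 'k set)"
    obtain Q l a where [simp]: "p = (Q, l, a)" by (cases p)
    have Q: "Q \<in> quad V'" and l: "l \<in> lf V'" using p by auto
    let ?G = "glue V' e V Q l a"
    have "r ?G = Q" using Q glue_value'[OF D Q l] by (auto simp: r_def quad_def fun_eq_iff)
    moreover have "polar ?G e y = l y" if "y \<in> V'" for y
      using glue_polar[OF D l subspace_0[OF V'] that, of Q a 1 0] Q V' that
      by (simp add: lf_zero[OF V' l] bilin_zero[OF qf_bilin V'] quad_def)
    hence "r (polar ?G e) = l" using l by (auto simp: r_def lf_def fun_eq_iff)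
    ultimately show "(\<lambda>Q. (r Q, r (polar Q e), Q e)) (case p of (Q, l, a) \<Rightarrow> glue V' e V Q l a) = p"
      using glue_value'[OF D Q l] by simp
    show "(case p of (Q, l, a) \<Rightarrow> glue V' e V Q l a) \<in> quad V" using glue_quad[OF D Q l] by simp
    show "F (case p of (Q, l, a) \<Rightarrow> glue V' e V Q l a) = (case p of (Q, l, a) \<Rightarrow> F (glue V' e V Q l a))"
      by simp
  qed
  thus ?thesis by (simp add: sum.cartesian_product[symmetric])
qed

lemma rad_cong:
  assumes "subspace V" "\<And>x. x \<in> V \<Longrightarrow> P x = Q x"
  shows "rad V P = rad V Q"
  using assms by (auto simp: rad_def brad_def polar_def subspace_add)

lemma cl_glue:
  assumes D: "dsum V' e V" and Q: "Q \<in> quad V'" and l: "l \<in> lf V'"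
  shows "cl V (glue V' e V Q l a) = (if stay V' Q l a then cl V' Q else Suc (cl V' Q))"
proof -
  let ?G = "glue V' e V Q l a"
  note V' = dsum_subspace'[OF D]
  have G: "qf V ?G" using glue_quad[OF D Q l] by (simp add: quad_def)
  have val: "?G x = Q x" if "x \<in> V'" for x using glue_value'(1)[OF D Q l that] .
  have rad: "rad V' ?G = rad V' Q" using val by (intro rad_cong V') auto
  have pol: "polar ?G w y = polar Q w y" if "w \<in> V'" "y \<in> V'" for w y
    using that V' by (simp add: polar_def val subspace_add)
  have pe: "polar ?G e y = l y" if "y \<in> V'" for y
    using glue_polar[OF D l subspace_0[OF V'] that, of Q a 1 0] Q V' that
    by (simp add: lf_zero[OF V' l] bilin_zero[OF qf_bilin V'] quad_def)
  have "stay V' ?G (polar ?G e) (?G e) = stay V' Q l a"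
    unfolding stay_def rk_def rad using rad_subset[of V' Q]
    by (auto simp: val pol pe glue_value'(2)[OF D Q l] subset_iff)
  thus ?thesis using cl_dsum[OF G D] by (simp add: cl_def rk_def rad)
qed

lemma sum_lf_total:
  assumes "subspace V" "s \<in> V"
  shows "(\<Sum>(l, a)\<in>lf V \<times> (UNIV :: 'k set). \<psi> (l s)) = (if s = 0 then of_nat (CARD('k) * card V) else 0)"
proof -
  have "(\<Sum>(l, a)\<in>lf V \<times> (UNIV :: 'k set). \<psi> (l s)) = of_nat CARD('k) * (\<Sum>l\<in>lf V. \<psi> (l s))"
    by (simp add: sum.cartesian_product[symmetric] sum_distrib_left)
  thus ?thesis using sum_psi_ann[of V "{0}" s] assms
    by (simp add: ann_zero card_lf)
qed

text \<open>For even rank the admissible pairs are the image of \<open>V\<close> modulo the radical,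
  \<open>q ^ rk\<close> in number. For odd rank they are the annihilator of the radical times a free
  \<open>a\<close>, so \<open>q ^ (rk + 1)\<close>. Both are \<open>q ^ (2 * cl)\<close>, the point
  of merging the ranks.\<close>

lemma sum_stay:
  assumes Q: "qf V Q" and V: "subspace V" and s: "s \<in> V"
  shows "(\<Sum>(l, a)\<in>{(l, a). l \<in> lf V \<and> stay V Q l a}. \<psi> (l s)) =
    (if s \<in> rad V Q then of_nat (CARD('k) ^ (2 * cl V Q)) else 0)"
proof (cases "even (rk V Q)")
  case True
  \<comment> \<open>The fibres of \<open>f\<close> are the cosets of \<open>rad V Q\<close>: equal
    first components mean congruence modulo the polar radical, which is \<open>rad V Q\<close> here,
    and \<open>Q\<close> is constant on its cosets.\<close>
  define f where "f w = ((\<lambda>y. if y \<in> V then polar Q w y else 0), Q w)" for w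
  have R: "brad V (polar Q) = rad V Q" using even_rank_rad[OF Q V True] .
  note B = qf_bilin[OF Q]
  have img: "{(l, a). l \<in> lf V \<and> stay V Q l a} = f ` V"
    using True bilin_lf[OF B V] by (auto simp: stay_def f_def image_iff fun_eq_iff lf_simps(3)) 
  have fib: "f x = f y \<longleftrightarrow> x - y \<in> rad V Q" if "x \<in> V" "y \<in> V" for x y
  proof -
    have "Q x = Q y \<Longrightarrow> x - y \<in> rad V Q \<Longrightarrow> f x = f y"
      using bilin_fibre[OF B V that] R by (auto simp: f_def)
    moreover have "Q x = Q y" if xy: "x - y \<in> rad V Q"
    proof -
      have "Q ((x - y) + y) = Q (x - y) + Q y + polar Q (x - y) y" by (rule polar_sum)
      thus ?thesis using xy \<open>y \<in> V\<close> by (simp add: rad_def brad_def)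
    qed
    moreover have "f x = f y \<Longrightarrow> x - y \<in> rad V Q"
      using bilin_fibre[OF B V that] R by (simp add: f_def)
    ultimately show ?thesis by blast
  qed
  have "of_nat (card (rad V Q)) * (\<Sum>(l, a)\<in>f ` V. \<psi> (l s)) = (\<Sum>w\<in>V. \<psi> (fst (f w) s))"
    using sum_fibres[OF V subspace_rad[OF Q V] rad_subset fib, of "\<lambda>p. \<psi> (fst p s)"]
    by (simp add: case_prod_unfold)
  also have "\<dots> = (\<Sum>w\<in>V. \<psi> ((\<lambda>w. if w \<in> V then polar Q s w else 0) w))"
    using s by (intro sum.cong) (auto simp: f_def polar_commute)
  also have "\<dots> = (if (\<lambda>w. if w \<in> V then polar Q s w else 0) = (\<lambda>x. 0) then of_nat (card V) else 0)"
    by (rule sum_psi_lf_values[OF V bilin_lf[OF B V s]])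
  also have "(\<lambda>w. if w \<in> V then polar Q s w else 0) = (\<lambda>x. 0) \<longleftrightarrow> s \<in> rad V Q"
    using s by (auto simp: R[symmetric] brad_def fun_eq_iff)
  finally have eq: "of_nat (card (rad V Q)) * (\<Sum>(l, a)\<in>f ` V. \<psi> (l s)) = (if s \<in> rad V Q then of_nat (card V) else 0)" .
  have "card V = card (rad V Q) * CARD('k) ^ (2 * cl V Q)"
    using True dim_rad_le[of V Q] subspace_rad[OF Q V] V
    by (auto simp: card_subspace power_add[symmetric] cl_def rk_def)
  moreover have "card (rad V Q) \<noteq> 0" using q_gt_1 by (simp add: card_subspace subspace_rad[OF Q V])
  ultimately show ?thesis using eq by (auto simp: img split: if_splits)
next
  case False
  have "{(l, a). l \<in> lf V \<and> stay V Q l a} = ann V (rad V Q) \<times> (UNIV :: 'k set)"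
    using False by (auto simp: stay_def ann_def)
  hence "(\<Sum>(l, a)\<in>{(l, a). l \<in> lf V \<and> stay V Q l a}. \<psi> (l s)) = of_nat CARD('k) * (\<Sum>l\<in>ann V (rad V Q). \<psi> (l s))"
    by (simp add: sum.cartesian_product[symmetric] sum_distrib_left)
  also have "(\<Sum>l\<in>ann V (rad V Q). \<psi> (l s)) = (if s \<in> rad V Q then of_nat (card (ann V (rad V Q))) else 0)"
    by (rule sum_psi_ann[OF V subspace_rad[OF Q V] s])
  also have "card (ann V (rad V Q)) = CARD('k) ^ rk V Q"
    by (simp add: card_ann_dim[OF V subspace_rad[OF Q V] rad_subset] rk_def)
  also have "of_nat CARD('k) * (if s \<in> rad V Q then of_nat (CARD('k) ^ rk V Q) else 0)
    = (if s \<in> rad V Q then of_nat (CARD('k) ^ (2 * cl V Q)) else 0 :: complex)"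
    using False by (auto simp: cl_def elim!: oddE)
  finally show ?thesis .
qed

lemma sum_fibre:
  assumes Q: "qf V Q" and V: "subspace V" and s: "s \<in> V"
  shows "(\<Sum>(l, a)\<in>lf V \<times> UNIV. (if stay V Q l a then A else B) * \<psi> (l s)) =
    (if s = 0 then B * of_nat (CARD('k) * card V) else 0) +
    (if s \<in> rad V Q then (A - B) * of_nat (CARD('k) ^ (2 * cl V Q)) else 0)"
proof -
  let ?S = "{(l, a). l \<in> lf V \<and> stay V Q l a}"
  have "(\<Sum>(l, a)\<in>lf V \<times> UNIV. (if stay V Q l a then A else B) * \<psi> (l s))
    = (\<Sum>p\<in>lf V \<times> UNIV. B * \<psi> (fst p s) + (if p \<in> ?S then (A - B) * \<psi> (fst p s) else 0))"
    by (intro sum.cong) (auto simp: algebra_simps split: if_splits)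
  also have "\<dots> = (\<Sum>p\<in>lf V \<times> (UNIV :: 'k set). B * \<psi> (fst p s)) + (\<Sum>p\<in>(lf V \<times> UNIV) \<inter> ?S. (A - B) * \<psi> (fst p s))"
    by (simp only: sum.distrib sum.inter_restrict[OF finite])
  also have "(lf V \<times> UNIV) \<inter> ?S = ?S" by auto
  also have "(\<Sum>p\<in>lf V \<times> (UNIV :: 'k set). B * \<psi> (fst p s)) + (\<Sum>p\<in>?S. (A - B) * \<psi> (fst p s))
    = B * (\<Sum>(l, a)\<in>lf V \<times> (UNIV :: 'k set). \<psi> (l s)) + (A - B) * (\<Sum>(l, a)\<in>?S. \<psi> (l s))"
    by (simp add: sum_distrib_left case_prod_unfold)
  finally show ?thesis unfolding sum_lf_total[OF V s] sum_stay[OF Q V s] by auto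
qed

end

section \<open>Squares in a finite field\<close>

lemma twice_card_squares:
  "CARD('k::finite_field) < 2 * card (range (\<lambda>x::'k. x\<^sup>2))"
proof -
  define I where "I = (\<lambda>x::'k. x\<^sup>2) ` (UNIV - {0})"
  have fib: "card {x::'k. x\<^sup>2 = y} \<le> 2" for y
  proof (cases "\<exists>x. x\<^sup>2 = y")
    case True
    then obtain x where "x\<^sup>2 = y" by blast
    hence "{x. x\<^sup>2 = y} \<subseteq> {x, - x}" by (auto simp: power2_eq_iff)
    from card_mono[OF _ this] show ?thesis using card_insert_le_m1[of 2 "{-x}" x] by simp
  qed auto
  have "UNIV - {0} \<subseteq> (\<Union>y\<in>I. {x::'k. x\<^sup>2 = y})" by (auto simp: I_def)
  from card_mono[OF _ this] have "card (UNIV - {0::'k}) \<le> card (\<Union>y\<in>I. {x::'k. x\<^sup>2 = y})" by simp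
  also have "\<dots> \<le> (\<Sum>y\<in>I. card {x::'k. x\<^sup>2 = y})" by (rule card_UN_le) simp
  also have "\<dots> \<le> (\<Sum>y\<in>I. 2)" by (rule sum_mono) (rule fib)
  finally have "CARD('k) - 1 \<le> 2 * card I" by (simp add: card_Diff_singleton)
  moreover have "range (\<lambda>x::'k. x\<^sup>2) = insert 0 I" by (auto simp: I_def image_iff)
  moreover have "0 \<notin> I" by (auto simp: I_def)
  ultimately show ?thesis by simp
qed

text \<open>The values of \<open>A * x\<^sup>2\<close> and of \<open>C - B * y\<^sup>2\<close> each
  fill more than half of the field, in any characteristic, so they meet.\<close>

lemma binary_form_universal:
  fixes A B C :: "'k::finite_field"
  assumes "A \<noteq> 0" "B \<noteq> 0"
  obtains x y where "A * x\<^sup>2 + B * y\<^sup>2 = C"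
proof -
  define S1 where "S1 = (\<lambda>z. A * z) ` range (\<lambda>x. x\<^sup>2)"
  define S2 where "S2 = (\<lambda>z. C - B * z) ` range (\<lambda>x. x\<^sup>2)"
  have "card S1 = card (range (\<lambda>x::'k. x\<^sup>2))" "card S2 = card (range (\<lambda>x::'k. x\<^sup>2))"
    unfolding S1_def S2_def using assms by (auto intro!: card_image simp: inj_on_def)
  hence "CARD('k) < card S1 + card S2" using twice_card_squares[where 'k = 'k] by simp
  moreover have "card S1 + card S2 = card (S1 \<union> S2) + card (S1 \<inter> S2)"
    by (rule card_Un_Int) auto
  moreover have "card (S1 \<union> S2) \<le> CARD('k)" by (rule card_mono) auto
  ultimately have "S1 \<inter> S2 \<noteq> {}" by (intro notI) simp
  then obtain x y where "A * x\<^sup>2 = C - B * y\<^sup>2" by (auto simp: S1_def S2_def)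
  thus thesis using that[of x y] by simp
qed

context finite_space
begin

subsection \<open>Isotropic functionals\<close>

text \<open>
  A function \<open>\<mu>\<close> on the space is a formal combination of point evaluations: it induces the linear
  functional \<open>Lam V \<mu>\<close> on quadratic forms and the symmetric bilinear form \<open>bil V \<mu>\<close> on the dual space.
\<close>

definition Lam :: "'v set \<Rightarrow> ('v \<Rightarrow> 'k) \<Rightarrow> ('v \<Rightarrow> 'k) \<Rightarrow> 'k" where
  "Lam V \<mu> Q = (\<Sum>v\<in>V. \<mu> v * Q v)"

definition bil :: "'v set \<Rightarrow> ('v \<Rightarrow> 'k) \<Rightarrow> ('v \<Rightarrow> 'k) \<Rightarrow> ('v \<Rightarrow> 'k) \<Rightarrow> 'k" where
  "bil V \<mu> f g = (\<Sum>v\<in>V. \<mu> v * (f v * g v))"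

definition bil_rad :: "'v set \<Rightarrow> ('v \<Rightarrow> 'k) \<Rightarrow> ('v \<Rightarrow> 'k) set" where
  "bil_rad V \<mu> = {f \<in> lf V. \<forall>g\<in>lf V. bil V \<mu> f g = 0}"

lemma bil_commute: "bil V \<mu> f g = bil V \<mu> g f"
  by (simp add: bil_def mult_ac)

lemma bil_add: "bil V \<mu> f (\<lambda>x. g x + h x) = bil V \<mu> f g + bil V \<mu> f h"
  by (simp add: bil_def algebra_simps sum.distrib)

lemma bil_diff: "bil V \<mu> f (\<lambda>x. g x - h x) = bil V \<mu> f g - bil V \<mu> f h"
  by (simp add: bil_def algebra_simps sum_subtractf)

lemma bil_scale: "bil V \<mu> f (\<lambda>x. c * g x) = c * bil V \<mu> f g"
  by (simp add: bil_def algebra_simps sum_distrib_left)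

text \<open>Pigeonhole: there are at least \<open>q ^ 3\<close> functionals but only
  \<open>q ^ 2\<close> pairs of values; the difference of two with equal values is orthogonal to
  both.\<close>

lemma common_orthogonal:
  assumes V: "subspace V" and "dim V \<ge> 3"
  obtains f where "f \<in> lf V" "f \<noteq> (\<lambda>x. 0)" "bil V \<mu> f1 f = 0" "bil V \<mu> f2 f = 0"
proof -
  define F where "F f = (bil V \<mu> f1 f, bil V \<mu> f2 f)" for f
  have "card (F ` lf V) \<le> CARD('k \<times> 'k)" by (rule card_mono) auto
  also have "\<dots> = CARD('k) ^ 2" by (simp add: power2_eq_square)
  also have "\<dots> < CARD('k) ^ dim V" using q_gt_1 assms by (intro power_strict_increasing) auto
  also have "\<dots> = card (lf V)" by (simp add: card_lf card_subspace V)
  finally have "\<not> inj_on F (lf V)" using card_image[of F "lf V"] by auto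
  then obtain f g where fg: "f \<in> lf V" "g \<in> lf V" "f \<noteq> g" "F f = F g" by (auto simp: inj_on_def)
  show thesis
  proof (rule that[of "\<lambda>x. f x - g x"])
    show "(\<lambda>x. f x - g x) \<in> lf V" using fg by (intro lf_diff)
    show "(\<lambda>x. f x - g x) \<noteq> (\<lambda>x. 0)" using fg by (auto simp: fun_eq_iff)
  qed (use fg in \<open>auto simp: F_def bil_diff\<close>)
qed

text \<open>Three mutually orthogonal functionals, if none is isotropic, carry a diagonal ternary
  form, and \<open>binary_form_universal\<close> solves it with last coordinate 1. No
  diagonalisation is involved, so characteristic 2 is covered.\<close>

lemma isotropic_functional:
  assumes V: "subspace V" and d: "dim V \<ge> 3"
  obtains f where "f \<in> lf V" "f \<noteq> (\<lambda>x. 0)" "bil V \<mu> f f = 0"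
proof -
  note ex = common_orthogonal[OF V d, of \<mu>]
  obtain f1 where f1: "f1 \<in> lf V" "f1 \<noteq> (\<lambda>x. 0)" using ex by metis
  obtain f2 where f2: "f2 \<in> lf V" "f2 \<noteq> (\<lambda>x. 0)" "bil V \<mu> f1 f2 = 0" using ex[of f1 f1] by metis
  obtain f3 where f3: "f3 \<in> lf V" "f3 \<noteq> (\<lambda>x. 0)" "bil V \<mu> f1 f3 = 0" "bil V \<mu> f2 f3 = 0"
    using ex[of f1 f2] by metis
  show thesis
  proof (cases "bil V \<mu> f1 f1 = 0 \<or> bil V \<mu> f2 f2 = 0 \<or> bil V \<mu> f3 f3 = 0")
    case True
    thus ?thesis using that f1 f2 f3 by blast
  next
    case False
    obtain x y where xy: "bil V \<mu> f1 f1 * x\<^sup>2 + bil V \<mu> f2 f2 * y\<^sup>2 = - bil V \<mu> f3 f3"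
      using binary_form_universal[of "bil V \<mu> f1 f1" "bil V \<mu> f2 f2" "- bil V \<mu> f3 f3"] False by blast
    define f where "f v = (x * f1 v + y * f2 v) + f3 v" for v
    have b: "bil V \<mu> g f = x * bil V \<mu> g f1 + y * bil V \<mu> g f2 + bil V \<mu> g f3" for g
      unfolding f_def by (simp add: bil_add bil_scale)
    \<comment> \<open>The combination is nonzero because its pairing with \<open>f3\<close> is the
      nonzero value at \<open>f3\<close> itself.\<close>
    have "bil V \<mu> f f3 = bil V \<mu> f3 f3" using f3 b[of f3] by (simp add: bil_commute)
    hence "f \<noteq> (\<lambda>x. 0)" using False by (auto simp: bil_def)
    moreover have "f \<in> lf V" using f1 f2 f3 unfolding f_def by (intro lf_add lf_scale)
    moreover have "bil V \<mu> f f = 0"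
    proof -
      have "bil V \<mu> f f1 = x * bil V \<mu> f1 f1" "bil V \<mu> f f2 = y * bil V \<mu> f2 f2" "bil V \<mu> f f3 = bil V \<mu> f3 f3"
        using b[of f1] b[of f2] b[of f3] f2 f3 by (simp_all add: bil_commute)
      thus ?thesis using b[of f] xy by (simp add: power2_eq_square algebra_simps)
    qed
    ultimately show ?thesis using that by blast
  qed
qed

subsection \<open>Recursion for the Fourier transform\<close>

text \<open>The test function, with its lower index \<open>k\<close> and its space left free: the
  recursion changes both.\<close>

definition wt :: "'v set \<Rightarrow> nat \<Rightarrow> ('v \<Rightarrow> 'k) \<Rightarrow> real" where
  "wt V k Q = gbin (real CARD('k) ^ 2) ((dim V + 1) div 2 - cl V Q) k"

definition FT :: "'v set \<Rightarrow> nat \<Rightarrow> ('v \<Rightarrow> 'k) \<Rightarrow> complex" where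
  "FT V k \<mu> = (\<Sum>Q\<in>quad V. of_real (wt V k Q) * \<psi> (Lam V \<mu> Q))"

text \<open>The push-forward of \<open>\<mu>\<close> under projection along
  \<open>e\<close>.\<close>

definition push :: "'v \<Rightarrow> ('v \<Rightarrow> 'k) \<Rightarrow> 'v \<Rightarrow> 'k" where
  "push e \<mu> x = (\<Sum>c\<in>UNIV. \<mu> (x + c *s e))"

text \<open>Here \<open>V\<close> is the hyperplane. Let \<open>\<chi>\<close> be the functional
  that vanishes on it and is 1 at \<open>e\<close>. Then \<open>bil\<close> pairs
  \<open>\<chi>\<close> with a functional \<open>l\<close> vanishing at \<open>e\<close> to
  \<open>l (mom V e \<mu>)\<close>, and \<open>mom2 V e \<mu>\<close> is the value of
  \<open>bil\<close> at \<open>\<chi>\<close> and \<open>\<chi>\<close>.\<close>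

definition mom :: "'v set \<Rightarrow> 'v \<Rightarrow> ('v \<Rightarrow> 'k) \<Rightarrow> 'v" where
  "mom V e \<mu> = (\<Sum>x\<in>V. \<Sum>c\<in>UNIV. (c * \<mu> (x + c *s e)) *s x)"

definition mom2 :: "'v set \<Rightarrow> 'v \<Rightarrow> ('v \<Rightarrow> 'k) \<Rightarrow> 'k" where
  "mom2 V e \<mu> = (\<Sum>x\<in>V. \<Sum>c\<in>UNIV. c\<^sup>2 * \<mu> (x + c *s e))"

lemma mom_in: "subspace V \<Longrightarrow> mom V e \<mu> \<in> V"
  unfolding mom_def by (intro subspace_sum subspace_scale)

lemma lf_mom:
  assumes "subspace V" "\<And>x y. x \<in> V \<Longrightarrow> y \<in> V \<Longrightarrow> l (x + y) = l x + l y"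
    "\<And>c x. x \<in> V \<Longrightarrow> l (c *s x) = c * l x"
  shows "l (mom V e \<mu>) = (\<Sum>x\<in>V. \<Sum>c\<in>UNIV. c * \<mu> (x + c *s e) * l x)"
proof -
  define l' where "l' x = (if x \<in> V then l x else 0)" for x
  have l': "l' \<in> lf V" using assms by (auto simp: l'_def lf_def subspace_add subspace_scale)
  have "l (mom V e \<mu>) = l' (mom V e \<mu>)" using mom_in[OF assms(1)] by (simp add: l'_def)
  also have "\<dots> = (\<Sum>x\<in>V. \<Sum>c\<in>UNIV. l' ((c * \<mu> (x + c *s e)) *s x))"
    unfolding mom_def using assms(1)
    by (simp add: lf_sum[OF assms(1) l'] subspace_sum subspace_scale)
  also have "\<dots> = (\<Sum>x\<in>V. \<Sum>c\<in>UNIV. c * \<mu> (x + c *s e) * l x)"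
    by (intro sum.cong refl) (simp add: l'_def assms subspace_scale)
  finally show ?thesis .
qed

lemma Lam_glue:
  assumes D: "dsum V' e V" and l: "l \<in> lf V'"
  shows "Lam V \<mu> (glue V' e V Q l a) = Lam V' (push e \<mu>) Q + l (mom V' e \<mu>) + a * mom2 V' e \<mu>"
proof -
  have "Lam V \<mu> (glue V' e V Q l a) = (\<Sum>x\<in>V'. \<Sum>c\<in>UNIV. \<mu> (x + c *s e) * (Q x + c * l x + c\<^sup>2 * a))"
    unfolding Lam_def dsum_sum[OF D] by (simp add: glue_value[OF D])
  also have "\<dots> = (\<Sum>x\<in>V'. \<Sum>c\<in>UNIV. \<mu> (x + c *s e) * Q x) + (\<Sum>x\<in>V'. \<Sum>c\<in>UNIV. c * \<mu> (x + c *s e) * l x)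
     + (\<Sum>x\<in>V'. \<Sum>c\<in>UNIV. a * (c\<^sup>2 * \<mu> (x + c *s e)))"
    by (simp add: sum.distrib[symmetric] algebra_simps)
  also have "(\<Sum>x\<in>V'. \<Sum>c\<in>UNIV. c * \<mu> (x + c *s e) * l x) = l (mom V' e \<mu>)"
    using l by (intro lf_mom[symmetric] dsum_subspace'[OF D]) (auto simp: lf_def)
  also have "(\<Sum>x\<in>V'. \<Sum>c\<in>UNIV. \<mu> (x + c *s e) * Q x) = Lam V' (push e \<mu>) Q"
    by (simp add: Lam_def push_def sum_distrib_right)
  also have "(\<Sum>x\<in>V'. \<Sum>c\<in>UNIV. a * (c\<^sup>2 * \<mu> (x + c *s e))) = a * mom2 V' e \<mu>"
    by (simp add: mom2_def sum_distrib_left)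
  finally show ?thesis .
qed

lemma bil_dsum:
  assumes D: "dsum V' e V" and f: "f \<in> lf V" and g: "g \<in> lf V"
  shows "bil V \<mu> f g = bil V' (push e \<mu>) f g + f e * g (mom V' e \<mu>) + g e * f (mom V' e \<mu>)
    + f e * g e * mom2 V' e \<mu>"
proof -
  note sub = dsum_subset[OF D] and eV = dsum_vector[OF D] and V = dsum_subspace[OF D]
  have val: "l (x + c *s e) = l x + c * l e" if "l \<in> lf V" "x \<in> V'" for l x c
    using that sub eV V by (simp add: lf_simps[OF that(1)] subset_iff subspace_scale)
  have m: "(\<Sum>x\<in>V'. \<Sum>c\<in>UNIV. c * \<mu> (x + c *s e) * l x) = l (mom V' e \<mu>)" if "l \<in> lf V" for l
    using sub lf_simps(1,2)[OF that] by (intro lf_mom[symmetric] dsum_subspace'[OF D]) (auto simp: subset_iff)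
  have "bil V \<mu> f g = (\<Sum>x\<in>V'. \<Sum>c\<in>UNIV. \<mu> (x + c *s e) * ((f x + c * f e) * (g x + c * g e)))"
    unfolding bil_def dsum_sum[OF D] using f g by (simp add: val)
  also have "\<dots> = (\<Sum>x\<in>V'. \<Sum>c\<in>UNIV. \<mu> (x + c *s e) * (f x * g x))
    + (\<Sum>x\<in>V'. \<Sum>c\<in>UNIV. f e * (c * \<mu> (x + c *s e) * g x))
    + (\<Sum>x\<in>V'. \<Sum>c\<in>UNIV. g e * (c * \<mu> (x + c *s e) * f x))
    + (\<Sum>x\<in>V'. \<Sum>c\<in>UNIV. f e * g e * (c\<^sup>2 * \<mu> (x + c *s e)))"
    by (simp add: sum.distrib[symmetric] algebra_simps power2_eq_square)
  also have "\<dots> = bil V' (push e \<mu>) f g + f e * g (mom V' e \<mu>) + g e * f (mom V' e \<mu>)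
    + f e * g e * mom2 V' e \<mu>"
    by (simp only: sum_distrib_left[symmetric] sum_distrib_right[symmetric] m[unfolded sum_distrib_right[symmetric]] f g mom2_def bil_def push_def)
  finally show ?thesis .
qed

lemma cl_le: "cl V Q \<le> (dim V + 1) div 2"
  unfolding cl_def rk_def by (intro div_le_mono) simp

text \<open>As \<open>mom2\<close> vanishes, \<open>a\<close> drops out of \<open>Lam_glue\<close>,
  and the sum over the extensions of \<open>Q\<close> is \<open>sum_fibre\<close> at the vector
  \<open>s\<close>.\<close>

lemma FT_dsum:
  assumes D: "dsum V' e V" and iso: "mom2 V' e \<mu> = 0"
  defines "n \<equiv> (dim V + 1) div 2" and "s \<equiv> mom V' e \<mu>" and "b \<equiv> real CARD('k) ^ 2"
  shows "FT V k \<mu> = (\<Sum>Q\<in>quad V'. \<psi> (Lam V' (push e \<mu>) Q) * of_real (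
     (if s = 0 then gbin b (n - Suc (cl V' Q)) k * real CARD('k) ^ dim V else 0) +
     (if s \<in> rad V' Q then (gbin b (n - cl V' Q) k - gbin b (n - Suc (cl V' Q)) k) * b ^ cl V' Q else 0)))"
  unfolding FT_def sum_quad[OF D]
proof (rule sum.cong[OF refl])
  fix Q assume Q: "Q \<in> quad V'"
  note V' = dsum_subspace'[OF D]
  define A where "A = gbin b (n - cl V' Q) k"
  define B where "B = gbin b (n - Suc (cl V' Q)) k"
  have s: "s \<in> V'" unfolding s_def by (rule mom_in[OF V'])
  have qQ: "qf V' Q" using Q by (simp add: quad_def)
  have c: "CARD('k) * card V' = CARD('k) ^ dim V"
    using card_subspace[OF V'] dsum_dim[OF D] by simp
  have "(\<Sum>(l, a)\<in>lf V' \<times> UNIV. of_real (wt V k (glue V' e V Q l a)) * \<psi> (Lam V \<mu> (glue V' e V Q l a)))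
    = (\<Sum>(l, a)\<in>lf V' \<times> UNIV. \<psi> (Lam V' (push e \<mu>) Q) *
        ((if stay V' Q l a then complex_of_real A else of_real B) * \<psi> (l s)))"
    by (rule sum.cong) (auto simp: wt_def cl_glue[OF D Q] Lam_glue[OF D] iso psi_add A_def B_def
        n_def b_def s_def)
  also have "\<dots> = \<psi> (Lam V' (push e \<mu>) Q) *
      (\<Sum>(l, a)\<in>lf V' \<times> UNIV. (if stay V' Q l a then complex_of_real A else of_real B) * \<psi> (l s))"
    by (simp add: sum_distrib_left case_prod_unfold)
  also have "(\<Sum>(l, a)\<in>lf V' \<times> UNIV. (if stay V' Q l a then complex_of_real A else of_real B) * \<psi> (l s))
    = (if s = 0 then of_real B * of_nat (CARD('k) * card V') else 0) +
    (if s \<in> rad V' Q then (of_real A - of_real B) * of_nat (CARD('k) ^ (2 * cl V' Q)) else 0)"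
    by (rule sum_fibre[OF qQ V' s])
  also have "\<dots> = of_real ((if s = 0 then B * real CARD('k) ^ dim V else 0) +
     (if s \<in> rad V' Q then (A - B) * b ^ cl V' Q else 0))"
    unfolding c b_def by (simp add: power_mult)
  finally show "(\<Sum>(l, a)\<in>lf V' \<times> UNIV. of_real (wt V k (glue V' e V Q l a)) * \<psi> (Lam V \<mu> (glue V' e V Q l a)))
    = \<psi> (Lam V' (push e \<mu>) Q) * of_real (
     (if s = 0 then gbin b (n - Suc (cl V' Q)) k * real CARD('k) ^ dim V else 0) +
     (if s \<in> rad V' Q then (gbin b (n - cl V' Q) k - gbin b (n - Suc (cl V' Q)) k) * b ^ cl V' Q else 0))"
    unfolding A_def B_def .
qed

lemma zero_in_rad:
  assumes "Q \<in> quad V" "subspace V"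
  shows "0 \<in> rad V Q"
  using assms subspace_rad[of V Q] by (auto simp: quad_def subspace_0)

text \<open>Both moments vanish exactly when the \<open>e\<close>-coordinate functional lies in the
  radical of \<open>bil\<close>; then all extensions of a form receive the same character value. For
  even \<open>dim V\<close> the number \<open>(dim V + 1) div 2\<close> is shared with the
  hyperplane, and \<open>gbin_stay_same\<close> applies.\<close>

lemma FT_radical_even:
  assumes D: "dsum V' e V" and iso: "mom2 V' e \<mu> = 0" "mom V' e \<mu> = 0" and even: "even (dim V)"
  shows "FT V k \<mu> = of_real (real CARD('k) ^ (2 * (dim V div 2 - k))) * FT V' k (push e \<mu>)"
proof -
  define b where "b = real CARD('k) ^ 2"
  define n where "n = dim V div 2"
  have n: "(dim V + 1) div 2 = n" "(dim V' + 1) div 2 = n" "dim V = 2 * n"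
    using even dsum_dim[OF D] by (auto simp: n_def elim!: evenE)
  have wt: "wt V' k Q = gbin b (n - cl V' Q) k" for Q unfolding wt_def n b_def ..
  have "FT V k \<mu> = (\<Sum>Q\<in>quad V'. \<psi> (Lam V' (push e \<mu>) Q) * of_real (b ^ (n - k) * gbin b (n - cl V' Q) k))"
    unfolding FT_dsum[OF D iso(1)] n(1) iso(2)
  proof (rule sum.cong[OF refl])
    fix Q assume Q: "Q \<in> quad V'"
    have "cl V' Q \<le> n" using cl_le[of V' Q] n by simp
    from gbin_stay_same[OF this, of b k]
    show "\<psi> (Lam V' (push e \<mu>) Q) * complex_of_real ((if 0 = (0 :: 'v)
       then gbin ((real CARD('k))\<^sup>2) (n - Suc (cl V' Q)) k * real CARD('k) ^ dim V else 0) +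
      (if 0 \<in> rad V' Q then (gbin ((real CARD('k))\<^sup>2) (n - cl V' Q) k - gbin ((real CARD('k))\<^sup>2) (n - Suc (cl V' Q)) k) *
         (real CARD('k))\<^sup>2 ^ cl V' Q else 0)) =
      \<psi> (Lam V' (push e \<mu>) Q) * complex_of_real (b ^ (n - k) * gbin b (n - cl V' Q) k)"
      using zero_in_rad[OF Q dsum_subspace'[OF D]] by (simp add: b_def n(3) power_mult[symmetric] mult.commute)
  qed
  also have "\<dots> = of_real (b ^ (n - k)) * FT V' k (push e \<mu>)"
    by (simp add: FT_def wt sum_distrib_left mult_ac)
  finally show ?thesis by (simp add: b_def n_def power_mult)
qed

text \<open>Now \<open>(dim V + 1) div 2\<close> drops by one on the hyperplane, so the extensions
  that raise \<open>cl\<close> carry the weight of the same index there, and the surplus of the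
  others is a weight of the next lower index by \<open>gbin_stay_drop\<close>.\<close>

lemma FT_radical_odd:
  assumes D: "dsum V' e V" and iso: "mom2 V' e \<mu> = 0" "mom V' e \<mu> = 0" and odd: "odd (dim V)"
  shows "FT V (Suc k) \<mu> = of_real (real CARD('k) ^ dim V) * FT V' (Suc k) (push e \<mu>)
      + of_real (real CARD('k) ^ (2 * (dim V div 2 - k))) * FT V' k (push e \<mu>)"
    and "FT V 0 \<mu> = of_real (real CARD('k) ^ dim V) * FT V' 0 (push e \<mu>)"
proof -
  define b where "b = real CARD('k) ^ 2"
  define n where "n = dim V div 2"
  have n: "(dim V + 1) div 2 = Suc n" "(dim V' + 1) div 2 = n"
    using odd dsum_dim[OF D] by (auto simp: n_def elim!: oddE)
  have wt: "wt V' k Q = gbin b (n - cl V' Q) k" for k Q unfolding wt_def n b_def ..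
  have "FT V (Suc k) \<mu> = (\<Sum>Q\<in>quad V'. \<psi> (Lam V' (push e \<mu>) Q) * of_real (
      real CARD('k) ^ dim V * gbin b (n - cl V' Q) (Suc k) + b ^ (n - k) * gbin b (n - cl V' Q) k))"
    unfolding FT_dsum[OF D iso(1)] n iso(2)
  proof (rule sum.cong[OF refl])
    fix Q assume Q: "Q \<in> quad V'"
    have "cl V' Q < Suc n" using cl_le[of V' Q] n by simp
    from gbin_stay_drop[OF this, of b k]
    show "\<psi> (Lam V' (push e \<mu>) Q) * complex_of_real ((if 0 = (0 :: 'v)
       then gbin ((real CARD('k))\<^sup>2) (Suc n - Suc (cl V' Q)) (Suc k) * real CARD('k) ^ dim V else 0) +
      (if 0 \<in> rad V' Q then (gbin ((real CARD('k))\<^sup>2) (Suc n - cl V' Q) (Suc k) - gbin ((real CARD('k))\<^sup>2) (Suc n - Suc (cl V' Q)) (Suc k)) *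
         (real CARD('k))\<^sup>2 ^ cl V' Q else 0)) =
      \<psi> (Lam V' (push e \<mu>) Q) * of_real (
      real CARD('k) ^ dim V * gbin b (n - cl V' Q) (Suc k) + b ^ (n - k) * gbin b (n - cl V' Q) k)"
      using zero_in_rad[OF Q dsum_subspace'[OF D]] by (simp add: b_def mult.commute)
  qed
  also have "\<dots> = of_real (real CARD('k) ^ dim V) * FT V' (Suc k) (push e \<mu>)
      + of_real (b ^ (n - k)) * FT V' k (push e \<mu>)"
    by (simp add: FT_def wt sum_distrib_left mult_ac distrib_left sum.distrib)
  finally show "FT V (Suc k) \<mu> = of_real (real CARD('k) ^ dim V) * FT V' (Suc k) (push e \<mu>)
      + of_real (real CARD('k) ^ (2 * (dim V div 2 - k))) * FT V' k (push e \<mu>)"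
    by (simp add: b_def n_def power_mult)
  show "FT V 0 \<mu> = of_real (real CARD('k) ^ dim V) * FT V' 0 (push e \<mu>)"
    unfolding FT_dsum[OF D iso(1)] iso(2) by (simp add: FT_def wt_def sum_distrib_left mult_ac cong: if_cong)
qed

lemma rad_glue_iff:
  assumes D: "dsum V' e V" and Q: "Q \<in> quad V'" and l: "l \<in> lf V'"
  shows "e \<in> rad V (glue V' e V Q l a) \<longleftrightarrow> l = (\<lambda>x. 0) \<and> a = 0"
proof -
  let ?G = "glue V' e V Q l a"
  note V' = dsum_subspace'[OF D]
  have G: "qf V ?G" using glue_quad[OF D Q l] by (simp add: quad_def)
  have eV: "e \<in> V" by (rule dsum_vector[OF D])
  have Ge: "?G e = a" using glue_value'(2)[OF D Q l] .
  have pe: "polar ?G e y = l y" if "y \<in> V'" for y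
    using glue_polar[OF D l subspace_0[OF V'] that, of Q a 1 0] Q V' that
    by (simp add: lf_zero[OF V' l] bilin_zero[OF qf_bilin V'] quad_def)
  have "(\<forall>y\<in>V'. polar ?G e y = 0) \<longleftrightarrow> l = (\<lambda>x. 0)"
    using l by (auto simp: pe lf_def fun_eq_iff)
  thus ?thesis
    using brad_dsum[OF G D eV] qf_polar_self[OF G eV] Ge by (auto simp: rad_def)
qed

text \<open>The \<open>e\<close>-coordinate functional is isotropic but outside the radical. Since
  the moment is nonzero, only forms having it in their radical contribute; by
  \<open>rad_glue_iff\<close> these are the forms on \<open>V''\<close> extended by zero, with
  unchanged \<open>cl\<close>. The dimension falls by two and the index by one.\<close>

lemma FT_hyperbolic:
  assumes D: "dsum V' e V" and iso: "mom2 V' e \<mu> = 0" and D': "dsum V'' (mom V' e \<mu>) V'"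
  shows "FT V (Suc k) \<mu> = of_real (real CARD('k) ^ (2 * ((dim V + 1) div 2 - Suc k))) *
      FT V'' k (push (mom V' e \<mu>) (push e \<mu>))"
proof -
  define b where "b = real CARD('k) ^ 2"
  define n where "n = (dim V + 1) div 2"
  define s where "s = mom V' e \<mu>"
  have n: "(dim V + 1) div 2 = n" "(dim V'' + 1) div 2 = n - 1" "n \<ge> 1"
    using dsum_dim[OF D] dsum_dim[OF D'] by (auto simp: n_def)
  have wt: "wt V'' k Q = gbin b (n - 1 - cl V'' Q) k" for k Q unfolding wt_def n b_def ..
  have s0: "s \<noteq> 0" using dsum_notin[OF D'] subspace_0[OF dsum_subspace'[OF D']] by (auto simp: s_def)
  note D' = D'[folded s_def]
  define F where "F Q = (if s \<in> rad V' Q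
      then (gbin b (n - cl V' Q) (Suc k) - gbin b (n - Suc (cl V' Q)) (Suc k)) * b ^ cl V' Q else 0)" for Q
  have "FT V (Suc k) \<mu> = (\<Sum>Q\<in>quad V'. \<psi> (Lam V' (push e \<mu>) Q) * of_real (F Q))"
    unfolding FT_dsum[OF D iso] s_def[symmetric] n F_def b_def using s0 by simp
  also have "\<dots> = (\<Sum>Q\<in>quad V''. \<Sum>p\<in>lf V'' \<times> (UNIV :: 'k set). if p = ((\<lambda>x. 0), 0) then
      \<psi> (Lam V'' (push s (push e \<mu>)) Q) * of_real (b ^ (n - Suc k) * gbin b (n - 1 - cl V'' Q) k) else 0)"
    unfolding sum_quad[OF D']
  proof (intro sum.cong refl)
    fix Q p assume Q: "Q \<in> quad V''" and p: "p \<in> lf V'' \<times> (UNIV :: 'k set)"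
    obtain l a where la: "p = (l, a)" "l \<in> lf V''" using p by auto
    let ?G = "glue V'' s V' Q l a"
    note sr = rad_glue_iff[OF D' Q la(2), of a]
    show "(case p of (l, a) \<Rightarrow> \<psi> (Lam V' (push e \<mu>) (glue V'' s V' Q l a)) * of_real (F (glue V'' s V' Q l a)))
      = (if p = ((\<lambda>x. 0), 0) then
      \<psi> (Lam V'' (push s (push e \<mu>)) Q) * of_real (b ^ (n - Suc k) * gbin b (n - 1 - cl V'' Q) k) else 0)"
    proof (cases "p = ((\<lambda>x. 0), 0)")
      case True
      hence l0: "l = (\<lambda>x. 0)" "a = 0" using la by auto
      have "\<exists>w\<in>V''. (\<forall>y\<in>V''. polar Q w y = 0) \<and> Q w = 0"
        using zero_in_rad[OF Q dsum_subspace'[OF D']] by (auto simp: rad_def brad_def)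
      hence "stay V'' Q l a" using l0 by (auto simp: stay_def)
      hence cl: "cl V' ?G = cl V'' Q" using cl_glue[OF D' Q la(2)] by simp
      have "cl V'' Q < n" using cl_le[of V'' Q] n by simp
      note drop = gbin_stay_drop[OF this, of b k]
      have "s \<in> rad V' ?G" using sr l0 by blast
      hence "F ?G = b ^ (n - Suc k) * gbin b (n - 1 - cl V'' Q) k"
        using drop by (simp add: F_def cl)
      moreover have "Lam V' (push e \<mu>) ?G = Lam V'' (push s (push e \<mu>)) Q"
        using Lam_glue[OF D' la(2)] l0 by simp
      ultimately show ?thesis using True la by simp
    next
      case False
      hence "F ?G = 0" using sr la by (auto simp: F_def)
      thus ?thesis using False la by auto
    qed
  qed
  also have "\<dots> = (\<Sum>Q\<in>quad V''.
      \<psi> (Lam V'' (push s (push e \<mu>)) Q) * of_real (b ^ (n - Suc k) * gbin b (n - 1 - cl V'' Q) k))"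
    using zero_ann(1)[of V'' "{}"] by (simp add: ann_def)
  also have "\<dots> = of_real (b ^ (n - Suc k)) * FT V'' k (push s (push e \<mu>))"
    by (simp add: FT_def wt sum_distrib_left mult_ac)
  finally show ?thesis by (simp add: b_def n_def power_mult s_def)
qed


section \<open>Character sums over forms, and the radical of the dual bilinear form\<close>

lemma quad_zero: "(\<lambda>x. 0) \<in> quad V"
  by (auto simp: quad_def qf_def bilin_def polar_def)

lemma quad_add:
  assumes "P \<in> quad V" "Q \<in> quad V"
  shows "P + Q \<in> quad V"
proof -
  have "polar (P + Q) x y = polar P x y + polar Q x y" for x y by (simp add: polar_def)
  thus ?thesis using assms
    by (auto simp: quad_def qf_def bilin_def algebra_simps)
qed

lemma quad_scale:
  assumes "Q \<in> quad V"
  shows "(\<lambda>x. c * Q x) \<in> quad V"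
proof -
  have "polar (\<lambda>x. c * Q x) x y = c * polar Q x y" for x y by (simp add: polar_def algebra_simps)
  thus ?thesis using assms
    by (auto simp: quad_def qf_def bilin_def algebra_simps)
qed

lemma quad_product:
  assumes "f \<in> lf V" "g \<in> lf V" "subspace V"
  shows "(\<lambda>x. f x * g x) \<in> quad V"
proof -
  have "polar (\<lambda>x. f x * g x) x y = f x * g y + f y * g x" if "x \<in> V" "y \<in> V" for x y
    using that assms by (simp add: polar_def lf_simps algebra_simps)
  thus ?thesis using assms
    by (auto simp: quad_def qf_def bilin_def lf_simps subspace_add subspace_scale algebra_simps power2_eq_square)
qed

lemma Lam_add: "Lam V \<mu> (P + Q) = Lam V \<mu> P + Lam V \<mu> Q"
  by (simp add: Lam_def algebra_simps sum.distrib)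

lemma Lam_scale: "Lam V \<mu> (\<lambda>x. c * Q x) = c * Lam V \<mu> Q"
  by (simp add: Lam_def algebra_simps sum_distrib_left)

lemma sum_psi_Lam:
  assumes add: "\<And>P Q. P \<in> G \<Longrightarrow> Q \<in> G \<Longrightarrow> P + Q \<in> G"
    and scale: "\<And>c Q. Q \<in> G \<Longrightarrow> (\<lambda>x. c * Q x) \<in> G"
  shows "(\<Sum>Q\<in>G. \<psi> (Lam V \<mu> Q)) = (if \<forall>Q\<in>G. Lam V \<mu> Q = 0 then of_nat (card G) else 0)"
proof (cases "\<forall>Q\<in>G. Lam V \<mu> Q = 0")
  case True
  thus ?thesis by (simp add: psi_zero)
next
  case False
  then obtain P where P: "P \<in> G" "Lam V \<mu> P \<noteq> 0" by blast
  obtain a where "\<psi> (a * Lam V \<mu> P) \<noteq> 1" using psi_nontrivial_multiple[OF P(2)] by blast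
  hence "(\<Sum>Q\<in>G. \<psi> (Lam V \<mu> Q)) = 0"
    by (intro char_sum_zero[where g = "\<lambda>x. a * P x"]) (use P add scale in \<open>auto simp: Lam_add Lam_scale\<close>)
  thus ?thesis using False by auto
qed

lemma zero_in_bil_rad: "(\<lambda>x. 0) \<in> bil_rad V \<mu>"
  by (auto simp: bil_rad_def lf_def bil_def)

definition lift :: "'v set \<Rightarrow> 'v \<Rightarrow> 'v set \<Rightarrow> ('v \<Rightarrow> 'k) \<Rightarrow> 'k \<Rightarrow> 'v \<Rightarrow> 'k" where
  "lift V' e V f c v = (if v \<in> V then f (v - coord V' e v *s e) + c * coord V' e v else 0)"

lemma lift_value:
  assumes "dsum V' e V" "x \<in> V'"
  shows "lift V' e V f c (x + d *s e) = f x + c * d"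
  using assms by (simp add: lift_def dsum_add coord_eq)

lemma
  assumes D: "dsum V' e V" and f: "f \<in> lf V'"
  shows lift_lf: "lift V' e V f c \<in> lf V"
    and lift_sub: "x \<in> V' \<Longrightarrow> lift V' e V f c x = f x" and lift_e: "lift V' e V f c e = c"
proof -
  note V' = dsum_subspace'[OF D]
  show "x \<in> V' \<Longrightarrow> lift V' e V f c x = f x" using lift_value[OF D, of x f c 0] by simp
  show "lift V' e V f c e = c"
    using lift_value[OF D subspace_0[OF V'], of f c 1] lf_zero[OF V' f] by simp
  have sc: "c *s (x + d *s e) = c *s x + (c * d) *s e" for c d x by (simp add: scale_right_distrib)
  have ad: "(x + c *s e) + (y + d *s e) = (x + y) + (c + d) *s e" for x y c d
    by (simp add: scale_left_distrib algebra_simps)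
  have "lift V' e V f c (u + v) = lift V' e V f c u + lift V' e V f c v" if mem: "u \<in> V" "v \<in> V" for u v
  proof -
    obtain x a where u: "x \<in> V'" "u = x + a *s e" using dsum_cases[OF D mem(1)] .
    obtain y d where v: "y \<in> V'" "v = y + d *s e" using dsum_cases[OF D mem(2)] .
    show ?thesis unfolding u(2) v(2) ad using u(1) v(1) V'
      by (simp add: lift_value[OF D] subspace_add lf_simps[OF f]) (simp add: algebra_simps)
  qed
  moreover have "lift V' e V f c (r *s u) = r * lift V' e V f c u" if mem: "u \<in> V" for r u
  proof -
    obtain x a where u: "x \<in> V'" "u = x + a *s e" using dsum_cases[OF D mem] .
    show ?thesis unfolding u(2) sc using u(1) V'
      by (simp add: lift_value[OF D] subspace_scale lf_simps[OF f]) (simp add: algebra_simps)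
  qed
  ultimately show "lift V' e V f c \<in> lf V" by (auto simp: lf_def lift_def[of _ _ V])
qed

lemma bil_cong:
  assumes "\<And>x. x \<in> V \<Longrightarrow> f x = f' x" "\<And>x. x \<in> V \<Longrightarrow> g x = g' x"
  shows "bil V \<mu> f g = bil V \<mu> f' g'"
  using assms by (simp add: bil_def)

lemma lf_restrict:
  assumes "g \<in> lf V" "V' \<subseteq> V" "subspace V'"
  shows "(\<lambda>x. if x \<in> V' then g x else 0) \<in> lf V'"
  using assms by (auto simp: lf_def subset_iff subspace_add subspace_scale)

lemma bil_rad_vanish:
  assumes "f \<in> bil_rad V' \<mu>" "g \<in> lf V" "V' \<subseteq> V" "subspace V'"
  shows "bil V' \<mu> f g = 0"
proof -
  have "bil V' \<mu> f g = bil V' \<mu> f (\<lambda>x. if x \<in> V' then g x else 0)" by (rule bil_cong) auto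
  thus ?thesis using assms lf_restrict[OF assms(2-4)] by (simp add: bil_rad_def)
qed

text \<open>The functional that kills \<open>V'\<close> and is 1 at \<open>e\<close> lies in the
  radical, so a radical functional of the pushed form may be extended with any value
  \<open>c\<close> at \<open>e\<close>.\<close>

lemma card_bil_rad_radical:
  assumes D: "dsum V' e V" and iso: "mom2 V' e \<mu> = 0" "mom V' e \<mu> = 0"
  shows "CARD('k) * card (bil_rad V' (push e \<mu>)) \<le> card (bil_rad V \<mu>)"
proof -
  define F where "F = (\<lambda>(f, c). lift V' e V f c)"
  note V' = dsum_subspace'[OF D]
  have "inj_on F (bil_rad V' (push e \<mu>) \<times> UNIV)"
  proof (rule inj_onI, clarify)
    fix f c g d assume fg: "f \<in> bil_rad V' (push e \<mu>)" "g \<in> bil_rad V' (push e \<mu>)" "F (f, c) = F (g, d)"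
    have f: "f \<in> lf V'" "g \<in> lf V'" using fg by (auto simp: bil_rad_def)
    have "f x = g x" for x
      using fg(3) lift_sub[OF D f(1), of x c] lift_sub[OF D f(2), of x d] lf_simps(3)[OF f(1)] lf_simps(3)[OF f(2)]
      by (cases "x \<in> V'") (auto simp: F_def)
    moreover have "c = d" using fun_cong[OF fg(3), of e] lift_e[OF D f(1)] lift_e[OF D f(2)] by (simp add: F_def)
    ultimately show "f = g \<and> c = d" by auto
  qed
  hence "card (bil_rad V' (push e \<mu>) \<times> (UNIV :: 'k set)) = card (F ` (bil_rad V' (push e \<mu>) \<times> UNIV))"
    by (simp add: card_image)
  also have "F ` (bil_rad V' (push e \<mu>) \<times> UNIV) \<subseteq> bil_rad V \<mu>"
  proof clarify
    fix f c assume f: "f \<in> bil_rad V' (push e \<mu>)"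
    hence fl: "f \<in> lf V'" by (simp add: bil_rad_def)
    have "bil V \<mu> (lift V' e V f c) g = 0" if g: "g \<in> lf V" for g
    proof -
      have "bil V' (push e \<mu>) (lift V' e V f c) g = bil V' (push e \<mu>) f g"
        by (rule bil_cong) (simp_all add: lift_sub[OF D fl])
      thus ?thesis
        using bil_dsum[OF D lift_lf[OF D fl] g] iso bil_rad_vanish[OF f g dsum_subset[OF D] V']
          lf_zero[OF dsum_subspace[OF D] g] lf_zero[OF dsum_subspace[OF D] lift_lf[OF D fl]] by simp
    qed
    thus "F (f, c) \<in> bil_rad V \<mu>" using lift_lf[OF D fl] by (simp add: F_def bil_rad_def)
  qed
  hence "card (F ` (bil_rad V' (push e \<mu>) \<times> UNIV)) \<le> card (bil_rad V \<mu>)"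
    by (intro card_mono) auto
  finally show ?thesis by (simp add: mult.commute)
qed

lemma card_bil_rad_hyperbolic:
  assumes D: "dsum V' e V" and iso: "mom2 V' e \<mu> = 0" and D': "dsum V'' (mom V' e \<mu>) V'"
  shows "card (bil_rad V'' (push (mom V' e \<mu>) (push e \<mu>))) \<le> card (bil_rad V \<mu>)"
proof -
  define s where "s = mom V' e \<mu>"
  define \<nu> where "\<nu> = push s (push e \<mu>)"
  define s' where "s' = mom V'' s (push e \<mu>)"
  note D' = D'[folded s_def]
  have s': "s' \<in> V''" unfolding s'_def by (rule mom_in[OF dsum_subspace'[OF D']])
  \<comment> \<open>The value 0 at \<open>s\<close> removes the term with \<open>g e\<close>; the
    value \<open>- f s'\<close> at \<open>e\<close> cancels the cross term \<open>g s * f s'\<close>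
    from the second splitting.\<close>
  define F where "F f = lift V' e V (lift V'' s V' f 0) (- f s')" for f
  note V' = dsum_subspace'[OF D] and V'' = dsum_subspace'[OF D'] and sub = dsum_subset[OF D] and sub' = dsum_subset[OF D']
  have "inj_on F (bil_rad V'' \<nu>)"
  proof (rule inj_onI)
    fix f g assume fg: "f \<in> bil_rad V'' \<nu>" "g \<in> bil_rad V'' \<nu>" "F f = F g"
    have f: "f \<in> lf V''" "g \<in> lf V''" using fg by (auto simp: bil_rad_def)
    have v: "F h x = h x" if "h \<in> lf V''" "x \<in> V''" for h x
      using lift_sub[OF D lift_lf[OF D' that(1)], of x] lift_sub[OF D' that(1), of x] that sub'
      by (auto simp: F_def)
    show "f = g"
    proof
      fix x show "f x = g x"
        using fg(3) v[OF f(1), of x] v[OF f(2), of x] lf_simps(3)[OF f(1)] lf_simps(3)[OF f(2)]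
        by (cases "x \<in> V''") auto
    qed
  qed
  hence "card (bil_rad V'' \<nu>) = card (F ` bil_rad V'' \<nu>)" by (simp add: card_image)
  also have "F ` bil_rad V'' \<nu> \<subseteq> bil_rad V \<mu>"
  proof clarify
    fix f assume f: "f \<in> bil_rad V'' \<nu>"
    hence fl: "f \<in> lf V''" by (simp add: bil_rad_def)
    define f' where "f' = lift V'' s V' f 0"
    have f': "f' \<in> lf V'" unfolding f'_def by (rule lift_lf[OF D' fl])
    have Fl: "F f \<in> lf V" unfolding F_def using f' by (intro lift_lf[OF D]) (simp add: f'_def)
    have Fx: "F f x = f' x" if "x \<in> V'" for x
      using lift_sub[OF D f' that] by (simp add: F_def f'_def)
    have Fe: "F f e = - f s'" using lift_e[OF D f'] by (simp add: F_def f'_def)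
    have f's: "f' s = 0" using lift_e[OF D' fl] by (simp add: f'_def)
    have f'x: "f' x = f x" if "x \<in> V''" for x using lift_sub[OF D' fl that] by (simp add: f'_def)
    have "bil V \<mu> (F f) g = 0" if g: "g \<in> lf V" for g
    proof -
      define g' where "g' x = (if x \<in> V' then g x else 0)" for x
      have g': "g' \<in> lf V'" unfolding g'_def by (rule lf_restrict[OF g sub V'])
      have sV: "s \<in> V'" using dsum_vector[OF D'] .
      have "bil V \<mu> (F f) g = bil V' (push e \<mu>) (F f) g + F f e * g s + g e * F f s"
        using bil_dsum[OF D Fl g] iso by (simp add: s_def)
      also have "F f s = 0" using Fx[OF sV] f's by simp
      also have "bil V' (push e \<mu>) (F f) g = bil V' (push e \<mu>) f' g'"
        by (rule bil_cong) (simp_all add: Fx g'_def)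
      also have "\<dots> = bil V'' \<nu> f' g' + g' s * f' s'"
        using bil_dsum[OF D' f' g', of "push e \<mu>"] f's by (simp add: \<nu>_def s'_def)
      also have "bil V'' \<nu> f' g' = bil V'' \<nu> f g'" by (rule bil_cong) (simp_all add: f'x)
      also have "\<dots> = 0" by (rule bil_rad_vanish[OF f g' sub' V''])
      finally show ?thesis using sV s' by (simp add: Fe f'x g'_def)
    qed
    thus "F f \<in> bil_rad V \<mu>" using Fl by (simp add: bil_rad_def)
  qed
  hence "card (F ` bil_rad V'' \<nu>) \<le> card (bil_rad V \<mu>)" by (intro card_mono) auto
  finally show ?thesis by (simp add: \<nu>_def s_def)
qed

lemma quad_rank_zero:
  assumes "Q \<in> quad V" "subspace V" "cl V Q = 0"
  shows "Q = (\<lambda>x. 0)"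
proof -
  have "qf V Q" using assms by (simp add: quad_def)
  hence "rad V Q = V"
    using assms by (intro subspace_dim_equal subspace_rad rad_subset) (auto simp: cl_def rk_def)
  hence "Q x = 0" if "x \<in> V" for x using that unfolding rad_def by blast
  thus ?thesis using assms by (auto simp: quad_def fun_eq_iff)
qed

lemma cl_zero: "cl V (\<lambda>x. 0) = 0"
proof -
  have "rad V (\<lambda>x. 0) = V" by (auto simp: rad_def brad_def polar_def)
  thus ?thesis by (simp add: cl_def rk_def)
qed

text \<open>For index 0 the weight is constantly 1, so the transform is a plain character sum. If it
  is nonzero, all forms are annihilated, in particular all products of two functionals, and
  \<open>bil\<close> vanishes.\<close>

lemma FT_zero_weight:
  assumes "subspace V"
  shows "FT V 0 \<mu> \<in> \<real>\<^sub>\<ge>\<^sub>0 \<and> (FT V 0 \<mu> \<noteq> 0 \<longrightarrow> CARD('k) ^ dim V \<le> card (bil_rad V \<mu>))"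
proof -
  have eq: "FT V 0 \<mu> = (if \<forall>Q\<in>quad V. Lam V \<mu> Q = 0 then of_nat (card (quad V)) else 0)"
    using sum_psi_Lam[of "quad V" V \<mu>] quad_add quad_scale by (simp add: FT_def wt_def)
  moreover have "CARD('k) ^ dim V \<le> card (bil_rad V \<mu>)" if "\<forall>Q\<in>quad V. Lam V \<mu> Q = 0"
  proof -
    have "bil_rad V \<mu> = lf V"
      using that quad_product[OF _ _ assms] by (auto simp: bil_rad_def bil_def Lam_def)
    thus ?thesis using card_lf[OF assms] card_subspace[OF assms] by simp
  qed
  ultimately show ?thesis by auto
qed

text \<open>The inequality says that \<open>bil V \<mu>\<close> has rank at most
  \<open>2 * k\<close>. Both claims pass through the recursions together: their coefficients are
  nonnegative, and the loss of dimension is matched by the change of index or of the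
  radical.\<close>

theorem FT_nonneg:
  assumes "subspace V"
  shows "FT V k \<mu> \<in> \<real>\<^sub>\<ge>\<^sub>0 \<and> (FT V k \<mu> \<noteq> 0 \<longrightarrow> CARD('k) ^ dim V \<le> CARD('k) ^ (2 * k) * card (bil_rad V \<mu>))"
  using assms
proof (induction "dim V" arbitrary: V k \<mu> rule: less_induct)
  case less
  note V = less.prems
  show ?case
  proof (cases k)
    case 0
    thus ?thesis using FT_zero_weight[OF V, of \<mu>] by simp
  next
    case (Suc j)
    show ?thesis
    proof (cases "dim V \<ge> 3")
      \<comment> \<open>An isotropic functional may be missing here. But in dimension at most 2 the
        positive index leaves weight on the zero form only, and \<open>2 * k\<close> is at least the
        dimension.\<close>
      case False
      have "wt V k Q * (if Q = (\<lambda>x. 0) then 1 else 0) = wt V k Q" if "Q \<in> quad V" for Q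
      proof (cases "cl V Q = 0")
        case True
        thus ?thesis using quad_rank_zero[OF that V] by simp
      next
        case False
        hence "(dim V + 1) div 2 - cl V Q = 0" using \<open>\<not> dim V \<ge> 3\<close> by simp
        thus ?thesis by (simp add: wt_def Suc gbin_eq_0)
      qed
      hence "FT V k \<mu> = (\<Sum>Q\<in>quad V. of_real (wt V k Q * (if Q = (\<lambda>x. 0) then 1 else 0)) * \<psi> (Lam V \<mu> Q))"
        unfolding FT_def by (intro sum.cong) auto
      also have "\<dots> = (\<Sum>Q\<in>quad V. if Q = (\<lambda>x. 0) then of_real (wt V k (\<lambda>x. 0)) else 0)"
        by (intro sum.cong) (auto simp: Lam_def psi_zero)
      also have "\<dots> = of_real (wt V k (\<lambda>x. 0))" using quad_zero by simp
      finally have "FT V k \<mu> \<in> \<real>\<^sub>\<ge>\<^sub>0" by (simp add: wt_def gbin_nonneg)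
      moreover have "card (bil_rad V \<mu>) > 0" using zero_in_bil_rad[of V \<mu>] by (auto simp: card_gt_0_iff)
      moreover have "CARD('k) ^ dim V \<le> CARD('k) ^ (2 * k)"
        using False Suc q_gt_1 by (intro power_increasing) auto
      ultimately show ?thesis by (metis One_nat_def Suc_leI mult.right_neutral mult_le_mono)
    next
      case True
      obtain \<phi> where \<phi>: "\<phi> \<in> lf V" "\<phi> \<noteq> (\<lambda>x. 0)" "bil V \<mu> \<phi> \<phi> = 0"
        using isotropic_functional[OF V True] .
      then obtain v where v: "\<phi> v \<noteq> 0" by auto
      define e where "e = inverse (\<phi> v) *s v"
      have vV: "v \<in> V" using v lf_simps(3)[OF \<phi>(1)] by blast
      have e: "e \<in> V" "\<phi> e = 1" using v vV V \<phi>(1) by (auto simp: e_def subspace_scale lf_simps)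
      define V' where "V' = {x \<in> V. \<phi> x = 0}"
      have D: "dsum V' e V" unfolding V'_def by (rule dsum_kernel[OF V \<phi>(1) e])
      note V' = dsum_subspace'[OF D] and dim = dsum_dim[OF D]
      have "bil V' (push e \<mu>) \<phi> \<phi> = 0" by (simp add: bil_def V'_def)
      moreover have "\<phi> (mom V' e \<mu>) = 0" using mom_in[OF V', of e \<mu>] by (simp add: V'_def)
      \<comment> \<open>As \<open>\<phi>\<close> vanishes on \<open>V'\<close> and is 1 at
        \<open>e\<close>, its isotropy is exactly the vanishing of the second moment.\<close>
      ultimately have iso: "mom2 V' e \<mu> = 0" using bil_dsum[OF D \<phi>(1) \<phi>(1), of \<mu>] \<phi>(3) e by simp
      show ?thesis
      proof (cases "mom V' e \<mu> = 0")
        case False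
        then obtain V'' where D': "dsum V'' (mom V' e \<mu>) V'"
          using dsum_exists[OF V' mom_in[OF V']] by blast
        let ?\<nu> = "push (mom V' e \<mu>) (push e \<mu>)"
        have IH: "FT V'' j ?\<nu> \<in> \<real>\<^sub>\<ge>\<^sub>0"
          "FT V'' j ?\<nu> \<noteq> 0 \<Longrightarrow> CARD('k) ^ dim V'' \<le> CARD('k) ^ (2 * j) * card (bil_rad V'' ?\<nu>)"
          using less.hyps[of V'' j ?\<nu>] dim dsum_dim[OF D'] dsum_subspace'[OF D'] by auto
        note eq = FT_hyperbolic[OF D iso D', of j, folded Suc]
        have "FT V k \<mu> \<in> \<real>\<^sub>\<ge>\<^sub>0" unfolding eq by (intro nonneg_Reals_mult_I IH) simp
        moreover have "CARD('k) ^ dim V \<le> CARD('k) ^ (2 * k) * card (bil_rad V \<mu>)" if "FT V k \<mu> \<noteq> 0"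
        proof -
          have "CARD('k) ^ dim V = CARD('k) ^ 2 * CARD('k) ^ dim V''"
            using dim dsum_dim[OF D'] by (simp add: power2_eq_square)
          also have "\<dots> \<le> CARD('k) ^ 2 * (CARD('k) ^ (2 * j) * card (bil_rad V'' ?\<nu>))"
            using IH(2) that unfolding eq by (intro mult_le_mono2) auto
          also have "\<dots> \<le> CARD('k) ^ 2 * (CARD('k) ^ (2 * j) * card (bil_rad V \<mu>))"
            using card_bil_rad_hyperbolic[OF D iso D'] by (intro mult_le_mono2)
          finally show ?thesis using Suc by (simp add: power_add[symmetric] mult.assoc[symmetric])
        qed
        ultimately show ?thesis by blast
      next
        case s: True
        have IH: "FT V' i (push e \<mu>) \<in> \<real>\<^sub>\<ge>\<^sub>0"
          "FT V' i (push e \<mu>) \<noteq> 0 \<Longrightarrow> CARD('k) ^ dim V' \<le> CARD('k) ^ (2 * i) * card (bil_rad V' (push e \<mu>))" for i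
          using less.hyps[of V' i "push e \<mu>"] dim V' by auto
        \<comment> \<open>The lost dimension is paid for by the factor \<open>q\<close> that the
          radical gains; lowering the index only strengthens the bound.\<close>
        have main: "CARD('k) ^ dim V \<le> CARD('k) ^ (2 * k) * card (bil_rad V \<mu>)"
          if i: "i \<le> k" "FT V' i (push e \<mu>) \<noteq> 0" for i
        proof -
          have "CARD('k) ^ dim V = CARD('k) * CARD('k) ^ dim V'" using dim by simp
          also have "\<dots> \<le> CARD('k) * (CARD('k) ^ (2 * i) * card (bil_rad V' (push e \<mu>)))"
            by (intro mult_le_mono2 IH i)
          also have "\<dots> = CARD('k) ^ (2 * i) * (CARD('k) * card (bil_rad V' (push e \<mu>)))" by simp
          also have "\<dots> \<le> CARD('k) ^ (2 * i) * card (bil_rad V \<mu>)"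
            by (intro mult_le_mono2 card_bil_rad_radical[OF D iso s])
          also have "\<dots> \<le> CARD('k) ^ (2 * k) * card (bil_rad V \<mu>)"
            using i q_gt_1 by (intro mult_le_mono1 power_increasing) auto
          finally show ?thesis .
        qed
        show ?thesis
        proof (cases "even (dim V)")
          case True
          note eq = FT_radical_even[OF D iso s True, of k]
          have "FT V k \<mu> \<in> \<real>\<^sub>\<ge>\<^sub>0" unfolding eq by (intro nonneg_Reals_mult_I IH) simp
          moreover have "FT V k \<mu> \<noteq> 0 \<Longrightarrow> FT V' k (push e \<mu>) \<noteq> 0" using eq by auto
          ultimately show ?thesis using main[of k] by blast
        next
          case False
          note eq = FT_radical_odd(1)[OF D iso s False, of j, folded Suc]
          have "FT V k \<mu> \<in> \<real>\<^sub>\<ge>\<^sub>0" unfolding eq by (intro nonneg_Reals_add_I nonneg_Reals_mult_I IH) simp_all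
          moreover have "FT V k \<mu> \<noteq> 0 \<Longrightarrow> FT V' k (push e \<mu>) \<noteq> 0 \<or> FT V' j (push e \<mu>) \<noteq> 0" using eq by auto
          ultimately show ?thesis using main[of k] main[of j] Suc by auto
        qed
      qed
    qed
  qed
qed

text \<open>At \<open>\<mu> = 0\<close> all moments vanish along any splitting, so only the radical
  recursions occur. In odd dimension they combine to the Pascal rule; the exponent base is the odd
  one of \<open>dim V\<close> and \<open>dim V + 1\<close>.\<close>

theorem FT_at_zero:
  assumes "subspace V"
  shows "FT V k 0 = of_real (real CARD('k) ^ ((if odd (dim V) then dim V else dim V + 1) * ((dim V + 1) div 2 - k))
    * gbin (real CARD('k) ^ 2) ((dim V + 1) div 2) k)"
  using assms
proof (induction V arbitrary: k rule: subspace_dsum_induct)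
  case zero
  have "Q = (\<lambda>x. 0)" if "Q \<in> quad {0}" for Q
    using quad_rank_zero[OF that] cl_le[of "{0}" Q] by simp
  hence "quad {0} = {\<lambda>x. 0}" using quad_zero[of "{0}"] by blast
  moreover have "wt {0} k Q = (if k = 0 then 1 else 0)" for Q by (cases k) (auto simp: wt_def)
  moreover have "gbin (real CARD('k) ^ 2) 0 k = (if k = 0 then 1 else 0)" by (cases k) auto
  ultimately show ?case by (simp add: FT_def Lam_def psi_zero)
next
  case (dsum V' e V)
  note D = dsum(1) and dim = dsum_dim[OF dsum(1)]
  define q where "q = real CARD('k)"
  have iso: "mom2 V' e 0 = 0" "mom V' e 0 = 0" and p: "push e 0 = 0"
    by (simp_all add: mom2_def mom_def push_def fun_eq_iff)
  show ?case
  proof (cases "even (dim V)")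
    case True
    then obtain n where n: "dim V = 2 * n" by blast
    have "odd (dim V')" using True dim by simp
    moreover have "(dim V' + 1) div 2 = n" "(dim V + 1) div 2 = n" using n dim by auto
    ultimately have n': "(dim V' + 1) div 2 = n" "(dim V + 1) div 2 = n" "odd (dim V')" by auto
    have "(dim V + 1) * (n - k) = (2 + dim V') * (n - k)" by (simp add: dim)
    hence e: "q ^ ((dim V + 1) * (n - k)) = q ^ (2 * (n - k)) * q ^ (dim V' * (n - k))"
      by (simp only: add_mult_distrib power_add)
    have d2: "dim V div 2 = n" by (simp add: n)
    have "FT V k 0 = of_real (q ^ (2 * (n - k)) * (q ^ (dim V' * (n - k)) * gbin (q ^ 2) n k))"
      unfolding FT_radical_even[OF D iso True] p dsum(2) n'(1,2) d2 using n'(3) by (simp add: q_def)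
    also have "\<dots> = of_real (q ^ ((dim V + 1) * (n - k)) * gbin (q ^ 2) n k)" by (simp only: e mult.assoc)
    finally show ?thesis unfolding n'(2) using True by (simp add: q_def zero_fun_def)
  next
    case False
    then obtain n where n: "dim V = 2 * n + 1" by (auto elim: oddE)
    have n': "(dim V' + 1) div 2 = n" "even (dim V')" "(dim V + 1) div 2 = Suc n" "dim V div 2 = n"
      "dim V' + 1 = dim V" using n dim by auto
    show ?thesis
    proof (cases k)
      case 0
      show ?thesis
        unfolding 0 FT_radical_odd(2)[OF D iso False] p dsum(2) n'(1,3)
        using n'(2) False n'(5) by (simp add: power_add[symmetric] algebra_simps)
    next
      case (Suc j)
      define m where "m = dim V"
      have e1: "q ^ m * (q ^ (m * (n - Suc j)) * gbin (q ^ 2) n (Suc j)) = q ^ (m * (n - j)) * gbin (q ^ 2) n (Suc j)"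
      proof (cases "Suc j \<le> n")
        case True
        hence "n - j = Suc (n - Suc j)" by simp
        thus ?thesis by (simp add: power_add)
      qed (simp add: gbin_eq_0)
      have "FT V k 0 = of_real (q ^ m * (q ^ (m * (n - Suc j)) * gbin (q ^ 2) n (Suc j))
          + q ^ (2 * (n - j)) * (q ^ (m * (n - j)) * gbin (q ^ 2) n j))"
        unfolding Suc FT_radical_odd(1)[OF D iso False] p dsum(2) n'(1,3,4,5)
        using n'(2) by (simp add: m_def q_def)
      also have "\<dots> = of_real (q ^ (m * (n - j)) * gbin (q ^ 2) (Suc n) (Suc j))"
        unfolding e1 power_mult[of q 2] by (simp add: algebra_simps)
      finally show ?thesis using False Suc n' by (simp add: m_def q_def zero_fun_def)
    qed
  qed
qed


subsection \<open>Linear programming bound and duality\<close>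

text \<open>Taken inside all functions \<open>\<mu>\<close>, a redundant model of the dual of the
  space of forms. Each functional is counted \<open>card (annih (quad UNIV))\<close> times, and this
  factor cancels in the end.\<close>

definition annih :: "('v \<Rightarrow> 'k) set \<Rightarrow> ('v \<Rightarrow> 'k) set" where
  "annih G = {\<mu>. \<forall>Q\<in>G. Lam UNIV \<mu> Q = 0}"

lemma sum_psi_measures:
  "(\<Sum>\<mu>\<in>UNIV. \<psi> (Lam UNIV \<mu> D)) = (if D = 0 then of_nat (CARD('v \<Rightarrow> 'k)) else 0)"
proof (cases "D = 0")
  case True
  thus ?thesis by (simp add: Lam_def psi_zero)
next
  case False
  then obtain v where v: "D v \<noteq> 0" by (auto simp: fun_eq_iff)
  obtain a where a: "\<psi> (a * D v) \<noteq> 1" using psi_nontrivial_multiple[OF v] by blast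
  have "Lam UNIV (\<lambda>x. if x = v then a else 0) D = (\<Sum>x\<in>UNIV. if x = v then a * D x else 0)"
    unfolding Lam_def by (intro sum.cong) auto
  hence "Lam UNIV (\<lambda>x. if x = v then a else 0) D = a * D v" by simp
  hence "(\<Sum>\<mu>\<in>UNIV. \<psi> (Lam UNIV \<mu> D)) = 0"
    using a by (intro char_sum_zero[where g = "\<lambda>x. if x = v then a else 0"])
      (auto simp: Lam_def distrib_right sum.distrib)
  thus ?thesis using False by simp
qed

lemma card_annih:
  assumes add: "\<And>P Q. P \<in> G \<Longrightarrow> Q \<in> G \<Longrightarrow> P + Q \<in> G"
    and scale: "\<And>c Q. Q \<in> G \<Longrightarrow> (\<lambda>x. c * Q x) \<in> G" and zero: "0 \<in> G"
  shows "card (annih G) * card G = CARD('v \<Rightarrow> 'k)"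
proof -
  have "(\<Sum>\<mu>\<in>UNIV. \<Sum>Q\<in>G. \<psi> (Lam UNIV \<mu> Q)) = (\<Sum>\<mu>\<in>UNIV. if \<mu> \<in> annih G then of_nat (card G) else 0)"
    using sum_psi_Lam[of G UNIV] add scale by (intro sum.cong) (auto simp: annih_def)
  also have "\<dots> = of_nat (card (annih G) * card G)" by (simp add: sum.If_cases)
  finally have "of_nat (card (annih G) * card G) = (\<Sum>Q\<in>G. \<Sum>\<mu>\<in>UNIV. \<psi> (Lam UNIV \<mu> Q))"
    by (subst sum.swap) simp
  also have "\<dots> = of_nat (CARD('v \<Rightarrow> 'k))" using zero by (simp add: sum_psi_measures)
  finally show ?thesis by (simp only: of_nat_eq_iff)
qed

lemma zero_quad: "0 \<in> quad V"
  using quad_zero by (simp add: zero_fun_def)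

lemma quad_minus:
  assumes "Q \<in> quad V"
  shows "- Q \<in> quad V"
proof -
  have "(\<lambda>x. (- 1) * Q x) = - Q" by (simp add: fun_eq_iff)
  thus ?thesis using quad_scale[OF assms, of "- 1"] by simp
qed

lemma quad_diff: "P \<in> quad V \<Longrightarrow> Q \<in> quad V \<Longrightarrow> P - Q \<in> quad V"
  using quad_add[OF _ quad_minus, of P V Q] by simp

lemma card_quad_annih: "card (annih (quad UNIV)) * card (quad UNIV) = CARD('v \<Rightarrow> 'k)"
  by (intro card_annih quad_add quad_scale zero_quad)

lemma Lam_minus: "Lam V \<mu> (- Q) = - Lam V \<mu> Q"
  by (simp add: Lam_def sum_negf)

lemma FT_annih:
  assumes "\<mu> \<in> annih (quad UNIV)"
  shows "FT UNIV k \<mu> = of_real (\<Sum>Q\<in>quad UNIV. wt UNIV k Q)"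
  unfolding FT_def using assms by (simp add: annih_def psi_zero)

text \<open>Fourier inversion over the redundant model; \<open>- P\<close> appears because both
  characters carry the same sign.\<close>

lemma sum_FT:
  assumes "P \<in> quad UNIV"
  shows "(\<Sum>\<mu>\<in>UNIV. FT UNIV k \<mu> * \<psi> (Lam UNIV \<mu> P)) = of_real (wt UNIV k (- P)) * of_nat CARD('v \<Rightarrow> 'k)"
proof -
  have "(\<Sum>\<mu>\<in>UNIV. FT UNIV k \<mu> * \<psi> (Lam UNIV \<mu> P))
    = (\<Sum>\<mu>\<in>UNIV. \<Sum>D\<in>quad UNIV. of_real (wt UNIV k D) * \<psi> (Lam UNIV \<mu> (D + P)))"
    by (simp add: FT_def sum_distrib_right Lam_add psi_add mult.assoc)
  also have "\<dots> = (\<Sum>D\<in>quad UNIV. of_real (wt UNIV k D) * (\<Sum>\<mu>\<in>UNIV. \<psi> (Lam UNIV \<mu> (D + P))))"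
    by (subst sum.swap) (simp add: sum_distrib_left)
  also have "\<dots> = (\<Sum>D\<in>quad UNIV. if D = - P then of_real (wt UNIV k (- P)) * of_nat CARD('v \<Rightarrow> 'k) else 0)"
    by (intro sum.cong refl) (simp add: sum_psi_measures eq_neg_iff_add_eq_0[symmetric])
  finally show ?thesis using quad_minus[OF assms] by simp
qed

text \<open>Delsarte's argument: \<open>FT\<close> times the squared modulus of the character sum of
  \<open>Z\<close>, summed over all \<open>\<mu>\<close>, is evaluated by inversion, where only the
  diagonal of \<open>Z\<close> survives, and bounded below by the trivial characters.\<close>

lemma linear_programming_bound:
  assumes Z: "Z \<subseteq> quad UNIV" and sep: "\<And>P Q. P \<in> Z \<Longrightarrow> Q \<in> Z \<Longrightarrow> P \<noteq> Q \<Longrightarrow> wt UNIV k (P - Q) = 0"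
  shows "real (card Z) * (\<Sum>Q\<in>quad UNIV. wt UNIV k Q) \<le> real (card (quad UNIV)) * wt UNIV k 0"
proof (cases "Z = {}")
  case True
  have "wt UNIV k 0 \<ge> 0" by (simp add: wt_def gbin_nonneg)
  thus ?thesis using True by simp
next
  case False
  hence Z0: "card Z > 0" by (simp add: card_gt_0_iff)
  define S where "S \<mu> = (\<Sum>P\<in>Z. \<psi> (Lam UNIV \<mu> P))" for \<mu>
  define W where "W = (\<Sum>Q\<in>quad UNIV. wt UNIV k Q)"
  define A where "A = annih (quad UNIV)"
  define g where "g \<mu> = Re (FT UNIV k \<mu>) * (norm (S \<mu>))\<^sup>2" for \<mu>
  have g: "complex_of_real (g \<mu>) = FT UNIV k \<mu> * (\<Sum>P\<in>Z. \<Sum>Q\<in>Z. \<psi> (Lam UNIV \<mu> (P - Q)))" for \<mu>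
  proof -
    have "(\<Sum>P\<in>Z. \<Sum>Q\<in>Z. \<psi> (Lam UNIV \<mu> (P - Q))) = S \<mu> * cnj (S \<mu>)"
      unfolding S_def by (simp add: sum_product psi_minus[symmetric] psi_add[symmetric] Lam_minus[symmetric] Lam_add[symmetric])
    also have "\<dots> = of_real ((norm (S \<mu>))\<^sup>2)" by (rule complex_norm_square[symmetric])
    finally show ?thesis
      using conjunct1[OF FT_nonneg[OF subspace_UNIV, of k \<mu>]]
      by (simp add: g_def complex_nonneg_Reals_iff complex_eq_iff)
  qed
  have "complex_of_real (\<Sum>\<mu>\<in>UNIV. g \<mu>) = (\<Sum>\<mu>\<in>UNIV. \<Sum>P\<in>Z. \<Sum>Q\<in>Z. FT UNIV k \<mu> * \<psi> (Lam UNIV \<mu> (P - Q)))"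
    by (simp add: g sum_distrib_left)
  also have "\<dots> = (\<Sum>P\<in>Z. \<Sum>Q\<in>Z. \<Sum>\<mu>\<in>UNIV. FT UNIV k \<mu> * \<psi> (Lam UNIV \<mu> (P - Q)))"
    by (subst sum.swap) (intro sum.cong refl sum.swap)
  also have "\<dots> = (\<Sum>P\<in>Z. \<Sum>Q\<in>Z. of_real (wt UNIV k (Q - P)) * of_nat CARD('v \<Rightarrow> 'k))"
    using Z by (intro sum.cong refl) (subst sum_FT, auto intro: quad_diff)
  also have "\<dots> = (\<Sum>P\<in>Z. \<Sum>Q\<in>Z. if Q = P then of_real (wt UNIV k 0) * of_nat CARD('v \<Rightarrow> 'k) else 0)"
    using sep by (intro sum.cong refl) auto
  also have "\<dots> = complex_of_real (real (card Z) * wt UNIV k 0 * real CARD('v \<Rightarrow> 'k))" by simp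
  finally have total: "(\<Sum>\<mu>\<in>UNIV. g \<mu>) = real (card Z) * wt UNIV k 0 * real CARD('v \<Rightarrow> 'k)"
    by (simp only: of_real_eq_iff)
  have "g \<mu> \<ge> 0" for \<mu>
    using conjunct1[OF FT_nonneg[OF subspace_UNIV, of k \<mu>]] by (simp add: g_def complex_nonneg_Reals_iff)
  \<comment> \<open>On \<open>A\<close> every form is annihilated, so the transform is the total
    weight \<open>W\<close> and the character sum is \<open>card Z\<close>.\<close>
  hence "(\<Sum>\<mu>\<in>A. g \<mu>) \<le> (\<Sum>\<mu>\<in>UNIV. g \<mu>)" by (intro sum_mono2) auto
  moreover have "g \<mu> = W * (real (card Z))\<^sup>2" if "\<mu> \<in> A" for \<mu>
  proof -
    have "S \<mu> = (\<Sum>P\<in>Z. 1)"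
      unfolding S_def using that Z by (intro sum.cong) (auto simp: A_def annih_def psi_zero)
    thus ?thesis using FT_annih[of \<mu> k] that by (simp add: g_def A_def W_def)
  qed
  ultimately have "real (card A) * (W * (real (card Z))\<^sup>2) \<le> real (card Z) * wt UNIV k 0 * real CARD('v \<Rightarrow> 'k)"
    by (simp add: total)
  also have "real CARD('v \<Rightarrow> 'k) = real (card A) * real (card (quad UNIV))"
    unfolding A_def by (metis card_quad_annih of_nat_mult)
  finally have "(real (card A) * real (card Z)) * (real (card Z) * W)
      \<le> (real (card A) * real (card Z)) * (real (card (quad UNIV)) * wt UNIV k 0)"
    by (simp add: power2_eq_square mult_ac zero_fun_def)
  moreover have "card A > 0"
    using card_quad_annih by (metis A_def gr0I mult_0 zero_less_card_finite zero_less_iff_neq_zero)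
  ultimately show ?thesis using Z0 by (simp add: W_def)
qed

text \<open>Poisson summation: the character sum of \<open>Y\<close> is supported on
  \<open>annih Y\<close>, where by \<open>dual\<close> the transform lives on the trivial part
  only.\<close>

lemma additive_weight:
  assumes Y: "Y \<subseteq> quad UNIV" and add: "\<And>P Q. P \<in> Y \<Longrightarrow> Q \<in> Y \<Longrightarrow> P + Q \<in> Y"
    and scale: "\<And>c Q. Q \<in> Y \<Longrightarrow> (\<lambda>x. c * Q x) \<in> Y"
    and dual: "\<And>\<mu>. \<mu> \<in> annih Y \<Longrightarrow> \<mu> \<notin> annih (quad UNIV) \<Longrightarrow> FT UNIV k \<mu> = 0"
  shows "real (card (quad UNIV)) * (\<Sum>Q\<in>Y. wt UNIV k Q) = real (card Y) * (\<Sum>Q\<in>quad UNIV. wt UNIV k Q)"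
proof -
  define W where "W = (\<Sum>Q\<in>quad UNIV. wt UNIV k Q)"
  define A where "A = annih (quad UNIV)"
  have AY: "A \<subseteq> annih Y" using Y by (auto simp: A_def annih_def)
  have neg: "- Q \<in> Y" if "Q \<in> Y" for Q
  proof -
    have "(\<lambda>x. (- 1) * Q x) = - Q" by (simp add: fun_eq_iff)
    thus ?thesis using scale[OF that, of "- 1"] by simp
  qed
  have "(\<Sum>\<mu>\<in>UNIV. FT UNIV k \<mu> * (\<Sum>Q\<in>Y. \<psi> (Lam UNIV \<mu> Q)))
    = (\<Sum>\<mu>\<in>UNIV. if \<mu> \<in> A then of_real W * of_nat (card Y) else 0)"
    using sum_psi_Lam[of Y UNIV] add scale AY dual FT_annih
    by (intro sum.cong) (auto simp: annih_def A_def W_def)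
  also have "\<dots> = of_real (real (card A) * (W * real (card Y)))" by (simp add: sum.If_cases)
  finally have "of_real (real (card A) * (W * real (card Y)))
    = (\<Sum>Q\<in>Y. \<Sum>\<mu>\<in>UNIV. FT UNIV k \<mu> * \<psi> (Lam UNIV \<mu> Q))"
    by (subst sum.swap) (simp add: sum_distrib_left)
  also have "\<dots> = (\<Sum>Q\<in>Y. of_real (wt UNIV k (- Q)) * of_nat CARD('v \<Rightarrow> 'k))"
    using Y by (intro sum.cong refl sum_FT) auto
  also have "\<dots> = (\<Sum>Q\<in>Y. of_real (wt UNIV k Q) * of_nat CARD('v \<Rightarrow> 'k))"
    by (rule sum.reindex_bij_witness[of _ uminus uminus]) (auto simp: neg)
  also have "\<dots> = of_real ((\<Sum>Q\<in>Y. wt UNIV k Q) * real CARD('v \<Rightarrow> 'k))"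
    by (simp add: sum_distrib_right)
  finally have "real (card A) * (W * real (card Y)) = (\<Sum>Q\<in>Y. wt UNIV k Q) * real CARD('v \<Rightarrow> 'k)"
    by (simp only: of_real_eq_iff)
  moreover have "real CARD('v \<Rightarrow> 'k) = real (card A) * real (card (quad UNIV))"
    unfolding A_def by (metis card_quad_annih of_nat_mult)
  moreover have "card A > 0"
    using card_quad_annih by (metis A_def gr0I mult_0 zero_less_card_finite zero_less_iff_neq_zero)
  hence "A \<noteq> {}" by auto
  ultimately show ?thesis by (simp add: W_def mult_ac)
qed

lemma sum_wt:
  assumes "odd (dim UNIV)"
  shows "(\<Sum>Q\<in>quad UNIV. wt UNIV k Q) = real CARD('k) ^ (dim UNIV * ((dim UNIV + 1) div 2 - k)) * wt UNIV k 0"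
proof -
  have "complex_of_real (\<Sum>Q\<in>quad UNIV. wt UNIV k Q) = FT UNIV k 0"
    by (simp add: FT_def Lam_def psi_zero)
  also have "\<dots> = of_real (real CARD('k) ^ (dim UNIV * ((dim UNIV + 1) div 2 - k)) * wt UNIV k 0)"
    using FT_at_zero[OF subspace_UNIV, of k] assms cl_zero[of UNIV] by (simp add: wt_def zero_fun_def)
  finally show ?thesis by (simp only: of_real_eq_iff)
qed

lemma card_quad:
  assumes "odd (dim UNIV)"
  shows "card (quad UNIV) = CARD('k) ^ (dim UNIV * ((dim UNIV + 1) div 2))"
proof -
  have "real (card (quad UNIV)) = real (CARD('k) ^ (dim UNIV * ((dim UNIV + 1) div 2)))"
    using sum_wt[OF assms, of 0] by (simp add: wt_def)
  thus ?thesis by (simp only: of_nat_eq_iff)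
qed

text \<open>A Gaussian binomial vanishes exactly when its upper index is the smaller one, which here
  means \<open>t < cl UNIV Q\<close>.\<close>

lemma
  assumes "odd (dim UNIV)" "2 * t + 1 \<le> dim UNIV"
  defines "k \<equiv> (dim UNIV + 1) div 2 - t"
  shows wt_zero_pos: "wt UNIV k 0 > 0" and wt_eq_0_iff: "wt UNIV k Q = 0 \<longleftrightarrow> 2 * t + 1 \<le> rk UNIV Q"
proof -
  have q: "real CARD('k) ^ 2 > 0" using q_gt_1 by simp
  show "wt UNIV k 0 > 0" using gbin_pos[OF q] cl_zero by (simp add: wt_def k_def zero_fun_def)
  have "wt UNIV k Q = 0 \<longleftrightarrow> (dim UNIV + 1) div 2 - cl UNIV Q < k"
    unfolding wt_def using gbin_pos[OF q] gbin_eq_0 by (metis leI less_irrefl)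
  also have "\<dots> \<longleftrightarrow> t < cl UNIV Q" using assms(1,2) cl_le[of UNIV Q] by (auto simp: k_def)
  also have "\<dots> \<longleftrightarrow> 2 * t + 1 \<le> rk UNIV Q" by (auto simp: cl_def)
  finally show "wt UNIV k Q = 0 \<longleftrightarrow> 2 * t + 1 \<le> rk UNIV Q" .
qed

theorem card_code_le:
  assumes odd: "odd (dim UNIV)" and t: "2 * t + 1 \<le> dim UNIV" and Z: "Z \<subseteq> quad UNIV"
    and sep: "\<And>P Q. P \<in> Z \<Longrightarrow> Q \<in> Z \<Longrightarrow> P \<noteq> Q \<Longrightarrow> 2 * t + 1 \<le> rk UNIV (P - Q)"
  shows "card Z \<le> CARD('k) ^ (dim UNIV * ((dim UNIV + 1) div 2 - t))"
proof -
  define N where "N = (dim UNIV + 1) div 2"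
  define q where "q = real CARD('k)"
  have q: "q > 0" using q_gt_1 by (simp add: q_def)
  have tN: "t \<le> N" using t by (simp add: N_def)
  note w = wt_zero_pos[OF odd t, folded N_def] and w0 = wt_eq_0_iff[OF odd t, folded N_def]
  have "real (card Z) * (q ^ (dim UNIV * t) * wt UNIV (N - t) 0) \<le> q ^ (dim UNIV * N) * wt UNIV (N - t) 0"
    using linear_programming_bound[OF Z, of "N - t"] sep w0 sum_wt[OF odd, of "N - t", folded N_def]
      card_quad[OF odd, folded N_def] tN
    by (simp add: q_def)
  hence "real (card Z) * q ^ (dim UNIV * t) \<le> q ^ (dim UNIV * N)"
    using w by (simp add: mult.assoc[symmetric])
  also have "q ^ (dim UNIV * N) = q ^ (dim UNIV * (N - t)) * q ^ (dim UNIV * t)"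
    using tN by (simp add: power_add[symmetric] distrib_left[symmetric])
  finally have "real (card Z) \<le> q ^ (dim UNIV * (N - t))" using q by simp
  thus ?thesis unfolding q_def N_def by (simp only: of_nat_power[symmetric] of_nat_le_iff)
qed

theorem additive_code_rank:
  assumes odd: "odd (dim UNIV)" and t: "2 * t + 1 \<le> dim UNIV" and Y: "Y \<subseteq> quad UNIV"
    and add: "\<And>P Q. P \<in> Y \<Longrightarrow> Q \<in> Y \<Longrightarrow> P + Q \<in> Y"
    and scale: "\<And>c Q. Q \<in> Y \<Longrightarrow> (\<lambda>x. c * Q x) \<in> Y" and zero: "0 \<in> Y"
    and card: "card Y = CARD('k) ^ (dim UNIV * ((dim UNIV + 1) div 2 - t))"
    and dual: "\<And>\<mu>. \<mu> \<in> annih Y \<Longrightarrow> \<mu> \<notin> annih (quad UNIV) \<Longrightarrow> card (bil_rad UNIV \<mu>) * CARD('k) ^ 2 \<le> CARD('k) ^ (2 * t)"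
    and Q: "Q \<in> Y" "Q \<noteq> 0"
  shows "2 * t + 1 \<le> rk UNIV Q"
proof -
  define N where "N = (dim UNIV + 1) div 2"
  define q where "q = real CARD('k)"
  have q: "q > 0" using q_gt_1 by (simp add: q_def)
  have tN: "t \<le> N" using t by (simp add: N_def)
  note w = wt_zero_pos[OF odd t, folded N_def] and w0 = wt_eq_0_iff[OF odd t, folded N_def]
  \<comment> \<open>A nonzero transform needs a radical of size at least
    \<open>q ^ (2 * t - 1)\<close>, since \<open>2 * N\<close> is one more than the dimension;
    \<open>dual\<close> allows at most \<open>q ^ (2 * t - 2)\<close>.\<close>
  have FT0: "FT UNIV (N - t) \<mu> = 0" if "\<mu> \<in> annih Y" "\<mu> \<notin> annih (quad UNIV)" for \<mu>
  proof (rule ccontr)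
    assume "FT UNIV (N - t) \<mu> \<noteq> 0"
    hence "CARD('k) ^ dim UNIV \<le> CARD('k) ^ (2 * (N - t)) * card (bil_rad UNIV \<mu>)"
      using FT_nonneg[OF subspace_UNIV] by blast
    hence "CARD('k) ^ dim UNIV * CARD('k) ^ 2 \<le> CARD('k) ^ (2 * (N - t)) * card (bil_rad UNIV \<mu>) * CARD('k) ^ 2"
      by (rule mult_le_mono1)
    also have "\<dots> = CARD('k) ^ (2 * (N - t)) * (card (bil_rad UNIV \<mu>) * CARD('k) ^ 2)" by (rule mult.assoc)
    also have "\<dots> \<le> CARD('k) ^ (2 * (N - t)) * CARD('k) ^ (2 * t)"
      by (intro mult_le_mono2 dual that)
    also have "\<dots> = CARD('k) ^ (2 * (N - t) + 2 * t)" by (rule power_add[symmetric])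
    also have "2 * (N - t) + 2 * t = 2 * N" using tN by simp
    finally have "CARD('k) ^ (dim UNIV + 2) \<le> CARD('k) ^ (2 * N)" by (simp only: power_add)
    hence "dim UNIV + 2 \<le> 2 * N" using q_gt_1 by (simp only: power_increasing_iff)
    thus False by (simp add: N_def)
  qed
  have "q ^ (dim UNIV * N) * (\<Sum>P\<in>Y. wt UNIV (N - t) P)
      = q ^ (dim UNIV * (N - t)) * (q ^ (dim UNIV * t) * wt UNIV (N - t) 0)"
    using additive_weight[OF Y add scale FT0] sum_wt[OF odd, of "N - t", folded N_def]
      card_quad[OF odd, folded N_def] card[folded N_def] tN
    by (simp add: q_def)
  also have "\<dots> = q ^ (dim UNIV * N) * wt UNIV (N - t) 0"
    using tN by (simp add: mult.assoc[symmetric] power_add[symmetric] distrib_left[symmetric])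
  finally have sum: "(\<Sum>P\<in>Y. wt UNIV (N - t) P) = wt UNIV (N - t) 0" using q by simp
  have nn: "wt UNIV (N - t) P \<ge> 0" for P by (simp add: wt_def gbin_nonneg)
  \<comment> \<open>The zero form alone exhausts the nonnegative sum, so every other form in
    \<open>Y\<close> has weight 0.\<close>
  have "(\<Sum>P\<in>{0, Q}. wt UNIV (N - t) P) \<le> (\<Sum>P\<in>Y. wt UNIV (N - t) P)"
    using Q zero nn by (intro sum_mono2) auto
  hence "wt UNIV (N - t) Q = 0" using sum Q(2) nn[of Q] by simp
  thus ?thesis using w0 by simp
qed

end

subsection \<open>A nontrivial additive character\<close>

lemma power_root_of_unity_mod:
  fixes w :: "'a::comm_monoid_mult"
  assumes "w ^ p = 1"
  shows "w ^ (a mod p) = w ^ a"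
proof -
  have "w ^ (p * (a div p) + a mod p) = w ^ (p * (a div p)) * w ^ (a mod p)" by (rule power_add)
  also have "w ^ (p * (a div p)) = 1" by (simp add: power_mult assms)
  finally show ?thesis by simp
qed

lemma finite_field_card_CHAR_power:
  assumes "primepow CARD('a::finite_field)"
  obtains n where "n > 0" "CARD('a) = CHAR('a) ^ n"
proof -
  obtain p n where pn: "prime p" "n > 0" "CARD('a) = p ^ n" using assms by (auto simp: primepow_def)
  have "prime CHAR('a)" by (simp add: prime_CHAR_semidom)
  moreover have "CHAR('a) dvd p ^ n" using CHAR_dvd_CARD[where ?'a = 'a] pn(3) by simp
  ultimately have "CHAR('a) = p" using pn by (metis prime_dvd_power primes_dvd_imp_eq)
  thus thesis using pn that by blast
qed

lemma additive_polynomial_kernel: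
  fixes a :: "nat \<Rightarrow> 'a::finite_field"
  assumes r: "r > 1" and j: "j < n" "a j \<noteq> 0"
  shows "card {x. (\<Sum>i<n. a i * x ^ (r ^ i)) = 0} \<le> r ^ (n - 1)"
proof -
  define p where "p = (\<Sum>i<n. Polynomial.monom (a i) (r ^ i))"
  have "Polynomial.coeff p (r ^ j) = (\<Sum>i<n. if i = j then a j else 0)"
    unfolding p_def Polynomial.coeff_sum using r by (intro sum.cong) auto
  hence "Polynomial.coeff p (r ^ j) \<noteq> 0" using j by simp
  hence p0: "p \<noteq> 0" by auto
  have "Polynomial.degree p \<le> r ^ (n - 1)"
    unfolding p_def
  proof (rule degree_sum_le)
    fix i assume "i \<in> {..<n}"
    hence "r ^ i \<le> r ^ (n - 1)" using r by (intro power_increasing) auto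
    thus "Polynomial.degree (Polynomial.monom (a i) (r ^ i)) \<le> r ^ (n - 1)"
      using degree_monom_le[of "a i" "r ^ i"] by linarith
  qed simp
  moreover have "{x. (\<Sum>i<n. a i * x ^ (r ^ i)) = 0} = {x. poly p x = 0}"
    by (simp add: p_def poly_sum poly_monom)
  ultimately show ?thesis using card_poly_roots_bound[OF p0] by simp
qed

text \<open>The prime field already supplies as many fixed points as \<open>x ^ p - x\<close> can
  have roots.\<close>

lemma Frobenius_fixed_of_nat:
  fixes y :: "'a::finite_field"
  assumes y: "y ^ CHAR('a) = y"
  shows "y \<in> range of_nat"
proof -
  define p where "p = CHAR('a)"
  have p: "prime p" by (simp add: p_def prime_CHAR_semidom)
  hence p1: "p > 1" by (rule prime_gt_1_nat)
  have pow: "(of_nat n :: 'a) ^ p = of_nat n" for n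
    using p by (induction n) (auto simp: freshmans_dream p_def prime_gt_0_nat)
  have inj: "inj_on (of_nat :: nat \<Rightarrow> 'a) {..<p}"
    by (auto simp: inj_on_def of_nat_eq_iff_cong_CHAR p_def[symmetric] cong_def)
  have "card {x::'a. x ^ p = x} \<le> p"
    using additive_polynomial_kernel[OF p1, of 0 2 "\<lambda>i. if i = 0 then - 1 else (1::'a)"]
    by (simp add: numeral_2_eq_2)
  also have "p = card ((of_nat :: nat \<Rightarrow> 'a) ` {..<p})" using inj by (simp add: card_image)
  finally have "(of_nat :: nat \<Rightarrow> 'a) ` {..<p} = {x. x ^ p = x}"
    using pow by (intro card_seteq) auto
  thus ?thesis using y by (auto simp: p_def)
qed

text \<open>The absolute trace to the prime field, followed by powers of a primitive
  \<open>p\<close>-th root of unity.\<close>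

lemma nontrivial_additive_character:
  assumes "primepow CARD('k)"
  obtains \<psi> :: "'k::finite_field \<Rightarrow> complex" where "\<And>x y. \<psi> (x + y) = \<psi> x * \<psi> y" "\<And>x. norm (\<psi> x) = 1" "\<exists>x. \<psi> x \<noteq> 1"
proof -
  define p where "p = CHAR('k)"
  obtain n where n: "n > 0" "CARD('k) = p ^ n"
    using finite_field_card_CHAR_power[OF assms] unfolding p_def .
  have p: "prime p" by (simp add: p_def prime_CHAR_semidom)
  hence p1: "p > 1" by (rule prime_gt_1_nat)
  define tr where "tr x = (\<Sum>i<n. x ^ (p ^ i))" for x :: 'k
  have frob: "(x + y) ^ (p ^ i) = x ^ (p ^ i) + y ^ (p ^ i)" for x y :: 'k and i
    using p by (intro freshmans_dream') (auto simp: p_def)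
  have tr_add: "tr (x + y) = tr x + tr y" for x y
    by (simp add: tr_def frob sum.distrib)
  have "tr x ^ p = tr x" for x
  proof -
    have "tr x ^ p = (\<Sum>i<n. (x ^ (p ^ i)) ^ p)"
      unfolding tr_def using p by (intro freshmans_dream_sum) (auto simp: p_def)
    also have "\<dots> = (\<Sum>i<n. x ^ (p ^ Suc i))" by (simp add: power_mult[symmetric] mult.commute)
    also have "\<dots> = (\<Sum>i<Suc n. x ^ (p ^ i)) - x" by (subst sum.lessThan_Suc_shift) simp
    also have "\<dots> = tr x" using finite_field_power_card_eq_same[of x] n by (simp add: tr_def)
    finally show ?thesis .
  qed
  hence rng: "tr x \<in> range of_nat" for x by (intro Frobenius_fixed_of_nat) (simp add: p_def)
  \<comment> \<open>Only the residue of \<open>N x\<close> modulo \<open>p\<close> is determined,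
    which suffices because \<open>w ^ p = 1\<close>.\<close>
  define N where "N x = (SOME j. tr x = of_nat j)" for x
  have N: "of_nat (N x) = tr x" for x
    unfolding N_def using rng[of x] by (metis (mono_tags, lifting) imageE someI)
  define w where "w = cis (2 * pi / real p)"
  have wp: "w ^ p = 1" using p1 by (simp add: w_def DeMoivre)
  show thesis
  proof (rule that[of "\<lambda>x. w ^ N x"])
    fix x y
    have "of_nat (N (x + y)) = (of_nat (N x + N y) :: 'k)" by (simp add: N tr_add)
    hence "[N (x + y) = N x + N y] (mod p)" by (simp only: of_nat_eq_iff_cong_CHAR p_def)
    hence "N (x + y) mod p = (N x + N y) mod p" by (simp only: cong_def)
    hence "w ^ N (x + y) = w ^ (N x + N y)" by (metis power_root_of_unity_mod wp)
    thus "w ^ N (x + y) = w ^ N x * w ^ N y" by (simp add: power_add)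
    show "norm (w ^ N x) = 1" by (simp add: norm_power w_def)
  next
    have "\<exists>x. tr x \<noteq> 0"
    proof (rule ccontr)
      assume "\<nexists>x. tr x \<noteq> 0"
      hence "{x. tr x = 0} = UNIV" by auto
      moreover have "card {x. tr x = 0} \<le> p ^ (n - 1)"
        using additive_polynomial_kernel[OF p1 n(1), of "\<lambda>_. 1"] by (simp add: tr_def)
      moreover have "p ^ (n - 1) < p ^ n" using n p1 by (intro power_strict_increasing) auto
      ultimately show False using n by simp
    qed
    then obtain x where x: "tr x \<noteq> 0" by blast
    define r where "r = N x mod p"
    have r: "0 < r" "r < p"
      using x N[of x] p1 by (auto simp: r_def p_def of_nat_eq_0_iff_char_dvd mod_greater_zero_iff_not_dvd)
    have "w ^ N x = w ^ r" using power_root_of_unity_mod[OF wp, of "N x"] by (simp add: r_def)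
    moreover have "w ^ r \<noteq> 1"
    proof
      assume "w ^ r = 1"
      hence "cis (real r * (2 * pi / real p)) = 1" by (simp add: w_def DeMoivre)
      hence c: "cos (real r * (2 * pi / real p)) = 1" by (simp add: complex_eq_iff)
      then obtain z :: int where "real r * (2 * pi / real p) = real_of_int z * 2 * pi"
        using cos_one_2pi_int by blast
      hence "real r = real_of_int z * real p" using r by (simp add: field_simps)
      hence "int r = z * int p" by (metis of_int_eq_iff of_int_mult of_int_of_nat_eq)
      hence "p dvd r" by (metis dvd_triv_right int_dvd_int_iff)
      thus False using r by (auto dest: dvd_imp_le)
    qed
    ultimately show "\<exists>x. w ^ N x \<noteq> 1" by metis
  qed
qed

subsection \<open>Trace forms\<close>

locale trace_space = finite_space "ext_scale h" \<psi>
  for h :: "'k::finite_field \<Rightarrow> 'v::finite_field" and \<psi> :: "'k \<Rightarrow> complex" +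
  fixes m :: nat
  assumes h: "field_embedding h" and primepow_card: "primepow CARD('k)"
    and card_ext: "CARD('v) = CARD('k) ^ m" and odd_m: "odd m"
begin

abbreviation "Tr \<equiv> rel_trace h m"

lemma m_pos: "m > 0"
  using odd_m by (cases m) auto

lemma h_simps: "h 0 = 0" "h 1 = 1" "h (a + b) = h a + h b" "h (a * b) = h a * h b"
  using h field_embedding_zero[OF h] by (auto simp: field_embedding_def)

lemma h_eq_iff: "h a = h b \<longleftrightarrow> a = b"
  using field_embedding_inj[OF h] by (auto simp: inj_def)

lemma h_power: "h (a ^ n) = h a ^ n"
  by (induction n) (auto simp: h_simps)

lemma h_Tr: "h (Tr y) = (\<Sum>i=1..m. y ^ (CARD('k) ^ i))"
  using embed_rel_trace[OF h primepow_card card_ext m_pos] .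

lemma q_power_fixed: "(c::'k) ^ (CARD('k) ^ i) = c"
  using finite_field_power_card_power_eq_same[of "CARD('k) ^ i" i c] by simp

lemma ext_power_fixed: "(x::'v) ^ (CARD('k) ^ m) = x"
  using finite_field_power_card_eq_same[of x] card_ext by simp

lemma Frobenius_periodic: "(x::'v) ^ (CARD('k) ^ (i + m)) = x ^ (CARD('k) ^ i)"
  by (simp add: power_add power_mult ext_power_fixed)

lemma char_ext: obtains k where "prime CHAR('v)" "CARD('k) = CHAR('v) ^ k"
proof -
  obtain n where n: "n > 0" "CARD('k) = CHAR('k) ^ n" using finite_field_card_CHAR_power[OF primepow_card] .
  have pk: "prime CHAR('k)" and pv: "prime CHAR('v)" by (simp_all add: prime_CHAR_semidom)
  have "CHAR('v) dvd (CHAR('k) ^ n) ^ m" using CHAR_dvd_CARD[where ?'a = 'v] card_ext n by simp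
  hence "CHAR('v) dvd CHAR('k)" using pv prime_dvd_power by blast
  hence "CHAR('v) = CHAR('k)" using primes_dvd_imp_eq[OF pv pk] by blast
  thus thesis using that pv n by simp
qed

lemma Frobenius_add: "((x::'v) + y) ^ (CARD('k) ^ i) = x ^ (CARD('k) ^ i) + y ^ (CARD('k) ^ i)"
proof -
  obtain k where k: "prime CHAR('v)" "CARD('k) = CHAR('v) ^ k" by (rule char_ext)
  show ?thesis by (rule freshmans_dream'[OF k(1), of _ "k * i"]) (simp add: k(2) power_mult)
qed

lemma Frobenius_sum: "(\<Sum>a\<in>A. f a :: 'v) ^ (CARD('k) ^ i) = (\<Sum>a\<in>A. f a ^ (CARD('k) ^ i))"
proof -
  obtain k where k: "prime CHAR('v)" "CARD('k) = CHAR('v) ^ k" by (rule char_ext)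
  show ?thesis by (rule freshmans_dream_sum'[OF k(1), of _ "k * i"]) (simp add: k(2) power_mult)
qed

lemma Tr_add: "Tr (x + y) = Tr x + Tr y"
proof -
  have "h (Tr (x + y)) = h (Tr x + Tr y)" by (simp add: h_Tr h_simps Frobenius_add sum.distrib)
  thus ?thesis by (simp add: h_eq_iff)
qed

lemma Tr_scale: "Tr (h c * x) = c * Tr x"
proof -
  have "h (Tr (h c * x)) = h (c * Tr x)"
    by (simp add: h_Tr h_simps power_mult_distrib h_power[symmetric] q_power_fixed sum_distrib_left)
  thus ?thesis by (simp add: h_eq_iff)
qed

lemma Tr_0: "Tr 0 = 0"
  using Tr_scale[of 0 0] by (simp add: h_simps)

lemma Tr_diff: "Tr (x - y) = Tr x - Tr y"
  using Tr_add[of "x - y" y] by simp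

lemma Tr_sum: "Tr (sum f A) = (\<Sum>i\<in>A. Tr (f i))"
  by (induction A rule: infinite_finite_induct) (auto simp: Tr_0 Tr_add)

lemma sum_periodic:
  fixes g :: "nat \<Rightarrow> 'a::comm_monoid_add"
  assumes "\<And>i. g (i + m) = g i"
  shows "(\<Sum>i<m. g (i + s)) = (\<Sum>i<m. g i)"
proof (induction s)
  case (Suc s)
  obtain n where n: "m = Suc n" using m_pos by (cases m) auto
  have "(\<Sum>i<m. g (i + Suc s)) = (\<Sum>i<n. g (Suc i + s)) + g (s + m)" by (simp add: n add.commute)
  also have "\<dots> = g (0 + s) + (\<Sum>i<n. g (Suc i + s))" unfolding assms by (simp add: add.commute)
  also have "\<dots> = (\<Sum>i<m. g (i + s))" unfolding n by (rule sum.lessThan_Suc_shift[symmetric])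
  finally show ?case using Suc by simp
qed simp

lemma h_Tr': "h (Tr y) = (\<Sum>i<m. y ^ (CARD('k) ^ i))"
proof -
  have "h (Tr y) = (\<Sum>i<m. y ^ (CARD('k) ^ (i + 1)))"
    unfolding h_Tr by (rule sum.reindex_bij_witness[of _ "\<lambda>i. i + 1" "\<lambda>i. i - 1"]) auto
  thus ?thesis using sum_periodic[of "\<lambda>i. y ^ (CARD('k) ^ i)" 1] Frobenius_periodic by simp
qed

lemma Tr_Frobenius: "Tr (y ^ (CARD('k) ^ i)) = Tr y"
proof -
  have "h (Tr (y ^ (CARD('k) ^ i))) = (\<Sum>j<m. y ^ (CARD('k) ^ (j + i)))"
    by (simp add: h_Tr' power_mult[symmetric] power_add[symmetric] add.commute)
  also have "\<dots> = h (Tr y)"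
    using sum_periodic[of "\<lambda>i. y ^ (CARD('k) ^ i)" i] Frobenius_periodic by (simp add: h_Tr')
  finally show ?thesis by (simp add: h_eq_iff)
qed

lemma q_poly_kernel:
  fixes a :: "nat \<Rightarrow> 'v"
  assumes "j < n" "a j \<noteq> 0"
  shows "card {x. (\<Sum>i<n. a i * x ^ (CARD('k) ^ i)) = 0} \<le> CARD('k) ^ (n - 1)"
  using additive_polynomial_kernel[of "CARD('k)" j n a] assms q_gt_1 by simp

lemma q_poly_zero:
  fixes a :: "nat \<Rightarrow> 'v"
  assumes "\<And>x. (\<Sum>i<m. a i * x ^ (CARD('k) ^ i)) = 0" "j < m"
  shows "a j = 0"
proof (rule ccontr)
  assume "a j \<noteq> 0"
  hence "CARD('k) ^ m \<le> CARD('k) ^ (m - 1)" using q_poly_kernel[of j m a] assms by (simp add: card_ext)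
  hence "m \<le> m - 1" using q_gt_1 by (simp only: power_increasing_iff)
  thus False using m_pos by simp
qed

text \<open>Otherwise the trace would vanish identically, against the root bound for a polynomial of
  degree \<open>q ^ (m - 1)\<close>.\<close>

lemma Tr_nondegenerate:
  fixes x :: 'v
  assumes "\<And>y. Tr (x * y) = 0"
  shows "x = 0"
proof (rule ccontr)
  assume x: "x \<noteq> 0"
  have "(\<Sum>i<m. 1 * y ^ (CARD('k) ^ i)) = 0" for y :: 'v
    using assms[of "y / x"] x h_Tr'[of y] by (simp add: h_simps)
  from q_poly_zero[OF this, of 0] m_pos show False by simp
qed

lemma dim_ext: "dim UNIV = m"
proof -
  have "CARD('k) ^ dim UNIV = CARD('k) ^ m" using card_subspace[OF subspace_UNIV] card_ext by simp
  thus ?thesis using q_gt_1 by (simp only: power_inject_exp)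
qed

lemma functional_Tr:
  assumes "f \<in> lf UNIV"
  obtains b where "f = (\<lambda>x. Tr (b * x))"
proof -
  define F where "F b = (\<lambda>x. Tr (b * x))" for b
  have "inj F"
  proof (rule injI)
    fix b c assume "F b = F c"
    hence "Tr (b * y) = Tr (c * y)" for y by (simp add: F_def fun_eq_iff)
    hence "Tr ((b - c) * y) = 0" for y by (simp add: left_diff_distrib Tr_diff)
    thus "b = c" using Tr_nondegenerate[of "b - c"] by simp
  qed
  hence "card (range F) = card (lf UNIV)" by (simp add: card_image card_lf subspace_UNIV)
  moreover have "range F \<subseteq> lf UNIV"
  proof clarify
    fix b
    have "Tr (b * (h c * x)) = c * Tr (b * x)" for c x
      using Tr_scale[of c "b * x"] by (simp add: mult_ac)
    thus "F b \<in> lf UNIV" by (simp add: F_def lf_def ext_scale_def distrib_left Tr_add)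
  qed
  ultimately have "range F = lf UNIV" by (intro card_subset_eq) auto
  thus thesis using assms that by (auto simp: F_def)
qed

definition tform :: "nat \<Rightarrow> (nat \<Rightarrow> 'v) \<Rightarrow> 'v \<Rightarrow> 'k" where
  "tform t f x = (\<Sum>i=t..(m - 1) div 2. Tr (f i * x ^ (CARD('k) ^ i + 1)))"

lemma trace_forms_eq: "trace_forms h m d = range (tform ((d - 1) div 2))"
  by (auto simp: trace_forms_def tform_def fun_eq_iff)

lemma tform_add: "tform t f + tform t g = tform t (\<lambda>i. f i + g i)"
  by (simp add: fun_eq_iff tform_def distrib_right Tr_add sum.distrib)

lemma tform_scale: "(\<lambda>x. c * tform t f x) = tform t (\<lambda>i. h c * f i)"
proof
  fix x
  have "Tr (h c * f i * x ^ (CARD('k) ^ i + 1)) = c * Tr (f i * x ^ (CARD('k) ^ i + 1))" for i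
    using Tr_scale[of c "f i * x ^ (CARD('k) ^ i + 1)"] by (simp add: mult_ac)
  thus "c * tform t f x = tform t (\<lambda>i. h c * f i) x" by (simp add: tform_def sum_distrib_left)
qed

lemma polar_tform:
  "polar (tform t f) x y = (\<Sum>i=t..(m - 1) div 2. Tr (f i * (x ^ (CARD('k) ^ i) * y + y ^ (CARD('k) ^ i) * x)))"
proof -
  have "Tr (f i * (x + y) ^ (CARD('k) ^ i + 1)) - Tr (f i * x ^ (CARD('k) ^ i + 1)) - Tr (f i * y ^ (CARD('k) ^ i + 1))
      = Tr (f i * (x ^ (CARD('k) ^ i) * y + y ^ (CARD('k) ^ i) * x))" for i
  proof -
    have "f i * (x + y) ^ (CARD('k) ^ i + 1)
      = f i * (x ^ (CARD('k) ^ i) * y + y ^ (CARD('k) ^ i) * x) + (f i * x ^ (CARD('k) ^ i + 1) + f i * y ^ (CARD('k) ^ i + 1))"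
      unfolding power_add Frobenius_add by (simp add: algebra_simps)
    thus ?thesis by (simp add: Tr_add)
  qed
  thus ?thesis by (simp add: polar_def tform_def sum_subtractf[symmetric])
qed

lemma tform_quad: "tform t f \<in> quad UNIV"
proof -
  have s: "tform t f (h c * x) = c\<^sup>2 * tform t f x" for c x
  proof -
    have "Tr (f i * (h c * x) ^ (CARD('k) ^ i + 1)) = c\<^sup>2 * Tr (f i * x ^ (CARD('k) ^ i + 1))" for i
    proof -
      have "f i * (h c * x) ^ (CARD('k) ^ i + 1) = h (c\<^sup>2) * (f i * x ^ (CARD('k) ^ i + 1))"
        by (simp add: power_mult_distrib h_power[symmetric] q_power_fixed h_simps power2_eq_square mult_ac)
      thus ?thesis by (simp only: Tr_scale)
    qed
    thus ?thesis by (simp add: tform_def sum_distrib_left)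
  qed
  have l: "polar (tform t f) (x + y) z = polar (tform t f) x z + polar (tform t f) y z" for x y z
    by (simp add: polar_tform Frobenius_add Tr_add[symmetric] sum.distrib[symmetric] algebra_simps)
  have c: "polar (tform t f) (h c * x) z = c * polar (tform t f) x z" for c x z
    unfolding polar_tform sum_distrib_left Tr_scale[symmetric]
    by (simp add: power_mult_distrib h_power[symmetric] q_power_fixed algebra_simps)
  have l': "polar (tform t f) z (x + y) = polar (tform t f) z x + polar (tform t f) z y" for x y z
    using l polar_commute by metis
  have c': "polar (tform t f) z (h c * x) = c * polar (tform t f) z x" for c x z
    using c polar_commute by metis
  show ?thesis
    using s l c l' c' by (simp add: quad_def qf_def bilin_def ext_scale_def)
qed

text \<open>The polar form is the trace of \<open>y\<close> times a \<open>q\<close>-polynomial in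
  \<open>x\<close>, which must vanish. Because \<open>m\<close> is odd, the exponents
  \<open>j\<close> and \<open>m - j\<close> with \<open>0 < j \<le> M\<close> are all distinct, so
  each \<open>f j\<close> can be read off as a coefficient.\<close>

lemma tform_0_eq_zero:
  assumes "\<And>x. tform 0 f x = 0" "i \<le> (m - 1) div 2"
  shows "f i = 0"
proof -
  define M where "M = (m - 1) div 2"
  have m: "m = 2 * M + 1" using odd_m by (auto simp: M_def elim!: oddE)
  define a where "a j = (if j = 0 then 2 * f 0 else if j \<le> M then f j else f (m - j) ^ (CARD('k) ^ j))" for j
  have "(\<Sum>j<m. a j * x ^ (CARD('k) ^ j)) = 0" for x
  proof (rule Tr_nondegenerate)
    fix y
    \<comment> \<open>Applying the Frobenius power \<open>m - j\<close> inside the trace frees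
      \<open>y\<close>; this is the origin of the conjugated entries of \<open>a\<close>.\<close>
    have eq: "Tr (f j * (x ^ (CARD('k) ^ j) * y + y ^ (CARD('k) ^ j) * x))
        = Tr ((f j * x ^ (CARD('k) ^ j) + f j ^ (CARD('k) ^ (m - j)) * x ^ (CARD('k) ^ (m - j))) * y)" if "j \<le> M" for j
    proof -
      have "j + (m - j) = m" using that m by simp
      hence yj: "(y ^ (CARD('k) ^ j)) ^ (CARD('k) ^ (m - j)) = y"
        by (simp only: power_mult[symmetric] power_add[symmetric] ext_power_fixed)
      have "Tr (f j * y ^ (CARD('k) ^ j) * x) = Tr ((f j * y ^ (CARD('k) ^ j) * x) ^ (CARD('k) ^ (m - j)))"
        by (simp only: Tr_Frobenius)
      also have "(f j * y ^ (CARD('k) ^ j) * x) ^ (CARD('k) ^ (m - j)) = f j ^ (CARD('k) ^ (m - j)) * x ^ (CARD('k) ^ (m - j)) * y"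
        by (simp add: power_mult_distrib yj mult_ac)
      finally have "Tr (f j * y ^ (CARD('k) ^ j) * x) = Tr (f j ^ (CARD('k) ^ (m - j)) * x ^ (CARD('k) ^ (m - j)) * y)" .
      thus ?thesis by (simp add: distrib_left distrib_right Tr_add mult.assoc[symmetric])
    qed
    have "0 = polar (tform 0 f) x y" by (simp add: polar_def assms)
    also have "\<dots> = (\<Sum>j=0..M. Tr ((f j * x ^ (CARD('k) ^ j) + f j ^ (CARD('k) ^ (m - j)) * x ^ (CARD('k) ^ (m - j))) * y))"
      unfolding polar_tform M_def[symmetric] by (intro sum.cong) (auto simp: eq)
    also have "\<dots> = Tr ((\<Sum>j=0..M. f j * x ^ (CARD('k) ^ j) + f j ^ (CARD('k) ^ (m - j)) * x ^ (CARD('k) ^ (m - j))) * y)"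
      by (simp add: Tr_sum[symmetric] sum_distrib_right)
    also have "(\<Sum>j=0..M. f j * x ^ (CARD('k) ^ j) + f j ^ (CARD('k) ^ (m - j)) * x ^ (CARD('k) ^ (m - j))) = (\<Sum>j<m. a j * x ^ (CARD('k) ^ j))"
    proof -
      have "(\<Sum>j<m. a j * x ^ (CARD('k) ^ j)) = (\<Sum>j\<in>{0} \<union> ({1..M} \<union> {M+1..<m}). a j * x ^ (CARD('k) ^ j))"
        using m by (intro sum.cong) auto
      also have "\<dots> = 2 * f 0 * x + ((\<Sum>j=1..M. a j * x ^ (CARD('k) ^ j)) + (\<Sum>j=M+1..<m. a j * x ^ (CARD('k) ^ j)))"
        by (subst sum.union_disjoint, simp, simp, simp, subst sum.union_disjoint) (auto simp: a_def)
      also have "(\<Sum>j=1..M. a j * x ^ (CARD('k) ^ j)) = (\<Sum>j=1..M. f j * x ^ (CARD('k) ^ j))"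
        by (intro sum.cong) (auto simp: a_def)
      also have "(\<Sum>j=M+1..<m. a j * x ^ (CARD('k) ^ j)) = (\<Sum>j=1..M. f j ^ (CARD('k) ^ (m - j)) * x ^ (CARD('k) ^ (m - j)))"
        by (rule sum.reindex_bij_witness[of _ "\<lambda>j. m - j" "\<lambda>j. m - j"]) (auto simp: a_def m)
      finally have "(\<Sum>j<m. a j * x ^ (CARD('k) ^ j)) = 2 * f 0 * x
          + (\<Sum>j=1..M. f j * x ^ (CARD('k) ^ j) + f j ^ (CARD('k) ^ (m - j)) * x ^ (CARD('k) ^ (m - j)))"
        by (simp add: sum.distrib)
      thus ?thesis by (simp add: sum.atLeast_Suc_atMost[of 0 M] ext_power_fixed)
    qed
    finally show "Tr ((\<Sum>j<m. a j * x ^ (CARD('k) ^ j)) * y) = 0" by simp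
  qed
  hence a0: "a j = 0" if "j < m" for j using q_poly_zero that by blast
  have f: "f j = 0" if "0 < j" "j \<le> M" for j using a0[of j] that m by (simp add: a_def)
  have "tform 0 f x = Tr (f 0 * x\<^sup>2)" for x
    unfolding tform_def M_def[symmetric] using f
    by (simp add: sum.atLeast_Suc_atMost[of 0 M] Tr_0 power2_eq_square)
  hence T: "Tr (f 0 * x\<^sup>2) = 0" for x using assms by simp
  have "f 0 = 0"
  \<comment> \<open>The polar form only knows \<open>2 * f 0\<close>. In characteristic 2 the form
    itself decides, since squares exhaust the field.\<close>
  proof (cases "(2::'v) = 0")
    case True
    show ?thesis
    proof (rule Tr_nondegenerate)
      fix y :: 'v
      obtain c where "c\<^sup>2 = y" by (rule square_surj_char_2[OF True, of y])
      thus "Tr (f 0 * y) = 0" using T[of c] by simp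
    qed
  next
    case False
    thus ?thesis using a0[of 0] m by (simp add: a_def)
  qed
  thus ?thesis using f assms(2) by (cases "i = 0") (auto simp: M_def)
qed

lemma tform_inj:
  assumes "tform t f = tform t g" "t \<le> i" "i \<le> (m - 1) div 2"
  shows "f i = g i"
proof -
  define f' where "f' j = (if t \<le> j then f j - g j else 0)" for j
  have "tform 0 f' x = 0" for x
  proof -
    have "tform 0 f' x = (\<Sum>i=t..(m - 1) div 2. Tr ((f i - g i) * x ^ (CARD('k) ^ i + 1)))"
      unfolding tform_def by (rule sum.mono_neutral_cong_right) (auto simp: f'_def Tr_0)
    also have "\<dots> = tform t f x - tform t g x"
    proof -
      show ?thesis by (simp add: tform_def sum_subtractf left_diff_distrib Tr_diff)
    qed
    finally show ?thesis using assms(1) by simp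
  qed
  hence "f' i = 0" using assms by (intro tform_0_eq_zero[of f' i]) auto
  thus ?thesis using assms by (simp add: f'_def)
qed

lemma card_tforms:
  assumes "2 * t + 1 \<le> m"
  shows "card (range (tform t)) = CARD('k) ^ (m * ((m + 1) div 2 - t))"
proof -
  define I where "I = {t..(m - 1) div 2}"
  define E where "E = PiE I (\<lambda>_. UNIV :: 'v set)"
  have "range (tform t) = tform t ` E"
  proof (intro Set.set_eqI iffI)
    fix Q assume "Q \<in> range (tform t)"
    then obtain f where f: "Q = tform t f" by blast
    have "tform t f = tform t (restrict f I)" by (simp add: fun_eq_iff tform_def I_def)
    thus "Q \<in> tform t ` E" using f by (auto simp: E_def)
  qed auto
  moreover have "inj_on (tform t) E"
  proof (rule inj_onI)
    fix f g assume fg: "f \<in> E" "g \<in> E" "tform t f = tform t g"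
    show "f = g"
    proof
      fix i show "f i = g i"
      proof (cases "i \<in> I")
        case True
        thus ?thesis using tform_inj[OF fg(3), of i] by (simp add: I_def)
      next
        case False
        show ?thesis
          using PiE_arb[OF fg(1)[unfolded E_def] False] PiE_arb[OF fg(2)[unfolded E_def] False] by (rule trans[OF _ sym])
      qed
    qed
  qed
  ultimately have "card (range (tform t)) = card E" by (simp add: card_image)
  also have "\<dots> = CARD('v) ^ card I" by (simp add: E_def card_PiE I_def)
  also have "card I = (m + 1) div 2 - t" using assms odd_m by (auto simp: I_def elim!: oddE)
  finally show ?thesis by (simp add: card_ext power_mult)
qed

text \<open>By counting: \<open>card_quad\<close>, read off from the transform at 0, equals the
  number of coefficient families.\<close>

lemma range_tform_0: "range (tform 0) = quad UNIV"
proof (rule card_subset_eq)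
  show "range (tform 0) \<subseteq> quad UNIV" using tform_quad by auto
  show "card (range (tform 0)) = card (quad UNIV)"
    using card_tforms[of 0] card_quad odd_m m_pos by (simp add: dim_ext)
qed simp

text \<open>\<open>Lam UNIV \<mu>\<close> sees a trace form only through these elements
  (\<open>Lam_tform\<close>), and they are the coefficients of the \<open>q\<close>-polynomial
  representing \<open>bil UNIV \<mu>\<close> under the trace pairing
  (\<open>bil_Tr\<close>).\<close>

definition mcoeff :: "('v \<Rightarrow> 'k) \<Rightarrow> nat \<Rightarrow> 'v" where
  "mcoeff \<mu> i = (\<Sum>v\<in>UNIV. h (\<mu> v) * v ^ (CARD('k) ^ i + 1))"

lemma Lam_tform: "Lam UNIV \<mu> (tform t f) = (\<Sum>i=t..(m - 1) div 2. Tr (f i * mcoeff \<mu> i))"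
proof -
  have "Tr (f i * mcoeff \<mu> i) = (\<Sum>v\<in>UNIV. \<mu> v * Tr (f i * v ^ (CARD('k) ^ i + 1)))" for i
    by (simp add: mcoeff_def sum_distrib_left Tr_sum Tr_scale[symmetric] mult_ac)
  thus ?thesis unfolding Lam_def tform_def
    by (simp add: sum_distrib_left) (rule sum.swap)
qed

lemma annih_tform: "\<mu> \<in> annih (range (tform t)) \<longleftrightarrow> (\<forall>i\<in>{t..(m - 1) div 2}. mcoeff \<mu> i = 0)"
proof
  assume *: "\<forall>i\<in>{t..(m - 1) div 2}. mcoeff \<mu> i = 0"
  thus "\<mu> \<in> annih (range (tform t))" by (simp add: annih_def Lam_tform Tr_0)
next
  assume *: "\<mu> \<in> annih (range (tform t))"
  show "\<forall>i\<in>{t..(m - 1) div 2}. mcoeff \<mu> i = 0"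
  proof
    fix i assume i: "i \<in> {t..(m - 1) div 2}"
    show "mcoeff \<mu> i = 0"
    proof (rule Tr_nondegenerate)
      fix y
      have "0 = Lam UNIV \<mu> (tform t (\<lambda>j. if j = i then y else 0))" using * by (simp add: annih_def)
      also have "\<dots> = (\<Sum>j=t..(m - 1) div 2. if j = i then Tr (y * mcoeff \<mu> i) else 0)"
        unfolding Lam_tform by (intro sum.cong) (auto simp: Tr_0)
      finally show "Tr (mcoeff \<mu> i * y) = 0" using i by (simp add: mult.commute)
    qed
  qed
qed

lemma mcoeff_periodic: "mcoeff \<mu> (i + m) = mcoeff \<mu> i"
  by (simp add: mcoeff_def Frobenius_periodic)

lemma mcoeff_symmetric:
  assumes "i \<le> m"
  shows "mcoeff \<mu> (m - i) = mcoeff \<mu> i ^ (CARD('k) ^ (m - i))"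
proof -
  have "(v ^ (CARD('k) ^ i)) ^ (CARD('k) ^ (m - i)) = v" for v :: 'v
    using assms by (simp add: power_mult[symmetric] power_add[symmetric] ext_power_fixed)
  thus ?thesis
    by (simp add: mcoeff_def Frobenius_sum power_mult_distrib h_power[symmetric] q_power_fixed mult_ac)
qed

lemma bil_Tr:
  "bil UNIV \<mu> (\<lambda>x. Tr (b * x)) (\<lambda>x. Tr (a * x)) = Tr (a * (\<Sum>i<m. mcoeff \<mu> i * b ^ (CARD('k) ^ i)))"
proof -
  have "(\<Sum>i<m. mcoeff \<mu> i * b ^ (CARD('k) ^ i)) = (\<Sum>v\<in>UNIV. h (\<mu> v) * (v * h (Tr (b * v))))"
    unfolding mcoeff_def h_Tr' sum_distrib_right sum_distrib_left
    by (subst sum.swap) (simp add: power_mult_distrib mult_ac)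
  hence "Tr (a * (\<Sum>i<m. mcoeff \<mu> i * b ^ (CARD('k) ^ i))) = (\<Sum>v\<in>UNIV. Tr (h (\<mu> v) * (h (Tr (b * v)) * (a * v))))"
    by (simp add: sum_distrib_left Tr_sum mult_ac)
  thus ?thesis by (simp add: bil_def Tr_scale)
qed

text \<open>
  The radical of the form dual to an annihilator of trace forms consists of roots of a
  \<open>q\<close>-polynomial which, after a cyclic shift of the exponents, has \<open>q\<close>-degree at most \<open>2 t - 2\<close>.
\<close>

lemma card_bil_rad_annih:
  assumes t: "2 * t + 1 \<le> m" and \<mu>: "\<mu> \<in> annih (range (tform t))" "\<mu> \<notin> annih (quad UNIV)"
  shows "card (bil_rad UNIV \<mu>) * CARD('k) ^ 2 \<le> CARD('k) ^ (2 * t)"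
proof -
  define M where "M = (m - 1) div 2"
  have m: "m = 2 * M + 1" using odd_m by (auto simp: M_def elim!: oddE)
  define z where "z = mcoeff \<mu>"
  have z1: "z i = 0" if "t \<le> i" "i \<le> M" for i
    using \<mu>(1) that by (simp add: annih_tform z_def M_def)
  \<comment> \<open>The symmetry between \<open>i\<close> and \<open>m - i\<close> reflects the
    vanishing range at the middle \<open>M\<close>.\<close>
  have z0: "z i = 0" if "t \<le> i" "i \<le> m - t" for i
  proof (cases "i \<le> M")
    case False
    have "z (m - (m - i)) = z (m - i) ^ (CARD('k) ^ (m - (m - i)))"
      unfolding z_def by (rule mcoeff_symmetric) simp
    moreover have "z (m - i) = 0" using False that m by (intro z1) auto
    ultimately show ?thesis using that q_gt_1 by simp
  qed (use z1 that in auto)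
  \<comment> \<open>Every form is a trace form with \<open>t = 0\<close>, so a nontrivial
    \<open>\<mu>\<close> has a nonzero coefficient.\<close>
  have "\<exists>i\<le>M. z i \<noteq> 0"
    using \<mu>(2) unfolding range_tform_0[symmetric] annih_tform M_def[symmetric] z_def by auto
  then obtain j where j: "j \<le> M" "z j \<noteq> 0" by blast
  hence jt: "j < t" using z1[of j] by (cases "t \<le> j") auto
  \<comment> \<open>Modulo \<open>m\<close> the possibly nonzero indices are \<open>-(t - 1)\<close>
    to \<open>t - 1\<close>; the shift by \<open>s\<close> moves these \<open>2 * t - 1\<close>
    indices to the start.\<close>
  define s where "s = m - t + 1"
  define L where "L b = (\<Sum>i<m. z i * b ^ (CARD('k) ^ i))" for b
  have L: "L b = (\<Sum>i<2 * t - 1. z (i + s) * (b ^ (CARD('k) ^ s)) ^ (CARD('k) ^ i))" for b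
  proof -
    have "L b = (\<Sum>i<m. z (i + s) * b ^ (CARD('k) ^ (i + s)))"
      unfolding L_def by (rule sum_periodic[symmetric]) (simp add: z_def mcoeff_periodic Frobenius_periodic)
    also have "\<dots> = (\<Sum>i<2 * t - 1. z (i + s) * b ^ (CARD('k) ^ (i + s)))"
    proof (rule sum.mono_neutral_right)
      show "\<forall>i\<in>{..<m} - {..<2 * t - 1}. z (i + s) * b ^ (CARD('k) ^ (i + s)) = 0"
      proof
        fix i assume i: "i \<in> {..<m} - {..<2 * t - 1}"
        have "i + s = (i + 1 - t) + m" using i jt t by (auto simp: s_def)
        hence "z (i + s) = z (i + 1 - t)" by (simp add: z_def mcoeff_periodic)
        also have "\<dots> = 0" using i by (intro z0) auto
        finally show "z (i + s) * b ^ (CARD('k) ^ (i + s)) = 0" by simp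
      qed
    qed (use t in auto)
    finally show ?thesis by (simp add: power_mult[symmetric] power_add[symmetric] add.commute)
  qed
  have "bil_rad UNIV \<mu> \<subseteq> (\<lambda>b x. Tr (b * x)) ` {b. L b = 0}"
  proof
    fix f assume f: "f \<in> bil_rad UNIV \<mu>"
    then obtain b where b: "f = (\<lambda>x. Tr (b * x))" using functional_Tr by (auto simp: bil_rad_def)
    have "Tr (L b * a) = 0" for a
    proof -
      have "(\<lambda>x. Tr (a * (h c * x))) = (\<lambda>x. c * Tr (a * x))" for c
        using Tr_scale[of c "a * _"] by (simp add: mult.left_commute)
      hence "(\<lambda>x. Tr (a * x)) \<in> lf UNIV"
        by (simp add: lf_def ext_scale_def distrib_left Tr_add fun_eq_iff)
      hence "bil UNIV \<mu> f (\<lambda>x. Tr (a * x)) = 0" using f by (simp add: bil_rad_def)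
      hence "Tr (a * L b) = 0" by (simp only: b bil_Tr L_def z_def)
      thus ?thesis by (simp only: mult.commute)
    qed
    hence "L b = 0" by (rule Tr_nondegenerate)
    thus "f \<in> (\<lambda>b x. Tr (b * x)) ` {b. L b = 0}" using b by blast
  qed
  hence "card (bil_rad UNIV \<mu>) \<le> card ((\<lambda>b x. Tr (b * x)) ` {b. L b = 0})" by (intro card_mono) auto
  also have "\<dots> \<le> card {b. L b = 0}" by (rule card_image_le) simp
  also have "\<dots> = card ((\<lambda>b. b ^ (CARD('k) ^ s)) ` {b. L b = 0})"
  proof (rule card_image[symmetric], rule inj_onI)
    fix b c :: 'v assume "b ^ (CARD('k) ^ s) = c ^ (CARD('k) ^ s)"
    hence "(b ^ (CARD('k) ^ s)) ^ (CARD('k) ^ (t - 1)) = (c ^ (CARD('k) ^ s)) ^ (CARD('k) ^ (t - 1))" by simp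
    moreover have "s + (t - 1) = m" using jt t by (simp add: s_def)
    ultimately show "b = c" by (simp add: power_mult[symmetric] power_add[symmetric] ext_power_fixed)
  qed
  also have "\<dots> \<le> card {b. (\<Sum>i<2 * t - 1. z (i + s) * b ^ (CARD('k) ^ i)) = 0}"
    using L by (intro card_mono) auto
  also have "\<dots> \<le> CARD('k) ^ (2 * t - 1 - 1)"
  \<comment> \<open>The position to which the shift moves the nonzero coefficient
    \<open>z j\<close>.\<close>
  proof (rule q_poly_kernel[of "j + t - 1"])
    show "j + t - 1 < 2 * t - 1" using jt by simp
    have "j + t - 1 + s = j + m" using jt t by (simp add: s_def)
    thus "z (j + t - 1 + s) \<noteq> 0" using j by (simp add: z_def mcoeff_periodic)
  qed
  finally have "card (bil_rad UNIV \<mu>) * CARD('k) ^ 2 \<le> CARD('k) ^ (2 * t - 1 - 1) * CARD('k) ^ 2" by (rule mult_le_mono1)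
  also have "\<dots> = CARD('k) ^ (2 * t - 1 - 1 + 2)" by (rule power_add[symmetric])
  also have "2 * t - 1 - 1 + 2 = 2 * t" using jt by simp
  finally show ?thesis .
qed

end

section \<open>Translation to the notions of the statement\<close>

lemma (in vector_space) linear_functional_iff:
  "Vector_Spaces.linear scale (*) f \<longleftrightarrow>
     (\<forall>x y. f (x + y) = f x + f y) \<and> (\<forall>c x. f (scale c x) = c * f x)"
proof -
  interpret K: vector_space "(*) :: 'a \<Rightarrow> 'a \<Rightarrow> 'a"
    by unfold_locales (auto simp: algebra_simps)
  show ?thesis
    by (auto simp: Vector_Spaces.linear_def module_hom_def module_hom_axioms_def module_axioms
        K.module_axioms vector_space_axioms K.vector_space_axioms)
qed

context finite_space
begin

lemma quadratic_form_iff: "quadratic_form scale Q \<longleftrightarrow> Q \<in> quad UNIV"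
  by (auto simp: quadratic_form_def linear_functional_iff quad_def qf_def bilin_def)

lemma qf_rank_eq: "qf_rank scale Q = rk UNIV Q"
proof -
  have "qf_radical Q = rad UNIV Q" by (auto simp: qf_radical_def rad_def brad_def)
  thus ?thesis by (simp add: qf_rank_def rk_def)
qed

lemma subgroup_qf_group:
  assumes "Y \<subseteq> quad UNIV" "0 \<in> Y" and add: "\<And>P Q. P \<in> Y \<Longrightarrow> Q \<in> Y \<Longrightarrow> P + Q \<in> Y"
    and minus: "\<And>Q. Q \<in> Y \<Longrightarrow> - Q \<in> Y"
  shows "subgroup Y (qf_group scale)"
proof -
  interpret G: comm_group "qf_group scale"
    by (rule comm_group_qf_group) (rule vector_space_axioms)
  show ?thesis
  proof (rule G.subgroupI)
    show "Y \<subseteq> carrier (qf_group scale)" using assms by (auto simp: qf_group_def quadratic_form_iff)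
    show "Y \<noteq> {}" using assms by auto
    fix P assume P: "P \<in> Y"
    have "inv\<^bsub>qf_group scale\<^esub> P = - P"
      using P assms(1) minus[OF P]
      by (intro G.inv_equality) (auto simp: qf_group_def quadratic_form_iff)
    thus "inv\<^bsub>qf_group scale\<^esub> P \<in> Y" using minus[OF P] by simp
    fix Q assume Q: "Q \<in> Y"
    have "P \<otimes>\<^bsub>qf_group scale\<^esub> Q = P + Q" by (auto simp: qf_group_def)
    thus "P \<otimes>\<^bsub>qf_group scale\<^esub> Q \<in> Y" using add[OF P Q] by simp
  qed
qed

end

theorem theorem5p4:
  fixes h :: "'k::finite_field \<Rightarrow> 'v::finite_field" and q m d :: nat
  assumes "primepow q" and "CARD('k) = q" and "CARD('v) = q ^ m" and "field_embedding h"
    and "odd m" and "odd d" and "1 \<le> d" and "d \<le> m"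
  shows "subgroup (trace_forms h m d) (qf_group (ext_scale h))
    \<and> d_code (ext_scale h) d (trace_forms h m d)
    \<and> card (trace_forms h m d) = q ^ (m * (m - d + 2) div 2)
    \<and> (\<forall>Z. d_code (ext_scale h) d Z \<longrightarrow> card Z \<le> q ^ (m * (m - d + 2) div 2))"
proof -
  obtain \<psi> :: "'k \<Rightarrow> complex" where \<psi>: "\<And>x y. \<psi> (x + y) = \<psi> x * \<psi> y" "\<And>x. norm (\<psi> x) = 1" "\<exists>x. \<psi> x \<noteq> 1"
    using nontrivial_additive_character[where 'k = 'k] assms by blast
  interpret vector_space "ext_scale h" using assms by (intro vector_space_ext_scale)
  interpret trace_space h \<psi> m
    using assms \<psi> by unfold_locales auto
  define t where "t = (d - 1) div 2"
  have d: "d = 2 * t + 1" using assms by (auto simp: t_def elim!: oddE)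
  have t: "2 * t + 1 \<le> m" using assms d by simp
  note tU = t[folded dim_ext] and oddU = \<open>odd m\<close>[folded dim_ext]
  \<comment> \<open>\<open>m - d + 2\<close> is even, as \<open>m\<close> and \<open>d\<close> are
    odd, so the division is exact.\<close>
  have exponent: "m * (m - d + 2) div 2 = m * ((m + 1) div 2 - t)"
  proof -
    obtain M where M: "m = 2 * M + 1" using \<open>odd m\<close> by (auto elim: oddE)
    have "m - d + 2 = 2 * ((m + 1) div 2 - t)" using t by (simp add: M d)
    thus ?thesis by simp
  qed
  define Y where "Y = range (tform t)"
  have Y: "trace_forms h m d = Y" by (simp add: trace_forms_eq Y_def t_def)
  have sub: "Y \<subseteq> quad UNIV" using tform_quad by (auto simp: Y_def)
  have add: "P + Q \<in> Y" if "P \<in> Y" "Q \<in> Y" for P Q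
    using that tform_add by (auto simp: Y_def)
  have scale: "(\<lambda>x. c * Q x) \<in> Y" if "Q \<in> Y" for c Q
    using that tform_scale by (auto simp: Y_def)
  have minus: "- Q \<in> Y" if "Q \<in> Y" for Q
    using scale[OF that, of "- 1"] by (simp add: fun_Compl_def)
  have zero: "0 \<in> Y"
    using scale[of "tform t (\<lambda>_. 0)" 0] by (simp add: Y_def zero_fun_def)
  have card: "card Y = q ^ (m * ((m + 1) div 2 - t))"
    unfolding Y_def card_tforms[OF t] assms(2) ..
  have rank: "d \<le> rk UNIV Q" if "Q \<in> Y" "Q \<noteq> 0" for Q
    unfolding d
    by (rule additive_code_rank[OF oddU tU sub add scale zero _ _ that])
      (use card card_bil_rad_annih[OF t] assms(2) in \<open>auto simp: dim_ext Y_def\<close>)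
  have "d_code (ext_scale h) d Y"
    unfolding d_code_def quadratic_form_iff qf_rank_eq
  proof (intro conjI ballI impI)
    fix P Q assume PQ: "P \<in> Y" "Q \<in> Y" "P \<noteq> Q"
    have "P - Q \<in> Y" using add[OF PQ(1) minus[OF PQ(2)]] by simp
    hence "d \<le> rk UNIV (P - Q)" using PQ rank by simp
    thus "d \<le> rk UNIV (\<lambda>x. P x - Q x)" by (simp add: fun_diff_def)
  qed (use sub in auto)
  moreover have "card Z \<le> q ^ (m * ((m + 1) div 2 - t))" if Z: "d_code (ext_scale h) d Z" for Z
  proof -
    have "2 * t + 1 \<le> rk UNIV (P - Q)" if "P \<in> Z" "Q \<in> Z" "P \<noteq> Q" for P Q
      using Z that unfolding d_code_def qf_rank_eq d by (simp add: fun_diff_def)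
    moreover have "Z \<subseteq> quad UNIV" using Z by (auto simp: d_code_def quadratic_form_iff)
    ultimately show ?thesis using card_code_le[OF oddU tU, of Z] assms(2) by (simp add: dim_ext)
  qed
  ultimately show ?thesis
    unfolding Y exponent using subgroup_qf_group[OF sub zero add minus] card by blast
qed

end
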